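(* Consider the iterates of Algorithm SPSA1-A (described in the context), with noise satisfying $E[\varepsilon_k^{+}-\varepsilon_k^{-}\mid\mathscr{F}_k,\xi_k]=0$ almost surely for all $k$. Let $x^*\in\mathbb{R}^n$ and assume: (1) $a_k>0$, $c_k>0$ for all $k$; $a_k\to0$ and $c_k\to 0$ as $k\to\infty$; $\sum_{k=0}^\infty a_k=\infty$ and $\sum_{k=0}^\infty (a_k/c_k)^2<\infty$. (2) There exist $\alpha_0>0$, $\alpha_1>0$ such that for all $k$, $E(\varepsilon_k^{\pm})^2\le\alpha_0$ and $E\big(f(\hat x_k\pm c_k\xi_k)\big)^2\le\alpha_1$. (3) $\sup_k\|\hat x_k\|<\infty$ almost surely. (4) $x^*$ is an asymptotically stable solution of the differential equation $d\phi(t)/dt=-g(\phi)$. (5) Let $D(x^* )=\{\phi_0:\lim_{t\to\infty}\phi(t|\phi_0)=x^*\}$, where $\phi(t|\phi_0)$ denotes the solution of the differential equation in (4) with initial condition $\phi_0$. There exists a compact set $S\subseteq D(x^* )$ such that $\hat x_k\in S$ infinitely often for almost all sample points. (6) There is an index $K<\infty$ and a constant $r>0$ such that $f^{(3)}(x)=\partial^3 f/(\partial x^T)^3$ is continuous and element-wise bounded in $\{x:\|x-\hat x_k\|<r\}$ for all $k\ge K$. Then, as $k\to\infty$, $$\hat x_k\to x^*\quad\text{for almost all }\omega\in\Omega.$$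
   Context: Setting. $f:\mathbb{R}^n\to\mathbb{R}$ is differentiable with gradient $g$, and only noisy measurements of its values are available. $\|\cdot\|$ is the Euclidean norm and $C_m^j$ denotes the binomial coefficient "$m$ choose $j$". Set $$\rho=\begin{cases} C_{n-1}^{n/2}\big/\left(2^{n-1}+\tfrac12 C_n^{n/2}\right), & n \text{ even},\\[2pt] C_{n-1}^{(n-1)/2}\big/2^{n-1}, & n\text{ odd}.\end{cases}$$ Algorithm SPSA1-A. Given an initial point $\hat x_0\in\mathbb{R}^n$ and positive scalars $a_k,c_k$, for $k=0,1,2,\dots$ (run indefinitely): 1. Generate $\xi_k$ uniformly in $\{-1,1\}^n$, independently of $\hat x_0,\dots,\hat x_k$. 2. Measure $\widetilde f(\hat x_k\pm c_k\xi_k)=f(\hat x_k\pm c_k\xi_k)+\varepsilon_k^{\pm}$, where $\varepsilon_k^+,\varepsilon_k^-$ are real random measurement noises, and put $$\hat g_k=\frac{\widetilde f(\hat x_k+c_k\xi_k)-\widetilde f(\hat x_k-c_k\xi_k)}{2c_k}\,\xi_k^{-1},$$ where $\xi_k^{-1}$ is the vector of componentwise inverses of $\xi_k$. Put $\rho_k=\rho/\|\hat g_k\|_\infty$ (it is understood that $\hat g_k\neq 0$ almost surely, so that $\rho_k$ is defined). 3. Generate $\hat\xi_k$ uniformly (conditionally on everything generated so far, in particular on $\hat x_k$ and $\hat g_k$) in the set $\{d\in\{-1,1\}^n:\ d^T\hat g_k\ge 0\}$. 4. Set $\hat x_{k+1}=\hat x_k-a_k\dfrac{\hat g_k+\hat\xi_k}{1+\rho_k}$.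 Here $\mathscr{F}_k=\{\hat x_0,\hat x_1,\dots,\hat x_k\}$ (conditioning on $\mathscr F_k$ means conditioning on these variables), and $\Omega=\{\omega\}$ is the sample space generating the sequence $\hat x_1,\hat x_2,\dots$. *)

theory Defs
  imports "HOL-Probability.Probability"
begin

section \<open>The algorithm SPSA1-A\<close>

definition sign_vectors :: "(real ^ 'n) set" where
  "sign_vectors = {v. \<forall>i. v $ i \<in> {-1, 1}}"

definition rho :: "nat \<Rightarrow> real" where
  "rho n = (if even n
     then real ((n - 1) choose (n div 2)) / (2 ^ (n - 1) + real (n choose (n div 2)) / 2)
     else real ((n - 1) choose ((n - 1) div 2)) / 2 ^ (n - 1))"

text \<open>
  The simultaneous perturbation estimate at \<open>y\<close> for step size \<open>c\<close>, perturbation \<open>v\<close>, and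
  noises \<open>ep\<close>, \<open>em\<close> in the measurements of \<open>f\<close> at \<open>y + c v\<close> and \<open>y - c v\<close>.
\<close>

definition grad_est ::
  "(real ^ 'n \<Rightarrow> real) \<Rightarrow> real \<Rightarrow> real ^ 'n \<Rightarrow> real ^ 'n \<Rightarrow> real \<Rightarrow> real \<Rightarrow> real ^ 'n" where
  "grad_est f c y v ep em =
     (((f (y + c *\<^sub>R v) + ep) - (f (y - c *\<^sub>R v) + em)) / (2 * c)) *\<^sub>R (\<chi> i. inverse (v $ i))"

text \<open>The admissible values of the second random direction, given the gradient estimate \<open>u\<close>.\<close>

definition descent_signs :: "real ^ 'n \<Rightarrow> (real ^ 'n) set" where
  "descent_signs u = {d \<in> sign_vectors. d \<bullet> u \<ge> 0}"

definition preimages :: "'w measure \<Rightarrow> ('w \<Rightarrow> 'b::topological_space) \<Rightarrow> 'w set set" where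
  "preimages M X = {X -` A \<inter> space M | A. A \<in> sets borel}"

definition sigma_iterates_direction ::
  "'w measure \<Rightarrow> (nat \<Rightarrow> 'w \<Rightarrow> real ^ 'n) \<Rightarrow> (nat \<Rightarrow> 'w \<Rightarrow> real ^ 'n) \<Rightarrow> nat \<Rightarrow> 'w measure" where
  "sigma_iterates_direction M x xi k =
     sigma (space M) ((\<Union>j\<le>k. preimages M (x j)) \<union> preimages M (xi k))"

text \<open>
  The sigma-algebra of everything generated before \<open>xihat k\<close> is drawn: the initial point, the
  directions \<open>xi j\<close> and noises for \<open>j \<le> k\<close>, and \<open>xihat j\<close> for \<open>j < k\<close>. The iterates
  \<open>x j\<close> and the gradient estimates with \<open>j \<le> k\<close> are functions of these.
\<close>

definition sigma_history ::
  "'w measure \<Rightarrow> ('w \<Rightarrow> real ^ 'n) \<Rightarrow> (nat \<Rightarrow> 'w \<Rightarrow> real ^ 'n) \<Rightarrow> (nat \<Rightarrow> 'w \<Rightarrow> real ^ 'n) \<Rightarrow>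
   (nat \<Rightarrow> 'w \<Rightarrow> real) \<Rightarrow> (nat \<Rightarrow> 'w \<Rightarrow> real) \<Rightarrow> nat \<Rightarrow> 'w measure" where
  "sigma_history M x0 xi xihat ep em k =
     sigma (space M) (preimages M x0 \<union>
       (\<Union>j\<le>k. preimages M (xi j) \<union> preimages M (ep j) \<union> preimages M (em j)) \<union>
       (\<Union>j<k. preimages M (xihat j)))"

text \<open>
  The process \<open>x\<close> is a run of the algorithm. The initial point may be random, which includes
  the deterministic case. Assumption \<open>xihat_uniform\<close> says that the conditional distribution of
  \<open>xihat k\<close> given the history is uniform on \<open>descent_signs (ghat k)\<close>. On the null event
  \<open>ghat k = 0\<close>, excluded by \<open>ghat_nonzero\<close>, the quotient in \<open>step\<close> is \<open>0\<close> by convention.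
\<close>

locale SPSA1_A = prob_space M
  for M :: "'w measure" +
  fixes f :: "real ^ 'n \<Rightarrow> real"
    and a c :: "nat \<Rightarrow> real"
    and x xi xihat :: "nat \<Rightarrow> 'w \<Rightarrow> real ^ 'n"
    and ep em :: "nat \<Rightarrow> 'w \<Rightarrow> real"
    and ghat :: "nat \<Rightarrow> 'w \<Rightarrow> real ^ 'n"
  defines "ghat \<equiv> \<lambda>k \<omega>. grad_est f (c k) (x k \<omega>) (xi k \<omega>) (ep k \<omega>) (em k \<omega>)"
  assumes x0_measurable: "random_variable borel (x 0)"
    and xi_measurable: "\<And>k. random_variable borel (xi k)"
    and ep_measurable: "\<And>k. random_variable borel (ep k)"
    and em_measurable: "\<And>k. random_variable borel (em k)"
    and xihat_measurable: "\<And>k. random_variable borel (xihat k)"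
    and xi_uniform: "\<And>k v. v \<in> sign_vectors \<Longrightarrow>
      prob {\<omega> \<in> space M. xi k \<omega> = v} = 1 / real (card (sign_vectors :: (real ^ 'n) set))"
    and xi_indep: "\<And>k. indep_set (preimages M (xi k))
      (sigma_sets (space M) (\<Union>j\<le>k. preimages M (x j)))"
    and ghat_nonzero: "\<And>k. AE \<omega> in M. ghat k \<omega> \<noteq> 0"
    and xihat_uniform: "\<And>k d. AE \<omega> in M.
      real_cond_exp M (sigma_history M (x 0) xi xihat ep em k)
        (indicator {\<omega> \<in> space M. xihat k \<omega> = d}) \<omega>
      = indicator (descent_signs (ghat k \<omega>)) d / real (card (descent_signs (ghat k \<omega>)))"
    and step: "\<And>k \<omega>. \<omega> \<in> space M \<Longrightarrow>
      x (Suc k) \<omega> = x k \<omega> -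
        (a k / (1 + rho CARD('n) / infnorm (ghat k \<omega>))) *\<^sub>R (ghat k \<omega> + xihat k \<omega>)"


section \<open>Autonomous differential equations\<close>

definition solves_ode_on ::
  "('b::real_normed_vector \<Rightarrow> 'b) \<Rightarrow> real set \<Rightarrow> (real \<Rightarrow> 'b) \<Rightarrow> bool" where
  "solves_ode_on F I \<phi> \<longleftrightarrow> (\<forall>t\<in>I. (\<phi> has_vector_derivative F (\<phi> t)) (at t within I))"

text \<open>
  Asymptotic stability in the sense of Lyapunov. Stability is required of solutions on every
  interval \<open>[0, T]\<close>, so that a solution escaping in finite time violates it.
\<close>

definition asymptotically_stable ::
  "('b::real_normed_vector \<Rightarrow> 'b) \<Rightarrow> 'b \<Rightarrow> bool" where
  "asymptotically_stable F p \<longleftrightarrow>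
     F p = 0 \<and>
     (\<forall>e>0. \<exists>d>0. \<forall>T>0. \<forall>\<phi>. solves_ode_on F {0..T} \<phi> \<and> norm (\<phi> 0 - p) < d \<longrightarrow>
        (\<forall>t\<in>{0..T}. norm (\<phi> t - p) < e)) \<and>
     (\<exists>d>0. \<forall>\<phi>. solves_ode_on F {0..} \<phi> \<and> norm (\<phi> 0 - p) < d \<longrightarrow>
        (\<phi> \<longlongrightarrow> p) at_top)"

text \<open>
  Where the initial value problem has a unique solution, the existential quantifier refers to
  that solution.
\<close>

definition attraction_domain ::
  "('b::real_normed_vector \<Rightarrow> 'b) \<Rightarrow> 'b \<Rightarrow> 'b set" where
  "attraction_domain F p =
     {y. \<exists>\<phi>. solves_ode_on F {0..} \<phi> \<and> \<phi> 0 = y \<and> (\<phi> \<longlongrightarrow> p) at_top}"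


section \<open>Third order partial derivatives\<close>

definition partial_differentiable :: "'n \<Rightarrow> (real ^ 'n \<Rightarrow> real) \<Rightarrow> real ^ 'n \<Rightarrow> bool" where
  "partial_differentiable i h y \<longleftrightarrow> (\<lambda>t::real. h (y + t *\<^sub>R axis i 1)) differentiable (at 0)"

definition partial_deriv :: "'n \<Rightarrow> (real ^ 'n \<Rightarrow> real) \<Rightarrow> real ^ 'n \<Rightarrow> real" where
  "partial_deriv i h y = deriv (\<lambda>t::real. h (y + t *\<^sub>R axis i 1)) 0"

definition third_partial :: "(real ^ 'n \<Rightarrow> real) \<Rightarrow> 'n \<Rightarrow> 'n \<Rightarrow> 'n \<Rightarrow> real ^ 'n \<Rightarrow> real" where
  "third_partial f i j l = partial_deriv l (partial_deriv j (partial_deriv i f))"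

text \<open>All entries of the third derivative array of \<open>f\<close> exist, are continuous, and are bounded
  on the open set \<open>B\<close>.\<close>

definition third_deriv_continuous_bounded_on ::
  "(real ^ 'n \<Rightarrow> real) \<Rightarrow> (real ^ 'n) set \<Rightarrow> bool" where
  "third_deriv_continuous_bounded_on f B \<longleftrightarrow>
     (\<forall>i j l. (\<forall>y\<in>B. partial_differentiable i f y \<and>
                     partial_differentiable j (partial_deriv i f) y \<and>
                     partial_differentiable l (partial_deriv j (partial_deriv i f)) y) \<and>
              continuous_on B (third_partial f i j l) \<and>
              bounded (third_partial f i j l ` B))"

end

theory Submission
  imports Defs
begin

text \<open>
  Two identities make the algorithm a stochastic gradient method. The estimate \<open>ghat\<close> is a multiple
  of a sign vector, and \<open>xihat\<close> is uniform on the half of the sign cube that faces it; the mean of that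
  half-cube points in the direction of \<open>ghat\<close> and has sup-norm exactly \<open>rho\<close>. So on average adding
  \<open>xihat\<close> multiplies \<open>ghat\<close> by \<open>1 + rho / infnorm ghat\<close>, which is the denominator of the step: the step
  direction has the same conditional mean as \<open>ghat\<close> (\<open>sum_descent_signs_component\<close>,
  \<open>normalized_step_unbiased\<close>). The measurement noise has conditional mean zero and the direction \<open>xi\<close>
  is independent of the iterates, so that mean is the average of the central differences of \<open>f\<close> over
  all sign vectors, each taken times its sign vector. Since \<open>v v\<^sup>T\<close> averages to the identity, this
  tends to the gradient as the step size tends to zero (\<open>central_difference_mean_consistent\<close>). Hence
  \<open>x (k+1) = x k - a k (g (x k) + b k) - w k\<close> with \<open>b k\<close> tending to \<open>0\<close>, where the components of
  \<open>w k\<close> are orthogonal to all bounded functions of the iterates up to \<open>x k\<close> and have second moments of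
  order \<open>(a k / c k)\<^sup>2\<close>. These are summable, so \<open>\<Sum>k. w k\<close> converges almost surely
  (\<open>orthogonal_increments_summable\<close>).

  The rest is deterministic and concerns a single path (\<open>gradient_recursion_converges\<close>). Subtracting
  from \<open>x k\<close> the remainder of the series \<open>\<Sum>k. w k\<close> changes the path by a null sequence and leaves a
  perturbed Euler scheme \<open>z\<close> for \<open>\<phi>' = - g \<phi>\<close>. Its cluster points lie where \<open>f\<close> has bounded third
  derivatives, so \<open>g\<close> is Lipschitz around each of them.

  First, \<open>xstar\<close> is a cluster point. The recurrent compact set contains a cluster point, from which some
  solution \<open>\<phi>\<close> converges to \<open>xstar\<close>. An Euler scheme that comes close to a point of \<open>\<phi>\<close> stays close to
  \<open>\<phi>\<close> for a short time, so the times up to which \<open>\<phi>\<close> consists of cluster points can always be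
  extended (\<open>solution_through_cluster_point_clusters\<close>). All of \<open>\<phi>\<close> consists of cluster points, and so
  does its limit.

  Second, \<open>xstar\<close> is an isolated critical point and a strict local minimum of \<open>f\<close>. Other nearby critical
  points would be constant solutions that are not attracted; and \<open>f\<close> decreases along every solution,
  while from every nearby point some solution exists for all times and converges to \<open>xstar\<close>
  (\<open>asymptotically_stable_gradient_flow_strict_minimum\<close>).

  Third, \<open>f\<close> is therefore a strict Lyapunov function for the scheme itself. In a shell around \<open>xstar\<close>
  the gradient is bounded away from zero and dominates the perturbation, so \<open>f (z k)\<close> decreases there,
  and a path that comes close enough to \<open>xstar\<close> never again has the energy to cross the shell
  (\<open>perturbed_gradient_descent_trapped_at_strict_minimum\<close>). Working with \<open>f\<close> directly avoids both a
  converse Lyapunov theorem and compactness arguments for families of interpolated paths.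
\<close>

section \<open>Local Lipschitz continuity of a gradient with bounded third derivatives\<close>

lemma partial_differentiable_line:
  assumes "partial_differentiable i h (q + t *\<^sub>R axis i 1)"
  shows "((\<lambda>s. h (q + s *\<^sub>R axis i 1)) has_field_derivative partial_deriv i h (q + t *\<^sub>R axis i 1)) (at t)"
proof -
  have "((\<lambda>s::real. h ((q + t *\<^sub>R axis i 1) + s *\<^sub>R axis i 1))
      has_field_derivative partial_deriv i h (q + t *\<^sub>R axis i 1)) (at 0)"
    using assms unfolding partial_differentiable_def partial_deriv_def
    by (simp add: DERIV_deriv_iff_real_differentiable)
  then have "((\<lambda>s::real. h ((q + t *\<^sub>R axis i 1) + (s - t) *\<^sub>R axis i 1))
      has_field_derivative partial_deriv i h (q + t *\<^sub>R axis i 1)) (at t)"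
    using DERIV_shift[of "\<lambda>s. h ((q + t *\<^sub>R axis i 1) + (s - t) *\<^sub>R axis i 1)" _ 0 t] by simp
  then show ?thesis by (simp add: algebra_simps)
qed

text \<open>
  The segment from \<open>v\<close> to \<open>u\<close> is replaced by a path that changes one coordinate at a time, so that only
  derivatives in coordinate directions occur. A corner of this path mixes coordinates of \<open>u\<close> and \<open>v\<close>;
  its squared distance to \<open>p\<close> is at most the sum of theirs, which is why \<open>u\<close> and \<open>v\<close> are taken from the
  ball of half the radius.
\<close>

lemma increment_le_of_bounded_partials:
  fixes h :: "real ^ 'n \<Rightarrow> real"
  assumes diff: "\<And>y i. y \<in> ball p R \<Longrightarrow> partial_differentiable i h y"
    and bd: "\<And>y i. y \<in> ball p R \<Longrightarrow> \<bar>partial_deriv i h y\<bar> \<le> C"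
    and u: "u \<in> ball p (R / 2)" and v: "v \<in> ball p (R / 2)"
  shows "\<bar>h u - h v\<bar> \<le> (\<Sum>i\<in>UNIV. C * \<bar>u $ i - v $ i\<bar>)"
proof -
  define mix where "mix I = (\<chi> i. if i \<in> I then u $ i else v $ i)" for I :: "'n set"
  have R: "R > 0" using u by (metis ball_eq_empty empty_iff half_gt_zero_iff not_le)
  have between: "w \<in> ball p R" if w: "\<And>i. w $ i \<in> closed_segment (v $ i) (u $ i)" for w
  proof -
    have "(w $ i - p $ i)\<^sup>2 \<le> (u $ i - p $ i)\<^sup>2 + (v $ i - p $ i)\<^sup>2" for i
    proof -
      have "\<bar>w $ i - p $ i\<bar> \<le> max \<bar>u $ i - p $ i\<bar> \<bar>v $ i - p $ i\<bar>"
        using w[of i] by (auto simp: closed_segment_eq_real_ivl split: if_splits)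
      then have "(w $ i - p $ i)\<^sup>2 \<le> (max \<bar>u $ i - p $ i\<bar> \<bar>v $ i - p $ i\<bar>)\<^sup>2"
        by (metis abs_ge_zero power2_abs power_mono)
      also have "\<dots> \<le> (u $ i - p $ i)\<^sup>2 + (v $ i - p $ i)\<^sup>2"
        by (cases "\<bar>u $ i - p $ i\<bar> \<le> \<bar>v $ i - p $ i\<bar>") (simp_all add: max_def)
      finally show ?thesis .
    qed
    then have "(\<Sum>i\<in>UNIV. (w $ i - p $ i)\<^sup>2) \<le> (\<Sum>i\<in>UNIV. (u $ i - p $ i)\<^sup>2) + (\<Sum>i\<in>UNIV. (v $ i - p $ i)\<^sup>2)"
      by (simp add: sum_mono flip: sum.distrib)
    then have "(norm (w - p))\<^sup>2 \<le> (norm (u - p))\<^sup>2 + (norm (v - p))\<^sup>2"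
      unfolding norm_vec_def L2_set_def by (simp add: sum_nonneg)
    moreover have "(norm (u - p))\<^sup>2 < (R/2)\<^sup>2" "(norm (v - p))\<^sup>2 < (R/2)\<^sup>2"
      using u v R by (auto simp: dist_norm norm_minus_commute intro!: power_strict_mono)
    moreover have "(R/2)\<^sup>2 + (R/2)\<^sup>2 \<le> R\<^sup>2" by (simp add: power2_eq_square)
    ultimately have "(norm (w - p))\<^sup>2 < R\<^sup>2" by linarith
    then have "norm (w - p) < R" using R by (metis less_le_not_le not_le power2_less_imp_less)
    then show ?thesis by (simp add: dist_norm norm_minus_commute)
  qed
  have "\<bar>h (mix I) - h v\<bar> \<le> (\<Sum>i\<in>I. C * \<bar>u $ i - v $ i\<bar>)" for I
  proof (induction I rule: finite_induct[OF finite])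
    case 1
    then show ?case by (simp add: mix_def)
  next
    case (2 j I)
    define s where "s = u $ j - v $ j"
    have mix_ins: "mix (insert j I) = mix I + s *\<^sub>R axis j 1"
      using 2 by (auto simp: mix_def s_def vec_eq_iff axis_def)
    have inb: "mix I + t *\<^sub>R axis j 1 \<in> ball p R" if "t \<in> closed_segment 0 s" for t
      by (rule between)
        (use that 2(2) in \<open>auto simp: mix_def s_def axis_def closed_segment_eq_real_ivl split: if_splits\<close>)
    have "norm (h (mix I + s *\<^sub>R axis j 1) - h (mix I + 0 *\<^sub>R axis j 1)) \<le> C * norm (s - 0)"
    proof (rule field_differentiable_bound[of "closed_segment 0 s"])
      fix t assume "t \<in> closed_segment 0 s"
      then show "((\<lambda>t. h (mix I + t *\<^sub>R axis j 1)) has_field_derivative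
          partial_deriv j h (mix I + t *\<^sub>R axis j 1)) (at t within closed_segment 0 s)"
        and "norm (partial_deriv j h (mix I + t *\<^sub>R axis j 1)) \<le> C"
        using partial_differentiable_line[OF diff[OF inb]] bd[OF inb] by (auto intro: has_field_derivative_at_within)
    qed auto
    then have "\<bar>h (mix (insert j I)) - h (mix I)\<bar> \<le> C * \<bar>u $ j - v $ j\<bar>"
      by (simp add: mix_ins s_def)
    then show ?case using 2 by simp
  qed
  moreover have "mix UNIV = u" by (simp add: mix_def)
  ultimately show ?thesis by (metis UNIV_I)
qed

lemma lipschitz_of_bounded_partials:
  fixes h :: "real ^ 'n \<Rightarrow> real"
  assumes diff: "\<And>y i. y \<in> ball p R \<Longrightarrow> partial_differentiable i h y"
    and bd: "\<And>i. bounded (partial_deriv i h ` ball p R)"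
  obtains L where "L-lipschitz_on (ball p (R / 2)) h"
proof -
  have "bounded (\<Union>i. partial_deriv i h ` ball p R)" using bd by (intro bounded_UN) auto
  then obtain C where C: "C > 0" "\<And>y i. y \<in> ball p R \<Longrightarrow> \<bar>partial_deriv i h y\<bar> \<le> C"
    by (force simp: bounded_pos)
  have "(C * CARD('n))-lipschitz_on (ball p (R / 2)) h"
  proof (rule lipschitz_onI)
    fix u v assume uv: "u \<in> ball p (R/2)" "v \<in> ball p (R/2)"
    have "dist (h u) (h v) \<le> (\<Sum>i\<in>UNIV. C * \<bar>u $ i - v $ i\<bar>)"
      using increment_le_of_bounded_partials[of p R h C u v] diff C uv by (simp add: dist_real_def)
    also have "\<dots> \<le> (\<Sum>i\<in>(UNIV::'n set). C * dist u v)"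
      using C(1) component_le_norm_cart[of "u - v"] by (intro sum_mono mult_left_mono) (auto simp: dist_norm)
    finally show "dist (h u) (h v) \<le> C * CARD('n) * dist u v" by (simp add: mult_ac)
  qed (use C in auto)
  then show ?thesis by (rule that)
qed

lemma partial_deriv_gradient:
  assumes "GDERIV f y :> g"
  shows "partial_deriv i f y = g $ i"
proof -
  have 1: "(f has_derivative (\<lambda>d. d \<bullet> g)) (at (y + 0 *\<^sub>R axis i 1))"
    using assms by (simp add: gderiv_def)
  have 2: "((\<lambda>t::real. y + t *\<^sub>R axis i 1) has_derivative (\<lambda>t. t *\<^sub>R axis i 1)) (at 0)"
    by (auto intro!: derivative_eq_intros)
  have "((\<lambda>t::real. f (y + t *\<^sub>R axis i 1)) has_derivative (\<lambda>t. (t *\<^sub>R axis i 1) \<bullet> g)) (at 0)"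
    using has_derivative_compose[OF 2 1] by simp
  then have "((\<lambda>t::real. f (y + t *\<^sub>R axis i 1)) has_field_derivative (g $ i)) (at 0)"
    unfolding has_field_derivative_def
    by (rule has_derivative_eq_rhs) (auto simp: inner_axis inner_commute mult.commute)
  then show ?thesis by (simp add: partial_deriv_def DERIV_imp_deriv)
qed

text \<open>
  Bounded third derivatives make the second derivatives Lipschitz, hence bounded, on a ball of half the
  radius; this makes the gradient Lipschitz on a ball of a quarter of the radius.
\<close>

lemma gradient_locally_lipschitz:
  fixes f :: "real ^ 'n \<Rightarrow> real"
  assumes grad: "\<And>y. GDERIV f y :> g y"
    and smooth: "third_deriv_continuous_bounded_on f B" and sub: "ball p R \<subseteq> B"
  obtains L where "L-lipschitz_on (ball p (R / 4)) g"
proof -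
  have comp: "\<exists>L. L-lipschitz_on (ball p (R / 4)) (\<lambda>y. g y $ i)" for i
  proof -
    have "bounded (partial_deriv j (partial_deriv i f) ` ball p (R / 2))" for j
    proof -
      have "bounded (partial_deriv l (partial_deriv j (partial_deriv i f)) ` ball p R)" for l
        using smooth sub unfolding third_deriv_continuous_bounded_on_def third_partial_def
        by (meson bounded_subset image_mono)
      then obtain L where L: "L-lipschitz_on (ball p (R / 2)) (partial_deriv j (partial_deriv i f))"
        using smooth sub unfolding third_deriv_continuous_bounded_on_def
        by (meson lipschitz_of_bounded_partials subsetD)
      show ?thesis
        by (rule lipschitz_on_uniformly_continuous[OF L, THEN bounded_uniformly_continuous_image]) simp
    qed
    moreover have "partial_differentiable j (partial_deriv i f) y" if "y \<in> ball p (R/2)" for j y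
    proof -
      have "y \<in> ball p R" using that by (auto simp: dist_norm) (smt (verit) norm_ge_zero field_sum_of_halves)
      then show ?thesis using smooth sub unfolding third_deriv_continuous_bounded_on_def by blast
    qed
    ultimately obtain L where "L-lipschitz_on (ball p (R / 2 / 2)) (partial_deriv i f)"
      using lipschitz_of_bounded_partials by meson
    moreover have "partial_deriv i f = (\<lambda>y. g y $ i)"
      using partial_deriv_gradient[OF grad] by auto
    ultimately show ?thesis by (auto simp: field_simps)
  qed
  then obtain L where L: "\<And>i. (L i)-lipschitz_on (ball p (R / 4)) (\<lambda>y. g y $ i)" by metis
  have "(\<Sum>i\<in>UNIV. L i)-lipschitz_on (ball p (R / 4)) g"
  proof (rule lipschitz_onI)
    fix u v assume uv: "u \<in> ball p (R/4)" "v \<in> ball p (R/4)"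
    have "dist (g u) (g v) \<le> (\<Sum>i\<in>UNIV. \<bar>(g u - g v) $ i\<bar>)"
      unfolding dist_norm by (rule norm_le_l1_cart)
    also have "\<dots> \<le> (\<Sum>i\<in>UNIV. L i * dist u v)"
      using lipschitz_onD[OF L uv] by (intro sum_mono) (auto simp: dist_real_def)
    finally show "dist (g u) (g v) \<le> (\<Sum>i\<in>UNIV. L i) * dist u v" by (simp add: sum_distrib_right)
  qed (use L lipschitz_on_nonneg in \<open>auto intro!: sum_nonneg\<close>)
  then show ?thesis by (rule that)
qed

section \<open>Global solutions of bounded Lipschitz differential equations\<close>

lemma indefinite_integral_has_vector_derivative_halfline:
  fixes h :: "real \<Rightarrow> 'a::euclidean_space"
  assumes "continuous_on {0..} h" "t \<ge> 0"
  shows "((\<lambda>b. integral {0..b} h) has_vector_derivative h t) (at t within {0..})"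
proof -
  have "((\<lambda>b. integral {0..b} h) has_vector_derivative h t) (at t within {0..t+1})"
    using assms by (intro integral_has_vector_derivative continuous_on_subset[OF assms(1)]) auto
  moreover have "at t within {0..t+1} = at t within {0..}"
    by (rule at_within_nhd[of _ "{..<t+1}"]) (use assms in auto)
  ultimately show ?thesis by simp
qed

text \<open>
  Picard iteration on the whole half-line at once. A solution is sought in the form
  \<open>\<psi> t = y + exp (l t) u t\<close> with \<open>u\<close> bounded and continuous; the weight makes the integral operator a
  contraction by the factor \<open>L / l\<close>, without any restriction to short times. Functions of bounded
  continuous type have domain \<^typ>\<open>real\<close>, so they are kept constant on negative times by \<open>max 0\<close>.
\<close>

lemma bounded_lipschitz_ode_has_global_solution:
  fixes F :: "'a::euclidean_space \<Rightarrow> 'a"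
  assumes lip: "L-lipschitz_on UNIV F" and bound: "\<And>v. norm (F v) \<le> B"
  obtains \<psi> where "solves_ode_on F {0..} \<psi>" "\<psi> 0 = y"
proof -
  \<comment> \<open>a weight of at least \<open>2 L\<close> gives a contraction by a half, and the summand \<open>1\<close> keeps it positive\<close>
  define l where "l = 2 * L + 1"
  have L: "L \<ge> 0" using lip by (rule lipschitz_on_nonneg)
  have l: "l > 0" using L by (simp add: l_def)
  have B: "B \<ge> 0" using bound[of 0] norm_ge_zero by (meson order_trans)
  define h where "h u s = F (y + exp (l * s) *\<^sub>R apply_bcontfun u s)" for u :: "real \<Rightarrow>\<^sub>C 'a" and s
  define I where "I u t = integral {0..t} (h u)" for u t
  define W where "W u t = exp (- l * max 0 t) *\<^sub>R I u (max 0 t)" for u t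
  have F_cont: "continuous_on UNIV F" using lip by (rule lipschitz_on_continuous_on)
  have h_cont: "continuous_on X (h u)" for u X
    unfolding h_def by (intro continuous_intros continuous_on_compose2[OF F_cont]) auto
  have I_deriv: "(I u has_vector_derivative h u t) (at t within {0..})" if "t \<ge> 0" for u t
    unfolding I_def using indefinite_integral_has_vector_derivative_halfline[OF h_cont that] .
  have I_cont: "continuous_on {0..} (I u)" for u
    using I_deriv by (auto simp: continuous_on_eq_continuous_within intro: has_vector_derivative_continuous)
  have I_bound: "norm (I u t) \<le> B * t" if "t \<ge> 0" for u t
    unfolding I_def using integral_bound[OF that h_cont, of u B] bound by (simp add: h_def)
  have W_cont: "continuous_on UNIV (W u)" for u
    unfolding W_def by (intro continuous_intros continuous_on_compose2[OF I_cont]) auto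
  have W_bound: "norm (W u t) \<le> B / l" for u t
  proof -
    define s where "s = max 0 t"
    have s: "s \<ge> 0" by (simp add: s_def)
    have "l * s \<le> exp (l * s)" using exp_ge_add_one_self[of "l * s"] by linarith
    then have "exp (- l * s) * s \<le> 1 / l" using l by (simp add: exp_minus field_simps)
    then have "B * (exp (- l * s) * s) \<le> B * (1 / l)" using B by (rule mult_left_mono)
    moreover have "norm (W u t) \<le> exp (- l * s) * (B * s)"
      unfolding W_def s_def[symmetric] using I_bound[OF s] by simp
    ultimately show ?thesis by (simp add: mult_ac)
  qed
  have W_bcont: "W u \<in> bcontfun" for u
    using W_cont W_bound unfolding bcontfun_def bounded_iff by blast
  define \<Theta> where "\<Theta> u = Bcontfun (W u)" for u
  have \<Theta>: "apply_bcontfun (\<Theta> u) = W u" for u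
    unfolding \<Theta>_def using W_bcont by (simp add: Bcontfun_inverse)
  have contr: "dist (W u t) (W v t) \<le> 1/2 * dist u v" for u v t
  proof -
    define s where "s = max 0 t"
    have s: "s \<ge> 0" by (simp add: s_def)
    have exp_int: "((\<lambda>r. L * dist u v * exp (l * r)) has_integral L * dist u v / l * exp (l * s) - L * dist u v / l * exp (l * 0)) {0..s}"
      using l by (intro fundamental_theorem_of_calculus s)
        (auto intro!: derivative_eq_intros simp: has_real_derivative_iff_has_vector_derivative[symmetric])
    have "I u s - I v s = integral {0..s} (\<lambda>r. h u r - h v r)"
      unfolding I_def by (intro integral_diff[symmetric] integrable_continuous_interval h_cont)
    also have "norm \<dots> \<le> integral {0..s} (\<lambda>r. L * dist u v * exp (l * r))"
    proof (rule integral_norm_bound_integral)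
      fix r
      have "norm (h u r - h v r) \<le> L * norm (exp (l * r) *\<^sub>R (u r - v r))"
        unfolding h_def
        using lipschitz_onD[OF lip, of "y + exp (l * r) *\<^sub>R u r" "y + exp (l * r) *\<^sub>R v r"]
        by (simp add: dist_norm scaleR_diff_right)
      also have "\<dots> = L * (exp (l * r) * dist (u r) (v r))" by (simp add: dist_norm)
      also have "\<dots> \<le> L * (exp (l * r) * dist u v)"
        using L by (intro mult_left_mono dist_bounded) auto
      finally show "norm (h u r - h v r) \<le> L * dist u v * exp (l * r)" by (simp add: mult_ac)
    qed (use exp_int h_cont in \<open>auto intro!: integrable_continuous_interval continuous_intros\<close>)
    also have "\<dots> \<le> L * dist u v / l * exp (l * s)"
      using integral_unique[OF exp_int] L l by simp
    finally have "norm (I u s - I v s) \<le> L * dist u v / l * exp (l * s)" .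
    then have "exp (- l * s) * norm (I u s - I v s) \<le> exp (- l * s) * (L * dist u v / l * exp (l * s))"
      by (rule mult_left_mono) simp
    also have "\<dots> = L / l * dist u v" by (simp add: exp_minus)
    also have "\<dots> \<le> 1/2 * dist u v" using L l by (intro mult_right_mono) (auto simp: l_def field_simps)
    finally show ?thesis
      unfolding W_def s_def[symmetric] by (simp add: dist_norm flip: scaleR_right_diff_distrib)
  qed
  have "\<exists>!u. \<Theta> u = u"
  proof (rule banach_fix_type[of "1/2"])
    have "dist (\<Theta> u) (\<Theta> v) \<le> 1/2 * dist u v" for u v
      by (rule dist_bound) (simp only: \<Theta> contr)
    then show "\<forall>u v. dist (\<Theta> u) (\<Theta> v) \<le> 1/2 * dist u v" by blast
  qed auto
  then obtain u where "\<Theta> u = u" by blast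
  then have u: "apply_bcontfun u t = exp (- l * t) *\<^sub>R I u t" if "t \<ge> 0" for t
    using \<Theta>[of u] that by (simp add: W_def)
  define \<psi> where "\<psi> t = y + I u t" for t
  have "h u t = F (\<psi> t)" if "t \<ge> 0" for t
    using u[OF that] unfolding h_def \<psi>_def by (simp add: exp_minus)
  then have "solves_ode_on F {0..} \<psi>"
    unfolding solves_ode_on_def \<psi>_def using I_deriv[of _ u] by (auto intro!: derivative_eq_intros)
  moreover have "\<psi> 0 = y" by (simp add: \<psi>_def I_def)
  ultimately show ?thesis by (rule that)
qed

section \<open>Asymptotically stable equilibria of gradient flows\<close>

lemma solves_ode_on_continuous:
  assumes "solves_ode_on F I \<phi>"
  shows "continuous_on I \<phi>"
  using assms unfolding solves_ode_on_def continuous_on_eq_continuous_within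
  by (blast intro: has_vector_derivative_continuous)

lemma solves_ode_on_shift:
  assumes sol: "solves_ode_on F {0..} \<phi>" and "\<tau> \<ge> 0"
  shows "solves_ode_on F {0..} (\<lambda>s. \<phi> (\<tau> + s))"
  unfolding solves_ode_on_def
proof
  fix t :: real assume t: "t \<in> {0..}"
  have "(\<phi> has_vector_derivative F (\<phi> (\<tau> + t))) (at (\<tau> + t) within {0..})"
    using sol t assms(2) by (simp add: solves_ode_on_def)
  then have "(\<phi> has_vector_derivative F (\<phi> (\<tau> + t))) (at (\<tau> + t) within (\<lambda>s. \<tau> + s) ` {0..})"
    by (rule has_vector_derivative_within_subset) (use assms(2) in auto)
  moreover have "((\<lambda>s. \<tau> + s) has_vector_derivative 1) (at t within {0..})"
    by (auto intro!: derivative_eq_intros simp flip: has_real_derivative_iff_has_vector_derivative)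
  ultimately show "((\<lambda>s. \<phi> (\<tau> + s)) has_vector_derivative F (\<phi> (\<tau> + t))) (at t within {0..})"
    using vector_diff_chain_within[of "\<lambda>s. \<tau> + s" 1 t "{0..}" \<phi> "F (\<phi> (\<tau> + t))"] by (simp add: o_def)
qed

lemma attracted_zero_is_equilibrium:
  fixes F :: "'a::real_normed_vector \<Rightarrow> 'a"
  assumes attr: "\<And>\<phi>. solves_ode_on F {0..} \<phi> \<Longrightarrow> norm (\<phi> 0 - p) < d \<Longrightarrow> (\<phi> \<longlongrightarrow> p) at_top"
    and y: "norm (y - p) < d" and zero: "F y = 0"
  shows "y = p"
proof -
  have "solves_ode_on F {0..} (\<lambda>_. y)"
    unfolding solves_ode_on_def by (simp add: zero)
  from attr[OF this] y have "((\<lambda>_::real. y) \<longlongrightarrow> p) at_top" by simp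
  then show ?thesis by (simp add: tendsto_const_iff)
qed

text \<open>
  The field \<open>F\<close> is a modification of \<open>G\<close> outside the ball of radius \<open>r\<close>, for which global solutions are
  known to exist. At the first time at which a solution for \<open>F\<close> reaches the sphere it is still a
  solution for \<open>G\<close>, and stability of \<open>G\<close> says that it cannot be there.
\<close>

lemma stable_equilibrium_confines_truncated_solution:
  fixes F G :: "'a::real_normed_vector \<Rightarrow> 'a"
  assumes stab: "\<And>T \<phi>. T > 0 \<Longrightarrow> solves_ode_on G {0..T} \<phi> \<Longrightarrow> norm (\<phi> 0 - p) < d \<Longrightarrow>
      \<forall>t\<in>{0..T}. norm (\<phi> t - p) < r"
    and sol: "solves_ode_on F {0..} \<psi>" and init: "norm (\<psi> 0 - p) < d" "norm (\<psi> 0 - p) < r"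
    and agree: "\<And>v. norm (v - p) \<le> r \<Longrightarrow> F v = G v"
  shows "solves_ode_on G {0..} \<psi>"
proof -
  have cont: "continuous_on {0..} (\<lambda>t. norm (\<psi> t - p))"
    by (intro continuous_intros solves_ode_on_continuous[OF sol])
  have conf: "norm (\<psi> t - p) \<le> r" if t: "t \<ge> 0" for t
  proof (rule ccontr)
    assume "\<not> norm (\<psi> t - p) \<le> r"
    define E where "E = {s \<in> {0..t}. norm (\<psi> s - p) = r}"
    have reach: "\<exists>s'\<in>E. s' \<le> s" if s: "s \<in> {0..t}" "norm (\<psi> s - p) \<ge> r" for s
    proof -
      have "continuous_on {0..s} (\<lambda>t. norm (\<psi> t - p))" by (rule continuous_on_subset[OF cont]) auto
      then obtain s' where "0 \<le> s'" "s' \<le> s" "norm (\<psi> s' - p) = r"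
        using IVT'[of "\<lambda>t. norm (\<psi> t - p)" 0 r s] init(2) s by auto
      then show ?thesis using s by (auto simp: E_def)
    qed
    have "closed ({0..t} \<inter> (\<lambda>s. norm (\<psi> s - p)) -` {r})"
      by (intro continuous_closed_preimage continuous_on_subset[OF cont]) auto
    moreover have "{0..t} \<inter> (\<lambda>s. norm (\<psi> s - p)) -` {r} = E" by (auto simp: E_def)
    ultimately have "compact E"
      by (metis Int_lower1 bounded_closed_interval bounded_subset compact_eq_bounded_closed)
    moreover have "E \<noteq> {}" using reach[of t] t \<open>\<not> norm (\<psi> t - p) \<le> r\<close> by auto
    ultimately obtain T where T: "T \<in> E" "\<And>s. s \<in> E \<Longrightarrow> T \<le> s"
      using compact_attains_inf by metis
    have le: "norm (\<psi> s - p) \<le> r" if s: "s \<in> {0..T}" for s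
    proof (rule ccontr)
      assume "\<not> norm (\<psi> s - p) \<le> r"
      then obtain s' where s': "s' \<in> E" "s' \<le> s" using reach[of s] s T(1) by (auto simp: E_def)
      then have "s = T" using T(2)[OF s'(1)] s by auto
      then show False using T(1) \<open>\<not> norm (\<psi> s - p) \<le> r\<close> by (simp add: E_def)
    qed
    have "T > 0" using T(1) init(2) by (auto simp: E_def less_le)
    moreover have "solves_ode_on G {0..T} \<psi>"
      unfolding solves_ode_on_def
    proof
      fix s assume s: "s \<in> {0..T}"
      have "(\<psi> has_vector_derivative F (\<psi> s)) (at s within {0..})"
        using sol s by (simp add: solves_ode_on_def)
      then have "(\<psi> has_vector_derivative F (\<psi> s)) (at s within {0..T})"
        by (rule has_vector_derivative_within_subset) auto
      then show "(\<psi> has_vector_derivative G (\<psi> s)) (at s within {0..T})"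
        using agree[OF le[OF s]] by simp
    qed
    ultimately have "norm (\<psi> T - p) < r" using bspec[OF stab[of T \<psi>], of T] init(1) by simp
    then show False using T(1) by (simp add: E_def)
  qed
  then have "F (\<psi> t) = G (\<psi> t)" if "t \<ge> 0" for t using agree that by blast
  with sol show ?thesis unfolding solves_ode_on_def by simp
qed

lemma gradient_flow_value_derivative:
  fixes f :: "'a::real_inner \<Rightarrow> real"
  assumes grad: "\<And>y. GDERIV f y :> g y" and sol: "solves_ode_on (\<lambda>y. - g y) I \<psi>" and t: "t \<in> I"
  shows "((\<lambda>t. f (\<psi> t)) has_real_derivative - (norm (g (\<psi> t)))\<^sup>2) (at t within I)"
proof -
  have 1: "(\<psi> has_derivative (\<lambda>h. h *\<^sub>R - g (\<psi> t))) (at t within I)"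
    using sol t by (auto simp: solves_ode_on_def has_vector_derivative_def)
  have 2: "(f has_derivative (\<lambda>h. h \<bullet> g (\<psi> t))) (at (\<psi> t))"
    using grad[of "\<psi> t"] by (simp add: gderiv_def)
  show ?thesis
    unfolding has_field_derivative_def
    by (rule has_derivative_eq_rhs[OF has_derivative_compose[OF 1 2]])
       (auto simp: power2_norm_eq_inner)
qed

text \<open>
  A solution from \<open>y\<close> exists after the gradient is truncated by the projection onto a ball, and by
  stability it never notices the truncation. Along it \<open>f\<close> is nonincreasing with limit \<open>f p\<close>, so
  \<open>f p \<le> f y\<close>; equality would make \<open>f\<close> constant along the solution and \<open>y\<close> critical.
\<close>

lemma asymptotically_stable_gradient_flow_strict_minimum:
  fixes f :: "'a::euclidean_space \<Rightarrow> real"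
  assumes grad: "\<And>y. GDERIV f y :> g y"
    and stable: "asymptotically_stable (\<lambda>y. - g y) p"
    and lip: "L-lipschitz_on (ball p R) g" and R: "R > 0"
  obtains d where "d > 0" "\<And>y. y \<noteq> p \<Longrightarrow> dist y p < d \<Longrightarrow> g y \<noteq> 0"
    "\<And>y. y \<noteq> p \<Longrightarrow> dist y p < d \<Longrightarrow> f p < f y"
proof -
  define r where "r = R / 2"
  have r: "r > 0" "cball p r \<subseteq> ball p R" using R by (auto simp: r_def)
  have gp: "g p = 0" using stable by (simp add: asymptotically_stable_def)
  obtain d1 where d1: "d1 > 0" and stab: "\<And>T \<phi>. T > 0 \<Longrightarrow> solves_ode_on (\<lambda>y. - g y) {0..T} \<phi> \<Longrightarrow>
      norm (\<phi> 0 - p) < d1 \<Longrightarrow> \<forall>t\<in>{0..T}. norm (\<phi> t - p) < r"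
    using stable r(1) unfolding asymptotically_stable_def by metis
  obtain d2 where d2: "d2 > 0" and attr: "\<And>\<phi>. solves_ode_on (\<lambda>y. - g y) {0..} \<phi> \<Longrightarrow>
      norm (\<phi> 0 - p) < d2 \<Longrightarrow> (\<phi> \<longlongrightarrow> p) at_top"
    using stable unfolding asymptotically_stable_def by metis
  define F where "F v = - g (closest_point (cball p r) v)" for v
  have cp_in: "closest_point (cball p r) v \<in> ball p R" for v
    using closest_point_in_set[of "cball p r" v] r by auto
  have F_lip: "L-lipschitz_on UNIV F"
  proof (rule lipschitz_onI)
    fix u v
    have "dist (F u) (F v) \<le> L * dist (closest_point (cball p r) u) (closest_point (cball p r) v)"
      unfolding F_def dist_minus using lipschitz_onD[OF lip cp_in cp_in] .
    also have "\<dots> \<le> L * dist u v"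
      using r lipschitz_on_nonneg[OF lip] by (intro mult_left_mono closest_point_lipschitz) auto
    finally show "dist (F u) (F v) \<le> L * dist u v" .
  qed (rule lipschitz_on_nonneg[OF lip])
  have F_bound: "norm (F v) \<le> L * R" for v
  proof -
    have "norm (F v) \<le> L * dist (closest_point (cball p r) v) p"
      using lipschitz_onD[OF lip cp_in, of p v] gp R by (simp add: F_def)
    also have "\<dots> \<le> L * R"
      using cp_in[of v] lipschitz_on_nonneg[OF lip] by (intro mult_left_mono) (auto simp: dist_commute)
    finally show ?thesis .
  qed
  have noncrit: "g y \<noteq> 0" if "y \<noteq> p" "dist y p < d2" for y
    using attracted_zero_is_equilibrium[of "\<lambda>y. - g y" p d2 y, OF attr] that by (auto simp: dist_norm)
  have larger: "f p < f y" if y: "y \<noteq> p" "dist y p < min r (min d1 d2)" for y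
  proof -
    obtain \<psi> where F_sol: "solves_ode_on F {0..} \<psi>" and init: "\<psi> 0 = y"
      using bounded_lipschitz_ode_has_global_solution[OF F_lip F_bound] by metis
    have "closest_point (cball p r) v = v" if "norm (v - p) \<le> r" for v
      using that by (intro closest_point_self) (auto simp: dist_norm norm_minus_commute)
    then have sol: "solves_ode_on (\<lambda>y. - g y) {0..} \<psi>"
      using y init by (intro stable_equilibrium_confines_truncated_solution[OF stab F_sol])
        (auto simp: F_def dist_norm)
    then have lim: "(\<psi> \<longlongrightarrow> p) at_top" using attr y init by (auto simp: dist_norm)
    define V where "V t = f (\<psi> t)" for t
    have V': "(V has_real_derivative - (norm (g (\<psi> t)))\<^sup>2) (at t within {0..})" if "t \<ge> 0" for t
      unfolding V_def using gradient_flow_value_derivative[OF grad sol] that by simp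
    have V_mono: "V t \<le> V s" if "0 \<le> s" "s \<le> t" for s t
    proof (rule DERIV_nonpos_imp_decreasing_open[OF that(2)])
      fix q assume q: "s < q" "q < t"
      then have "at q within {0..} = at q" using that by (intro at_within_interior) auto
      then show "\<exists>y. (V has_real_derivative y) (at q) \<and> y \<le> 0"
        using V'[of q] q that by (intro exI[of _ "- (norm (g (\<psi> q)))\<^sup>2"]) auto
    next
      have "continuous_on {0..} V"
        using V' by (auto simp: continuous_on_eq_continuous_within intro: DERIV_continuous)
      then show "continuous_on {s..t} V" using that by (rule_tac continuous_on_subset) auto
    qed
    have "isCont f p" using grad[of p] by (auto simp: gderiv_def intro: has_derivative_continuous)
    then have V_lim: "(V \<longlongrightarrow> f p) at_top"
      unfolding V_def using lim by (rule isCont_tendsto_compose)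
    have V_ge: "f p \<le> V t" if "t \<ge> 0" for t
    proof (rule tendsto_upperbound[OF V_lim])
      show "\<forall>\<^sub>F s in at_top. V s \<le> V t"
        using eventually_ge_at_top[of t] by eventually_elim (use V_mono that in auto)
    qed simp
    have "f p \<noteq> f y"
    proof
      assume eq: "f p = f y"
      have "V t = f p" if "t \<ge> 0" for t
        using V_ge[OF that] V_mono[of 0 t] that eq init by (auto simp: V_def)
      then have "((\<lambda>_. f p) has_real_derivative - (norm (g (\<psi> 0)))\<^sup>2) (at 0 within {0..})"
        using V'[of 0] by (subst has_field_derivative_cong_ev[where g=V and y=0 and S="{0..}" and t="{0..}"])
          (auto simp: eventually_at_filter)
      moreover have "((\<lambda>_. f p) has_real_derivative 0) (at 0 within {0..})" by simp
      moreover have "at (0::real) within {0..} \<noteq> bot"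
        using at_le[of "{0<..}" "{0..}" "0::real"] trivial_limit_at_right_real[of 0]
        by (auto simp: bot_unique Ioi_le_Ico)
      ultimately have "- (norm (g (\<psi> 0)))\<^sup>2 = 0"
        using has_field_derivative_unique by blast
      then show False using noncrit[of y] y init by simp
    qed
    then show ?thesis using V_ge[of 0] init by (simp add: V_def)
  qed
  show ?thesis
    by (rule that[of "min r (min d1 d2)"]) (use r(1) d1 d2 noncrit larger in auto)
qed

section \<open>Cluster points of sequences\<close>

text \<open>
  This is stated through recurrence rather than through subsequences because the arguments below start the
  scheme at arbitrarily late times close to the cluster point.
\<close>

definition cluster_point :: "(nat \<Rightarrow> 'a::metric_space) \<Rightarrow> 'a \<Rightarrow> bool" where
  "cluster_point z p \<longleftrightarrow> (\<forall>e>0. \<exists>\<^sub>F k in sequentially. dist (z k) p < e)"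

lemma cluster_pointE:
  assumes "cluster_point z p" "e > 0"
  obtains k where "k \<ge> N" "dist (z k) p < e"
  using assms unfolding cluster_point_def frequently_sequentially by metis

lemma cluster_pointI:
  assumes "\<And>e N. e > 0 \<Longrightarrow> \<exists>k\<ge>N. dist (z k) p < e"
  shows "cluster_point z p"
  using assms unfolding cluster_point_def frequently_sequentially by blast

lemma cluster_point_subsequence:
  assumes "strict_mono r" "(z \<circ> r) \<longlonglongrightarrow> p"
  shows "cluster_point z p"
proof (rule cluster_pointI)
  fix e :: real and N :: nat assume "e > 0"
  then obtain n where n: "\<And>k. k \<ge> n \<Longrightarrow> dist (z (r k)) p < e"
    using assms(2) unfolding lim_sequentially by auto
  have "r (max n N) \<ge> N" using seq_suble[OF assms(1), of "max n N"] by linarith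
  then show "\<exists>k\<ge>N. dist (z k) p < e" using n[of "max n N"] by auto
qed

lemma cluster_point_closed:
  assumes "\<And>n. cluster_point z (q n)" "q \<longlonglongrightarrow> p"
  shows "cluster_point z p"
proof (rule cluster_pointI)
  fix e :: real and N :: nat assume e: "e > 0"
  then obtain n where n: "dist (q n) p < e / 2"
    using assms(2) unfolding lim_sequentially by (meson half_gt_zero order_refl)
  obtain k where "k \<ge> N" "dist (z k) (q n) < e / 2"
    using cluster_pointE[OF assms(1)[of n], of "e/2" N] e by auto
  then show "\<exists>k\<ge>N. dist (z k) p < e" using n dist_triangle_half_l[of "z k" "q n" e p]
    by (metis dist_commute dist_triangle_half_r)
qed

lemma cluster_point_asymptotic:
  assumes "cluster_point z p" and lim: "(\<lambda>k. dist (y k) (z k)) \<longlonglongrightarrow> 0"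
  shows "cluster_point y p"
proof (rule cluster_pointI)
  fix e :: real and N :: nat assume e: "e > 0"
  then have "\<forall>\<^sub>F k in sequentially. dist (y k) (z k) < e / 2"
    using order_tendstoD(2)[OF lim, of "e / 2"] by simp
  then obtain n where n: "\<And>k. k \<ge> n \<Longrightarrow> dist (y k) (z k) < e / 2"
    by (auto simp: eventually_sequentially)
  obtain k where "k \<ge> max n N" "dist (z k) p < e / 2"
    using cluster_pointE[OF assms(1), of "e/2" "max n N"] e by auto
  then show "\<exists>k\<ge>N. dist (y k) p < e" using n[of k] dist_triangle[of "y k" p "z k"]
    by (intro exI[of _ k]) auto
qed

lemma tendsto_zero_along_convergent_subsequences:
  fixes x :: "nat \<Rightarrow> 'a::heine_borel" and y :: "nat \<Rightarrow> 'b::real_normed_vector"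
  assumes bdd: "bounded (range x)"
    and sub: "\<And>r p. strict_mono r \<Longrightarrow> (x \<circ> r) \<longlonglongrightarrow> p \<Longrightarrow> (y \<circ> r) \<longlonglongrightarrow> 0"
  shows "y \<longlonglongrightarrow> 0"
proof (rule ccontr)
  assume "\<not> y \<longlonglongrightarrow> 0"
  then obtain e where e: "e > 0" "\<And>N. \<exists>n\<ge>N. norm (y n) \<ge> e"
    unfolding LIMSEQ_iff by (auto simp: not_less)
  then have "infinite {n. norm (y n) \<ge> e}"
    by (auto simp: infinite_nat_iff_unbounded_le)
  then obtain r :: "nat \<Rightarrow> nat" where r: "strict_mono r" "\<And>n. norm (y (r n)) \<ge> e"
    using infinite_enumerate by blast
  have "bounded (range (x \<circ> r))" using bdd by (rule bounded_subset) auto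
  then obtain l s where s: "strict_mono s" "((x \<circ> r) \<circ> s) \<longlonglongrightarrow> l"
    using bounded_imp_convergent_subsequence by blast
  have "(y \<circ> (r \<circ> s)) \<longlonglongrightarrow> 0"
    using sub[of "r \<circ> s" l] s r(1) by (simp add: strict_mono_o o_assoc)
  then obtain n where "norm (y (r (s n))) < e"
    using e(1) unfolding LIMSEQ_iff by auto
  then show False using r(2)[of "s n"] by simp
qed

text \<open>
  A substitute for uniform continuity: a bounded sequence accumulates only at its cluster points, so
  continuity there is enough.
\<close>

lemma continuous_at_cluster_points_asymptotic:
  fixes x y :: "nat \<Rightarrow> 'a::{heine_borel,real_normed_vector}" and g :: "'a \<Rightarrow> 'b::real_normed_vector"
  assumes bdd: "bounded (range x)" and lim: "(\<lambda>k. y k - x k) \<longlonglongrightarrow> 0"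
    and cont: "\<And>p. cluster_point x p \<Longrightarrow> isCont g p"
  shows "(\<lambda>k. g (y k) - g (x k)) \<longlonglongrightarrow> 0"
proof (rule tendsto_zero_along_convergent_subsequences[OF bdd])
  fix r p assume r: "strict_mono r" and p: "(x \<circ> r) \<longlonglongrightarrow> p"
  have "((\<lambda>k. y k - x k) \<circ> r) \<longlonglongrightarrow> 0" using lim r by (rule LIMSEQ_subseq_LIMSEQ)
  from tendsto_add[OF this p] have "(\<lambda>k. y (r k)) \<longlonglongrightarrow> p" by (simp add: o_def)
  then have "(\<lambda>k. g (y (r k)) - g (x (r k))) \<longlonglongrightarrow> g p - g p"
    using p cont[OF cluster_point_subsequence[OF r p]]
    by (intro tendsto_diff isCont_tendsto_compose[of p g]) (auto simp: o_def)
  then show "((\<lambda>k. g (y k) - g (x k)) \<circ> r) \<longlonglongrightarrow> 0" by (simp add: o_def)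
qed

section \<open>Euler schemes follow solutions\<close>

lemma vector_derivative_increment_bound:
  fixes \<phi> :: "real \<Rightarrow> 'a::real_normed_vector"
  assumes "s \<le> t"
    and deriv: "\<And>u. u \<in> {s..t} \<Longrightarrow> (\<phi> has_vector_derivative \<phi>' u) (at u within {s..t})"
    and bound: "\<And>u. u \<in> {s..t} \<Longrightarrow> norm (\<phi>' u) \<le> C"
  shows "norm (\<phi> t - \<phi> s) \<le> C * (t - s)"
proof -
  have "norm (\<phi> t - \<phi> s) \<le> C * norm (t - s)"
  proof (rule differentiable_bound[of "{s..t}" \<phi> "\<lambda>u h. h *\<^sub>R \<phi>' u"])
    fix u assume "u \<in> {s..t}"
    then show "onorm (\<lambda>h. h *\<^sub>R \<phi>' u) \<le> C"
      using bound[of u] by (intro onorm_le) (simp add: mult.commute[of C] mult_left_mono)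
  qed (use assms in \<open>auto simp: has_vector_derivative_def\<close>)
  then show ?thesis using assms(1) by simp
qed

text \<open>
  If the scheme starts within a small distance of \<open>p\<close> at a late time, then over a time span \<open>h\<close> the
  distance to \<open>\<psi>\<close> stays small: the scheme errs through the perturbation, the time discretisation and the
  Lipschitz feedback of the distance itself. With \<open>L h \<le> 1/2\<close> the feedback contributes at most half of
  the target accuracy \<open>E\<close>, so no exponential growth estimate is needed.
\<close>

lemma euler_scheme_clusters_at_solution_locally:
  fixes z :: "nat \<Rightarrow> 'a::real_normed_vector"
  assumes rec: "\<And>k. z (Suc k) = z k - a k *\<^sub>R (g (z k) + b k)"
    and a: "\<And>k. a k > 0" "a \<longlonglongrightarrow> 0" "filterlim (\<lambda>N. \<Sum>k<N. a k) at_top sequentially"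
    and b: "b \<longlonglongrightarrow> 0"
    and R: "R > 0" and lip: "L-lipschitz_on (ball p R) g"
    and clus: "cluster_point z p"
    and sol: "solves_ode_on (\<lambda>y. - g y) {0..} \<psi>" and init: "\<psi> 0 = p"
  obtains h where "h > 0" "\<And>t. 0 \<le> t \<Longrightarrow> t \<le> h \<Longrightarrow> cluster_point z (\<psi> t)"
proof -
  have L: "L \<ge> 0" using lip by (rule lipschitz_on_nonneg)
  have "continuous_on {0..} \<psi>" using sol by (rule solves_ode_on_continuous)
  then obtain h0 where h0: "h0 > 0" "\<And>s. 0 \<le> s \<Longrightarrow> s < h0 \<Longrightarrow> dist (\<psi> s) p < R / 2"
    unfolding continuous_on_iff using init R
    by (metis abs_of_nonneg atLeast_iff diff_zero dist_real_def half_gt_zero order_refl)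
  define h where "h = min (h0 / 2) (1 / (2 * (L + 1)))"
  have h: "h > 0" "h < h0" "h \<le> 1" "L * h \<le> 1 / 2"
  proof -
    show "h > 0" using h0 L by (simp add: h_def)
    have "h \<le> 1 / (2 * (L + 1))" by (simp add: h_def)
    then have "L * h + h \<le> 1 / 2" using L by (simp add: field_simps)
    moreover have "L * h \<ge> 0" using L \<open>h > 0\<close> by simp
    ultimately show "L * h \<le> 1/2" "h \<le> 1" using \<open>h > 0\<close> by linarith+
    show "h < h0" using h0(1) by (simp add: h_def min_def)
  qed
  have near: "dist (\<psi> s) p < R / 2" if "0 \<le> s" "s \<le> h" for s
    using h0(2)[of s] h that by simp
  then have inb: "\<psi> s \<in> ball p R" if "0 \<le> s" "s \<le> h" for s
    using that R by (force simp: dist_commute)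
  define G where "G = norm (g p) + L * R"
  have G: "norm (g v) \<le> G" if "v \<in> ball p R" for v
  proof -
    have "norm (g v - g p) \<le> L * dist v p"
      using lipschitz_onD[OF lip that, of p] R by (simp add: dist_norm)
    also have "\<dots> \<le> L * R" using that L by (intro mult_left_mono) (auto simp: dist_commute)
    finally show ?thesis unfolding G_def using norm_triangle_sub[of "g v" "g p"] by linarith
  qed
  have G0: "G \<ge> 0" using L R by (simp add: G_def)
  have \<psi>_deriv: "(\<psi> has_vector_derivative - g (\<psi> u)) (at u within {s..t})"
    if "0 \<le> s" "u \<in> {s..t}" for s t u
  proof (rule has_vector_derivative_within_subset)
    show "(\<psi> has_vector_derivative - g (\<psi> u)) (at u within {0..})"
      using sol that by (simp add: solves_ode_on_def)
  qed (use that in auto)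
  have \<psi>_lip: "norm (\<psi> t - \<psi> s) \<le> G * (t - s)" if "0 \<le> s" "s \<le> t" "t \<le> h" for s t
    using that \<psi>_deriv G inb by (intro vector_derivative_increment_bound[of s t \<psi> "\<lambda>u. - g (\<psi> u)"]) auto
  have one_step: "norm (\<psi> (s + \<delta>) - \<psi> s + \<delta> *\<^sub>R g (\<psi> s)) \<le> L * G * \<delta> * \<delta>"
    if s: "0 \<le> s" "0 \<le> \<delta>" "s + \<delta> \<le> h" for s \<delta>
  proof -
    define w where "w u = \<psi> u + (u - s) *\<^sub>R g (\<psi> s)" for u
    have "norm (w (s + \<delta>) - w s) \<le> (L * (G * \<delta>)) * (s + \<delta> - s)"
    proof (rule vector_derivative_increment_bound[where \<phi>' = "\<lambda>u. - g (\<psi> u) + g (\<psi> s)"])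
      fix u assume u: "u \<in> {s..s + \<delta>}"
      show "(w has_vector_derivative - g (\<psi> u) + g (\<psi> s)) (at u within {s..s + \<delta>})"
        unfolding w_def by (rule derivative_eq_intros \<psi>_deriv s u | simp)+
      have "norm (- g (\<psi> u) + g (\<psi> s)) = dist (g (\<psi> u)) (g (\<psi> s))"
        by (simp add: dist_norm norm_minus_commute)
      also have "\<dots> \<le> L * dist (\<psi> u) (\<psi> s)"
        using u s by (intro lipschitz_onD[OF lip] inb) auto
      also have "\<dots> \<le> L * (G * \<delta>)"
      proof (intro mult_left_mono L)
        have "dist (\<psi> u) (\<psi> s) \<le> G * (u - s)" using \<psi>_lip[of s u] u s by (simp add: dist_norm)
        also have "\<dots> \<le> G * \<delta>" using u G0 by (intro mult_left_mono) auto
        finally show "dist (\<psi> u) (\<psi> s) \<le> G * \<delta>" .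
      qed
      finally show "norm (- g (\<psi> u) + g (\<psi> s)) \<le> L * (G * \<delta>)" .
    qed (use s in auto)
    then show ?thesis by (simp add: w_def algebra_simps)
  qed
  have "cluster_point z (\<psi> t)" if t: "0 \<le> t" "t \<le> h" for t
  proof (rule cluster_pointI)
    fix e :: real and N :: nat assume e: "e > 0"
    define E where "E = min e R / 2"
    have E: "E > 0" "2 * E \<le> e" "2 * E \<le> R" using e R by (auto simp: E_def)
    have "(\<lambda>m. norm (b m)) \<longlonglongrightarrow> 0" "(\<lambda>m. L * G * a m) \<longlonglongrightarrow> 0" "(\<lambda>m. G * a m) \<longlonglongrightarrow> 0"
      using b a(2) by (auto intro!: tendsto_eq_intros tendsto_norm_zero)
    then have "\<forall>\<^sub>F m in sequentially. norm (b m) < E/8 \<and> L * G * a m < E/8 \<and> G * a m < E"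
      using E(1) by (intro eventually_conj order_tendstoD(2)[where y=0]) auto
    then obtain N1 where N1: "\<And>m. m \<ge> N1 \<Longrightarrow> norm (b m) \<le> E/8"
      "\<And>m. m \<ge> N1 \<Longrightarrow> L * G * a m \<le> E/8" "\<And>m. m \<ge> N1 \<Longrightarrow> G * a m < E"
      unfolding eventually_sequentially by (meson less_imp_le)
    obtain k where k: "k \<ge> max N N1" "dist (z k) p < E / 4"
      using cluster_pointE[OF clus, of "E/4" "max N N1"] E(1) by auto
    define s where "s j = (\<Sum>i<j. a (k + i))" for j
    have s_Suc: "s (Suc j) = s j + a (k + j)" for j by (simp add: s_def)
    have s0: "s j \<ge> 0" for j unfolding s_def using a(1) by (intro sum_nonneg) (simp add: less_imp_le)
    \<comment> \<open>\<open>L * E\<close> bounds the feedback and \<open>E/4\<close> bounds perturbation plus discretisation per unit of time\<close>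
    have track: "dist (z (k + j)) (\<psi> (s j)) \<le> E/4 + s j * (L * E + E/4)" if "s j \<le> h" for j
      using that
    proof (induction j)
      case 0
      then show ?case using k init by (simp add: s_def)
    next
      case (Suc j)
      define \<alpha> where "\<alpha> = a (k + j)"
      have \<alpha>: "\<alpha> > 0" using a(1) by (simp add: \<alpha>_def)
      have sj: "s j + \<alpha> \<le> h" "s j \<le> h" using Suc.prems \<alpha> by (auto simp: s_Suc \<alpha>_def[symmetric])
      define u where "u = z (k + j)"
      define v where "v = \<psi> (s j)"
      have IH: "dist u v \<le> E/4 + s j * (L * E + E/4)" using Suc.IH sj by (simp add: u_def v_def)
      also have "\<dots> \<le> E"
      proof -
        have "s j * (L * E + E/4) \<le> h * (L * E + E/4)"
          using sj L E by (intro mult_right_mono) auto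
        also have "\<dots> = (L * h) * E + h * E / 4" by (simp add: algebra_simps)
        also have "\<dots> \<le> 1/2 * E + 1 * E / 4"
          using h E by (intro add_mono mult_right_mono divide_right_mono) auto
        finally show ?thesis using E by simp
      qed
      finally have uvE: "dist u v \<le> E" .
      have vb: "dist v p < R / 2" using near[OF s0 sj(2)] by (simp add: v_def)
      then have "dist u p < R" using uvE E dist_triangle[of u p v] by linarith
      then have ub: "u \<in> ball p R" "v \<in> ball p R" using vb R by (auto simp: dist_commute)
      have gl: "norm (g u - g v) \<le> L * E"
        using lipschitz_onD[OF lip ub] mult_left_mono[OF uvE L] by (simp add: dist_norm)
      define q where "q = \<psi> (s j + \<alpha>) - v + \<alpha> *\<^sub>R g v"
      have q: "norm q \<le> \<alpha> * (E/8)"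
      proof -
        have "norm q \<le> \<alpha> * (L * G * \<alpha>)"
          using one_step[of "s j" \<alpha>] s0[of j] \<alpha> sj by (simp add: q_def v_def mult_ac)
        also have "\<dots> \<le> \<alpha> * (E/8)"
          using \<alpha> N1(2)[of "k + j"] k by (intro mult_left_mono) (auto simp: \<alpha>_def)
        finally show ?thesis .
      qed
      have "z (k + Suc j) - \<psi> (s (Suc j)) = (u - v) - \<alpha> *\<^sub>R (g u - g v) - \<alpha> *\<^sub>R b (k + j) - q"
        using rec[of "k + j"] by (simp add: u_def v_def q_def s_Suc \<alpha>_def algebra_simps)
      then have "dist (z (k + Suc j)) (\<psi> (s (Suc j)))
          \<le> dist u v + \<alpha> * norm (g u - g v) + \<alpha> * norm (b (k + j)) + norm q"
        unfolding dist_norm using \<alpha>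
          norm_triangle_ineq4[of "u - v" "\<alpha> *\<^sub>R (g u - g v)"]
          norm_triangle_ineq4[of "u - v - \<alpha> *\<^sub>R (g u - g v)" "\<alpha> *\<^sub>R b (k + j)"]
          norm_triangle_ineq4[of "u - v - \<alpha> *\<^sub>R (g u - g v) - \<alpha> *\<^sub>R b (k + j)" q]
        by simp
      also have "\<dots> \<le> E/4 + s j * (L * E + E/4) + \<alpha> * (L * E) + \<alpha> * (E/8) + \<alpha> * (E/8)"
        using N1(1)[of "k + j"] k \<alpha> by (intro add_mono IH mult_left_mono gl q) auto
      also have "\<dots> = E/4 + s (Suc j) * (L * E + E/4)"
        by (simp add: s_Suc \<alpha>_def algebra_simps)
      finally show ?case .
    qed
    have "\<exists>j. s (Suc j) > t"
    proof -
      have shift: "(\<Sum>i<k + j. a i) = (\<Sum>i<k. a i) + s j" for j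
        by (induction j) (auto simp: s_def)
      have "\<forall>\<^sub>F n in sequentially. (\<Sum>i<n. a i) > (\<Sum>i<k. a i) + t"
        using a(3) by (simp add: filterlim_at_top_dense)
      then obtain n where n: "\<And>m. m \<ge> n \<Longrightarrow> (\<Sum>i<m. a i) > (\<Sum>i<k. a i) + t"
        by (auto simp: eventually_sequentially)
      have "s (Suc n) > t" using n[of "k + Suc n"] unfolding shift by simp
      then show ?thesis by blast
    qed
    \<comment> \<open>\<open>j\<close> is the last index whose algorithmic time does not exceed \<open>t\<close>\<close>
    then obtain j where j: "s (Suc j) > t" "\<And>i. i < j \<Longrightarrow> \<not> s (Suc i) > t"
      using exists_least_iff[of "\<lambda>j. s (Suc j) > t"] by auto
    have sj: "s j \<le> t"
      using j(2)[of "j - 1"] t by (cases j) (auto simp: s_def)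
    have "dist (z (k + j)) (\<psi> (s j)) \<le> E"
    proof -
      have "s j * (L * E + E/4) \<le> h * (L * E + E/4)"
        using sj t L E by (intro mult_right_mono) auto
      also have "\<dots> = (L * h) * E + h * E / 4" by (simp add: algebra_simps)
      also have "\<dots> \<le> 1/2 * E + 1 * E / 4"
        using h E by (intro add_mono mult_right_mono divide_right_mono) auto
      finally show ?thesis using E track[of j] sj t by simp
    qed
    moreover have "dist (\<psi> (s j)) (\<psi> t) < E"
    proof -
      have "dist (\<psi> (s j)) (\<psi> t) \<le> G * (t - s j)"
        using \<psi>_lip[of "s j" t] s0[of j] sj t by (simp add: dist_norm norm_minus_commute)
      also have "\<dots> \<le> G * a (k + j)" using j(1) G0 by (intro mult_left_mono) (auto simp: s_Suc)
      also have "\<dots> < E" using N1(3)[of "k + j"] k by simp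
      finally show ?thesis .
    qed
    ultimately have "dist (z (k + j)) (\<psi> t) < e"
      using E dist_triangle[of "z (k + j)" "\<psi> t" "\<psi> (s j)"] by linarith
    then show "\<exists>k\<ge>N. dist (z k) (\<psi> t) < e" using k by (intro exI[of _ "k + j"]) auto
  qed
  then show ?thesis using that h(1) by blast
qed

text \<open>
  The infimum of the times at which \<open>\<phi>\<close> fails to be a cluster point would itself be a time at which
  \<open>\<phi>\<close> is one, since the cluster points form a closed set; the local result then carries on beyond it.
\<close>

lemma solution_through_cluster_point_clusters:
  fixes z :: "nat \<Rightarrow> 'a::real_normed_vector"
  assumes rec: "\<And>k. z (Suc k) = z k - a k *\<^sub>R (g (z k) + b k)"
    and a: "\<And>k. a k > 0" "a \<longlonglongrightarrow> 0" "filterlim (\<lambda>N. \<Sum>k<N. a k) at_top sequentially"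
    and b: "b \<longlonglongrightarrow> 0"
    and lip: "\<And>p. cluster_point z p \<Longrightarrow> \<exists>R>0. \<exists>L. L-lipschitz_on (ball p R) g"
    and sol: "solves_ode_on (\<lambda>y. - g y) {0..} \<phi>" and init: "cluster_point z (\<phi> 0)"
    and t: "t \<ge> 0"
  shows "cluster_point z (\<phi> t)"
proof (rule ccontr)
  assume not: "\<not> cluster_point z (\<phi> t)"
  define B where "B = {s. s \<ge> 0 \<and> \<not> cluster_point z (\<phi> s)}"
  define \<tau> where "\<tau> = Inf B"
  have B: "B \<noteq> {}" "bdd_below B" using not t by (auto simp: B_def bdd_below_def intro: exI[of _ 0])
  have \<tau>: "\<tau> \<ge> 0" unfolding \<tau>_def using B by (intro cInf_greatest) (auto simp: B_def)
  have before: "cluster_point z (\<phi> s)" if "0 \<le> s" "s < \<tau>" for s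
  proof (rule ccontr)
    assume "\<not> cluster_point z (\<phi> s)"
    then have "s \<in> B" using that by (simp add: B_def)
    then show False using cInf_lower[OF _ B(2), of s] that by (simp add: \<tau>_def)
  qed
  have at_\<tau>: "cluster_point z (\<phi> \<tau>)"
  proof (cases "\<tau> = 0")
    case False
    then have pos: "\<tau> > 0" using \<tau> by simp
    define q where "q n = \<tau> - \<tau> / real (Suc n)" for n
    have q: "0 \<le> q n" "q n < \<tau>" for n using pos by (auto simp: q_def field_simps)
    have "q \<longlonglongrightarrow> \<tau> - 0"
      unfolding q_def using lim_const_over_n[of \<tau>, THEN LIMSEQ_Suc] by (intro tendsto_diff) auto
    moreover have "continuous_on {0..} \<phi>" using sol by (rule solves_ode_on_continuous)
    ultimately have "(\<lambda>n. \<phi> (q n)) \<longlonglongrightarrow> \<phi> \<tau>"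
      using \<tau> q(1) by (intro continuous_on_tendsto_compose[of "{0..}" \<phi>]) auto
    then show ?thesis using before q by (rule_tac cluster_point_closed[of _ "\<lambda>n. \<phi> (q n)"]) auto
  qed (use init in simp)
  obtain R L where "R > 0" "L-lipschitz_on (ball (\<phi> \<tau>) R) g" using lip[OF at_\<tau>] by blast
  from euler_scheme_clusters_at_solution_locally[OF rec a b this at_\<tau> solves_ode_on_shift[OF sol \<tau>]]
  obtain h where h: "h > 0" "\<And>t. 0 \<le> t \<Longrightarrow> t \<le> h \<Longrightarrow> cluster_point z (\<phi> (\<tau> + t))"
    by auto
  obtain s where s: "s \<in> B" "s < \<tau> + h"
    using cInf_lessD[OF B(1), of "\<tau> + h"] h(1) by (auto simp: \<tau>_def)
  then have "s \<ge> \<tau>" using cInf_lower[OF s(1) B(2)] by (simp add: \<tau>_def)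
  then have "cluster_point z (\<phi> s)" using h(2)[of "s - \<tau>"] s by simp
  then show False using s(1) by (simp add: B_def)
qed

section \<open>Perturbed gradient descent\<close>

lemma gradient_mean_value:
  fixes f :: "'a::real_inner \<Rightarrow> real"
  assumes grad: "\<And>y. GDERIV f y :> g y"
  obtains \<theta> where "0 < \<theta>" "\<theta> < 1" "f (u + w) - f u = g (u + \<theta> *\<^sub>R w) \<bullet> w"
proof -
  have deriv: "((\<lambda>t. f (u + t *\<^sub>R w)) has_real_derivative g (u + t *\<^sub>R w) \<bullet> w) (at t)" for t
  proof -
    have 1: "((\<lambda>t. u + t *\<^sub>R w) has_derivative (\<lambda>h. h *\<^sub>R w)) (at t)"
      by (auto intro!: derivative_eq_intros)
    have 2: "(f has_derivative (\<lambda>h. h \<bullet> g (u + t *\<^sub>R w))) (at (u + t *\<^sub>R w))"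
      using grad[of "u + t *\<^sub>R w"] by (simp add: gderiv_def)
    show ?thesis
      unfolding has_field_derivative_def
      by (rule has_derivative_eq_rhs[OF has_derivative_compose[OF 1 2]])
         (auto simp: inner_commute mult.commute)
  qed
  obtain \<theta> where "0 < \<theta>" "\<theta> < 1" "f (u + 1 *\<^sub>R w) - f (u + 0 *\<^sub>R w) = (1 - 0) * (g (u + \<theta> *\<^sub>R w) \<bullet> w)"
    using MVT2[of 0 1 "\<lambda>t. f (u + t *\<^sub>R w)" "\<lambda>t. g (u + t *\<^sub>R w) \<bullet> w"] deriv by auto
  then show ?thesis by (intro that) auto
qed

text \<open>
  The linear term of the change of \<open>f\<close> is at most \<open>- 3/4 \<alpha> \<bar>g u\<bar>\<^sup>2\<close> by the bound on \<open>b\<close>. The gradient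
  moves by at most \<open>5/16 \<bar>g u\<bar>\<close> along the step, whose length is at most \<open>5/4 \<alpha> \<bar>g u\<bar>\<close>, so the error is
  at most \<open>25/64 \<alpha> \<bar>g u\<bar>\<^sup>2\<close>.
\<close>

lemma perturbed_gradient_step_decreases:
  fixes f :: "'a::real_inner \<Rightarrow> real"
  assumes grad: "\<And>y. GDERIV f y :> g y"
    and lip: "L-lipschitz_on (ball p R) g"
    and u: "u \<in> ball p R" "u - \<alpha> *\<^sub>R (g u + b) \<in> ball p R"
    and \<alpha>: "\<alpha> \<ge> 0" "L * \<alpha> \<le> 1/4" and b: "norm b \<le> norm (g u) / 4"
  shows "f (u - \<alpha> *\<^sub>R (g u + b)) \<le> f u"
proof -
  have L: "L \<ge> 0" using lip by (rule lipschitz_on_nonneg)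
  define w where "w = - (\<alpha> *\<^sub>R (g u + b))"
  define n where "n = norm (g u)"
  obtain \<theta> where \<theta>: "0 < \<theta>" "\<theta> < 1" "f (u + w) - f u = g (u + \<theta> *\<^sub>R w) \<bullet> w"
    using gradient_mean_value[OF grad, of u w] by blast
  have "u + \<theta> *\<^sub>R w = (1 - \<theta>) *\<^sub>R u + \<theta> *\<^sub>R (u + w)" by (simp add: algebra_simps)
  also have "\<dots> \<in> ball p R"
    using u \<theta> by (intro convexD convex_ball) (auto simp: w_def)
  finally have inb: "u + \<theta> *\<^sub>R w \<in> ball p R" .
  have nw: "norm w \<le> \<alpha> * (5/4 * n)"
  proof -
    have "norm (g u + b) \<le> 5/4 * n" using norm_triangle_ineq[of "g u" b] b by (simp add: n_def)
    then have "\<alpha> * norm (g u + b) \<le> \<alpha> * (5/4 * n)" using \<alpha>(1) by (rule mult_left_mono)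
    then show ?thesis using \<alpha>(1) by (simp add: w_def)
  qed
  have "norm (g (u + \<theta> *\<^sub>R w) - g u) \<le> L * norm w"
  proof -
    have "norm (g (u + \<theta> *\<^sub>R w) - g u) \<le> L * (\<theta> * norm w)"
      using lipschitz_onD[OF lip inb u(1)] \<theta> by (simp add: dist_norm)
    also have "\<dots> \<le> L * norm w"
      using \<theta> L by (intro mult_left_mono) (auto simp: mult_left_le_one_le)
    finally show ?thesis .
  qed
  also have "\<dots> \<le> L * (\<alpha> * (5/4 * n))" using nw L by (rule mult_left_mono)
  also have "\<dots> = (L * \<alpha>) * (5/4 * n)" by simp
  also have "\<dots> \<le> 1/4 * (5/4 * n)" using \<alpha> by (intro mult_right_mono) (auto simp: n_def)
  finally have gd: "norm (g (u + \<theta> *\<^sub>R w) - g u) \<le> 5/16 * n" by simp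
  have "(g (u + \<theta> *\<^sub>R w) - g u) \<bullet> w \<le> norm (g (u + \<theta> *\<^sub>R w) - g u) * norm w"
    by (rule norm_cauchy_schwarz)
  also have "\<dots> \<le> (5/16 * n) * (\<alpha> * (5/4 * n))"
    using gd nw by (intro mult_mono) (auto simp: n_def)
  finally have 1: "(g (u + \<theta> *\<^sub>R w) - g u) \<bullet> w \<le> 25/64 * (\<alpha> * n\<^sup>2)" by (simp add: power2_eq_square mult_ac)
  have "- (g u \<bullet> b) \<le> norm (g u) * norm b" using norm_cauchy_schwarz[of "g u" "- b"] by simp
  also have "\<dots> \<le> n * (n / 4)" unfolding n_def using b by (intro mult_left_mono) auto
  finally have "- (g u \<bullet> g u) - g u \<bullet> b \<le> - (3/4 * n\<^sup>2)"
    by (simp add: n_def power2_eq_square flip: power2_norm_eq_inner)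
  then have "\<alpha> * (- (g u \<bullet> g u) - g u \<bullet> b) \<le> \<alpha> * - (3/4 * n\<^sup>2)" using \<alpha>(1) by (rule mult_left_mono)
  then have "g u \<bullet> w \<le> - (3/4 * (\<alpha> * n\<^sup>2))" by (simp add: w_def inner_right_distrib algebra_simps)
  with 1 have "g (u + \<theta> *\<^sub>R w) \<bullet> w \<le> - (23/64 * (\<alpha> * n\<^sup>2))" by (simp add: inner_diff_left)
  moreover have "0 \<le> \<alpha> * n\<^sup>2" using \<alpha>(1) by simp
  ultimately have "f (u + w) \<le> f u" using \<theta>(3) by linarith
  then show ?thesis by (simp add: w_def)
qed

text \<open>
  Let \<open>m\<close> be the minimum of \<open>f\<close> on the shell between the radii \<open>\<epsilon>/2\<close> and \<open>\<epsilon>\<close>. The set of points within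
  \<open>\<epsilon>/2\<close> of \<open>p\<close> at which \<open>f < m\<close> is eventually invariant. Steps are too short to jump over the shell, and
  landing in it would need \<open>f \<ge> m\<close>. The value of \<open>f\<close> stays below \<open>m\<close>: away from \<open>p\<close> the step decreases it,
  and next to \<open>p\<close>, where the gradient may be smaller than the perturbation, a short step cannot leave the
  ball of radius \<open>\<rho>\<close>, on which \<open>f < m\<close> anyway.
\<close>

lemma perturbed_gradient_descent_trapped_at_strict_minimum:
  fixes f :: "'a::euclidean_space \<Rightarrow> real"
  assumes grad: "\<And>y. GDERIV f y :> g y"
    and rec: "\<And>k. z (Suc k) = z k - a k *\<^sub>R (g (z k) + b k)"
    and a: "\<And>k. a k > 0" "a \<longlonglongrightarrow> 0" and b: "b \<longlonglongrightarrow> 0"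
    and R: "R > 0" and lip: "L-lipschitz_on (ball p R) g"
    and d: "d > 0" and crit: "\<And>y. y \<noteq> p \<Longrightarrow> dist y p < d \<Longrightarrow> g y \<noteq> 0"
    and min: "\<And>y. y \<noteq> p \<Longrightarrow> dist y p < d \<Longrightarrow> f p < f y"
    and clus: "cluster_point z p"
  shows "z \<longlonglongrightarrow> p"
proof (rule metric_LIMSEQ_I)
  fix e :: real assume e: "e > 0"
  define \<epsilon> where "\<epsilon> = min e (min d R) / 2"
  have \<epsilon>: "\<epsilon> > 0" "\<epsilon> < e" "\<epsilon> < d" "\<epsilon> < R" using e d R by (auto simp: \<epsilon>_def)
  have shell: "compact (cball p \<epsilon> - ball p r)" for r by (intro compact_diff) auto
  have f_cont: "isCont f y" for y
    using grad[of y] by (auto simp: gderiv_def intro: has_derivative_continuous)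
  have g_cont: "continuous_on (ball p R) g" using lip by (rule lipschitz_on_continuous_on)
  obtain m where m: "m > f p" "\<And>y. \<epsilon> / 2 \<le> dist y p \<Longrightarrow> dist y p \<le> \<epsilon> \<Longrightarrow> m \<le> f y"
  proof (cases "cball p \<epsilon> - ball p (\<epsilon>/2) = {}")
    case True
    have "y \<notin> cball p \<epsilon> - ball p (\<epsilon>/2)" for y unfolding True by simp
    then show ?thesis by (intro that[of "f p + 1"]) (auto simp: dist_commute not_less not_le, smt (verit))
  next
    case False
    have "continuous_on (cball p \<epsilon> - ball p (\<epsilon>/2)) f"
      using f_cont by (simp add: continuous_at_imp_continuous_on)
    then obtain y0 where y0: "y0 \<in> cball p \<epsilon> - ball p (\<epsilon>/2)"
      "\<And>y. y \<in> cball p \<epsilon> - ball p (\<epsilon>/2) \<Longrightarrow> f y0 \<le> f y"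
      using continuous_attains_inf[OF shell False] by blast
    have "f p < f y0" using y0(1) \<epsilon> by (intro min) (auto simp: dist_commute)
    then show ?thesis by (intro that[of "f y0"] y0(2)) (auto simp: dist_commute)
  qed
  have "\<exists>\<rho>0>0. \<forall>y. dist y p < \<rho>0 \<longrightarrow> f y < m"
    using order_tendstoD(2)[OF f_cont[unfolded isCont_def, of p] m(1)] m(1)
    unfolding eventually_at by (metis UNIV_I)
  then obtain \<rho>0 where \<rho>0: "\<rho>0 > 0" "\<And>y. dist y p < \<rho>0 \<Longrightarrow> f y < m" by blast
  define \<rho> where "\<rho> = min \<rho>0 (\<epsilon> / 2)"
  have \<rho>: "\<rho> > 0" "\<rho> \<le> \<epsilon> / 2" "\<And>y. dist y p < \<rho> \<Longrightarrow> f y < m"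
    using \<rho>0 \<epsilon> by (auto simp: \<rho>_def)
  obtain \<gamma> where \<gamma>: "\<gamma> > 0" "\<And>y. \<rho> / 2 \<le> dist y p \<Longrightarrow> dist y p \<le> \<epsilon> \<Longrightarrow> \<gamma> \<le> norm (g y)"
  proof (cases "cball p \<epsilon> - ball p (\<rho>/2) = {}")
    case True
    have "y \<notin> cball p \<epsilon> - ball p (\<rho>/2)" for y unfolding True by simp
    then show ?thesis by (intro that[of 1]) (auto simp: dist_commute not_less not_le, smt (verit))
  next
    case False
    have "continuous_on (cball p \<epsilon> - ball p (\<rho>/2)) (\<lambda>y. norm (g y))"
      using \<epsilon> by (intro continuous_on_norm continuous_on_subset[OF g_cont]) auto
    then obtain y0 where y0: "y0 \<in> cball p \<epsilon> - ball p (\<rho>/2)"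
      "\<And>y. y \<in> cball p \<epsilon> - ball p (\<rho>/2) \<Longrightarrow> norm (g y0) \<le> norm (g y)"
      using continuous_attains_inf[OF shell False] by blast
    have "g y0 \<noteq> 0" using y0(1) \<epsilon> \<rho>(1) by (intro crit) (auto simp: dist_commute)
    then show ?thesis by (intro that[of "norm (g y0)"] y0(2)) (auto simp: dist_commute)
  qed
  define G where "G = norm (g p) + L * R"
  have G: "norm (g v) \<le> G" if "v \<in> ball p R" for v
  proof -
    have "norm (g v - g p) \<le> L * dist v p"
      using lipschitz_onD[OF lip that, of p] R by (simp add: dist_norm)
    also have "\<dots> \<le> L * R"
      using that lipschitz_on_nonneg[OF lip] by (intro mult_left_mono) (auto simp: dist_commute)
    finally show ?thesis unfolding G_def using norm_triangle_sub[of "g v" "g p"] by linarith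
  qed
  have "(\<lambda>m. norm (b m)) \<longlonglongrightarrow> 0" "(\<lambda>m. L * a m) \<longlonglongrightarrow> 0" "(\<lambda>m. a m * (G + 1)) \<longlonglongrightarrow> 0"
    using b a(2) by (auto intro!: tendsto_eq_intros tendsto_norm_zero)
  then have "\<forall>\<^sub>F m in sequentially. norm (b m) < min (\<gamma>/4) 1 \<and> L * a m < 1/4 \<and> a m * (G + 1) < \<rho>/2"
    using \<gamma> \<rho>(1) by (intro eventually_conj order_tendstoD(2)[where y=0]) auto
  then obtain N where N: "\<And>m. m \<ge> N \<Longrightarrow> norm (b m) < min (\<gamma>/4) 1"
    "\<And>m. m \<ge> N \<Longrightarrow> L * a m < 1/4" "\<And>m. m \<ge> N \<Longrightarrow> a m * (G + 1) < \<rho>/2"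
    unfolding eventually_sequentially by blast
  define P where "P k \<longleftrightarrow> dist (z k) p < \<epsilon> / 2 \<and> f (z k) < m" for k
  have step: "P (Suc k)" if k: "k \<ge> N" "P k" for k
  proof -
    have zk: "dist (z k) p < \<epsilon> / 2" "f (z k) < m" "z k \<in> ball p R"
      using k \<epsilon> by (auto simp: P_def dist_commute)
    have "dist (z (Suc k)) (z k) = a k * norm (g (z k) + b k)"
      using a(1)[of k] by (simp add: rec dist_norm)
    also have "\<dots> \<le> a k * (G + 1)"
      using a(1)[of k] norm_triangle_ineq[of "g (z k)" "b k"] G[OF zk(3)] N(1)[OF k(1)]
      by (intro mult_left_mono) auto
    also have "\<dots> < \<rho> / 2" using N(3) k by simp
    finally have move: "dist (z (Suc k)) (z k) < \<rho> / 2" .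
    then have near: "dist (z (Suc k)) p < \<epsilon>"
      using zk(1) \<rho>(2) \<rho>(1) dist_triangle[of "z (Suc k)" p "z k"] by linarith
    have below: "f (z (Suc k)) < m"
    proof (cases "dist (z k) p < \<rho> / 2")
      case True
      then show ?thesis using move dist_triangle[of "z (Suc k)" p "z k"] by (intro \<rho>(3)) linarith
    next
      case False
      then have "\<gamma> \<le> norm (g (z k))" using \<gamma>(2)[of "z k"] zk \<epsilon>(1) by auto
      then have "norm (b k) \<le> norm (g (z k)) / 4" using N(1)[OF k(1)] by simp
      moreover have "z (Suc k) \<in> ball p R" using near \<epsilon> by (simp add: dist_commute)
      ultimately have "f (z (Suc k)) \<le> f (z k)"
        using perturbed_gradient_step_decreases[OF grad lip zk(3), of "a k" "b k"] a(1)[of k] N(2)[OF k(1)]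
        by (simp add: rec)
      then show ?thesis using zk by simp
    qed
    have "dist (z (Suc k)) p < \<epsilon> / 2" using m(2)[of "z (Suc k)"] near below by force
    then show ?thesis using below by (simp add: P_def)
  qed
  obtain k0 where k0: "k0 \<ge> N" "dist (z k0) p < \<rho>"
    using cluster_pointE[OF clus \<rho>(1)] by blast
  have "P k" if "k \<ge> k0" for k
    using that
  proof (induction k rule: dec_induct)
    case base
    show ?case using k0 \<rho>(2) \<rho>(3)[OF k0(2)] by (simp add: P_def)
  next
    case (step k)
    then show ?case using k0(1) \<open>\<And>k. N \<le> k \<Longrightarrow> P k \<Longrightarrow> P (Suc k)\<close> by simp
  qed
  then show "\<exists>no. \<forall>n\<ge>no. dist (z n) p < e" using \<epsilon> by (intro exI[of _ k0]) (force simp: P_def)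
qed

text \<open>
  The convergent noise is absorbed by passing to \<open>z k = x k + W k\<close>, where \<open>W k\<close> is minus the remainder
  of the series from index \<open>k\<close> on; evaluating \<open>g\<close> at \<open>z k\<close> instead of \<open>x k\<close> only changes the vanishing
  perturbation.
\<close>

theorem gradient_recursion_converges:
  fixes f :: "'a::euclidean_space \<Rightarrow> real"
  assumes grad: "\<And>y. GDERIV f y :> g y"
    and rec: "\<And>k. x (Suc k) = x k - a k *\<^sub>R (g (x k) + b k) - w k"
    and a: "\<And>k. a k > 0" "a \<longlonglongrightarrow> 0" "filterlim (\<lambda>N. \<Sum>k<N. a k) at_top sequentially"
    and b: "b \<longlonglongrightarrow> 0" and w: "summable w"
    and bdd: "bounded (range x)"
    and lip: "\<And>p. cluster_point x p \<Longrightarrow> \<exists>R>0. \<exists>L. L-lipschitz_on (ball p R) g"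
    and stable: "asymptotically_stable (\<lambda>y. - g y) p"
    and S: "compact S" "S \<subseteq> attraction_domain (\<lambda>y. - g y) p" "infinite {k. x k \<in> S}"
  shows "x \<longlonglongrightarrow> p"
proof -
  define W where "W k = (\<Sum>i<k. w i) - suminf w" for k
  define z where "z k = x k + W k" for k
  have W: "W \<longlonglongrightarrow> 0"
    unfolding W_def using tendsto_diff[OF summable_LIMSEQ[OF w] tendsto_const[of "suminf w"]] by simp
  have zx: "(\<lambda>k. z k - x k) \<longlonglongrightarrow> 0" using W by (simp add: z_def)
  then have dzx: "(\<lambda>k. dist (z k) (x k)) \<longlonglongrightarrow> 0" by (simp add: dist_norm tendsto_norm_zero)
  then have dxz: "(\<lambda>k. dist (x k) (z k)) \<longlonglongrightarrow> 0" by (simp add: dist_commute)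
  have x_clus: "cluster_point x q" if "cluster_point z q" for q
    using cluster_point_asymptotic[OF that dxz] .
  define b' where "b' k = b k - (g (z k) - g (x k))" for k
  have "isCont g q" if q: "cluster_point x q" for q
  proof -
    obtain R L where "R > 0" "L-lipschitz_on (ball q R) g" using lip[OF q] by blast
    then have "continuous_on (ball q R) g" using lipschitz_on_continuous_on by blast
    then show ?thesis using \<open>R > 0\<close> by (simp add: continuous_on_eq_continuous_at)
  qed
  from continuous_at_cluster_points_asymptotic[OF bdd zx this]
  have b': "b' \<longlonglongrightarrow> 0" unfolding b'_def using tendsto_diff[OF b] by fastforce
  have z_rec: "z (Suc k) = z k - a k *\<^sub>R (g (z k) + b' k)" for k
    by (simp add: z_def b'_def rec W_def algebra_simps)
  obtain r :: "nat \<Rightarrow> nat" where r: "strict_mono r" "\<And>n. x (r n) \<in> S"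
    using infinite_enumerate[OF S(3)] by blast
  then obtain y s where y: "y \<in> S" "strict_mono s" "((x \<circ> r) \<circ> s) \<longlonglongrightarrow> y"
    using S(1) unfolding compact_def by (metis comp_apply)
  then have "cluster_point x y"
    using cluster_point_subsequence[of "r \<circ> s" x y] r(1) by (simp add: strict_mono_o o_assoc)
  then have y_clus: "cluster_point z y" using dzx by (rule cluster_point_asymptotic)
  obtain \<phi> where \<phi>: "solves_ode_on (\<lambda>y. - g y) {0..} \<phi>" "\<phi> 0 = y" "(\<phi> \<longlongrightarrow> p) at_top"
    using S(2) y(1) unfolding attraction_domain_def by blast
  have z_lip: "\<exists>R>0. \<exists>L. L-lipschitz_on (ball q R) g" if "cluster_point z q" for q
    using lip[OF x_clus[OF that]] .
  have "cluster_point z (\<phi> (real n))" for n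
    using solution_through_cluster_point_clusters[OF z_rec a b' z_lip \<phi>(1)] y_clus \<phi>(2) by simp
  moreover have "(\<lambda>n. \<phi> (real n)) \<longlonglongrightarrow> p"
    using \<phi>(3) filterlim_real_sequentially by (rule filterlim_compose)
  ultimately have p_clus: "cluster_point z p" by (rule cluster_point_closed)
  obtain R L where RL: "R > 0" "L-lipschitz_on (ball p R) g" using z_lip[OF p_clus] by blast
  obtain d where "d > 0" "\<And>y. y \<noteq> p \<Longrightarrow> dist y p < d \<Longrightarrow> g y \<noteq> 0"
    "\<And>y. y \<noteq> p \<Longrightarrow> dist y p < d \<Longrightarrow> f p < f y"
    using asymptotically_stable_gradient_flow_strict_minimum[OF grad stable RL(2,1)] by blast
  then have "z \<longlonglongrightarrow> p"
    using perturbed_gradient_descent_trapped_at_strict_minimum[OF grad z_rec a(1,2) b' RL _ _ _ p_clus]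
    by blast
  from tendsto_diff[OF this zx] show ?thesis by simp
qed

section \<open>Averages over sign vectors\<close>

definition sign_vector :: "'n set \<Rightarrow> real ^ 'n" where
  "sign_vector A = (\<chi> i. if i \<in> A then 1 else - 1)"

lemma bij_betw_sign_vector: "bij_betw (sign_vector :: 'n set \<Rightarrow> real ^ 'n) UNIV sign_vectors"
proof (rule bij_betwI[where g = "\<lambda>v. {i. v $ i = 1}"])
  show "sign_vector {i. v $ i = 1} = v" if "v \<in> sign_vectors" for v :: "real ^ 'n"
    using that unfolding sign_vector_def sign_vectors_def vec_eq_iff by (simp, metis)
qed (auto simp: sign_vector_def sign_vectors_def split: if_splits)

lemma finite_sign_vectors: "finite (sign_vectors :: (real ^ 'n) set)"
  using bij_betw_finite[OF bij_betw_sign_vector] by simp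

lemma card_sign_vectors: "card (sign_vectors :: (real ^ 'n) set) = 2 ^ CARD('n)"
  using bij_betw_same_card[OF bij_betw_sign_vector[where 'n='n]] by (simp add: card_UNIV_set)

lemma sign_vectors_component: "v \<in> sign_vectors \<Longrightarrow> v $ i = 1 \<or> v $ i = - 1"
  by (auto simp: sign_vectors_def)

lemma sign_vectors_square: "v \<in> sign_vectors \<Longrightarrow> v $ i * v $ i = 1"
  using sign_vectors_component[of v i] by auto

lemma sign_vectors_inverse: "v \<in> sign_vectors \<Longrightarrow> inverse (v $ i) = v $ i"
  using sign_vectors_component[of v i] by auto

text \<open>
  Flipping the sign of coordinate \<open>i\<close> is a bijection of the sign vectors that changes the sign of each
  summand when \<open>i \<noteq> j\<close>.
\<close>

lemma sum_sign_vectors_orthogonal: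
  "(\<Sum>v\<in>(sign_vectors :: (real ^ 'n) set). v $ i * v $ j) = (if i = j then 2 ^ CARD('n) else 0)"
proof (cases "i = j")
  case True
  then show ?thesis by (simp add: sign_vectors_square card_sign_vectors)
next
  case False
  define flip where "flip v = (\<chi> l. if l = i then - v $ l else v $ l)" for v :: "real ^ 'n"
  have "flip v \<in> sign_vectors" if "v \<in> sign_vectors" for v
    using that unfolding sign_vectors_def flip_def by (simp, metis minus_minus)
  moreover have "flip (flip v) = v" for v by (simp add: flip_def vec_eq_iff)
  ultimately have "bij_betw flip sign_vectors sign_vectors"
    by (intro bij_betwI[where g = flip]) auto
  then have "(\<Sum>v\<in>sign_vectors. v $ i * v $ j) = (\<Sum>v\<in>sign_vectors. flip v $ i * flip v $ j)"
    by (rule sum.reindex_bij_betw[symmetric])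
  also have "\<dots> = - (\<Sum>v\<in>sign_vectors. v $ i * v $ j)"
    using False by (simp add: flip_def sum_negf)
  finally show ?thesis using False by simp
qed

lemma sum_sign_vectors_isotropic:
  "(\<Sum>v\<in>(sign_vectors :: (real ^ 'n) set). (u \<bullet> v) * v $ i) = 2 ^ CARD('n) * u $ i"
proof -
  have "(\<Sum>v\<in>(sign_vectors :: (real ^ 'n) set). (u \<bullet> v) * v $ i)
      = (\<Sum>v\<in>sign_vectors. \<Sum>j\<in>UNIV. u $ j * (v $ j * v $ i))"
    by (simp add: inner_vec_def sum_distrib_right mult.assoc)
  also have "\<dots> = (\<Sum>j\<in>UNIV. u $ j * (\<Sum>v\<in>sign_vectors. v $ j * v $ i))"
    by (subst sum.swap) (simp add: sum_distrib_left)
  also have "\<dots> = 2 ^ CARD('n) * u $ i" by (simp add: sum_sign_vectors_orthogonal if_distrib cong: if_cong)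
  finally show ?thesis .
qed

text \<open>
  Complementation exchanges the sets with fewer than half and those with more than half of all elements.
\<close>

lemma card_large_subsets:
  "2 * card {A :: 'n::finite set. CARD('n) \<le> 2 * card A}
     = 2 ^ CARD('n) + (if even CARD('n) then CARD('n) choose (CARD('n) div 2) else 0)"
proof -
  let ?n = "CARD('n)"
  have "bij_betw uminus {A :: 'n set. 2 * card A < ?n} {A. ?n < 2 * card A}"
  proof (rule bij_betwI[where g = uminus])
    have compl: "card A + card (- A) = ?n" for A :: "'n set"
      using card_Un_disjoint[of A "- A"] by simp
    show "uminus \<in> {A :: 'n set. 2 * card A < ?n} \<rightarrow> {A. ?n < 2 * card A}"
    proof (intro Pi_I CollectI)
      fix A :: "'n set" assume "A \<in> {A. 2 * card A < ?n}"
      then show "?n < 2 * card (- A)" using compl[of A] by simp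
    qed
    show "uminus \<in> {A :: 'n set. ?n < 2 * card A} \<rightarrow> {A. 2 * card A < ?n}"
    proof (intro Pi_I CollectI)
      fix A :: "'n set" assume "A \<in> {A. ?n < 2 * card A}"
      then show "2 * card (- A) < ?n" using compl[of A] by simp
    qed
  qed auto
  then have small: "card {A :: 'n set. 2 * card A < ?n} = card {A :: 'n set. ?n < 2 * card A}"
    by (rule bij_betw_same_card)
  have "UNIV = {A :: 'n set. 2 * card A < ?n} \<union> {A. ?n \<le> 2 * card A}" by auto
  then have "card (UNIV :: 'n set set) = card {A :: 'n set. 2 * card A < ?n} + card {A :: 'n set. ?n \<le> 2 * card A}"
    by (metis (no_types, lifting) card_Un_disjoint disjoint_iff finite linorder_not_less mem_Collect_eq)
  then have total: "2 ^ ?n = card {A :: 'n set. 2 * card A < ?n} + card {A :: 'n set. ?n \<le> 2 * card A}"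
    by (simp add: card_UNIV_set)
  have "{A :: 'n set. ?n \<le> 2 * card A} = {A. ?n < 2 * card A} \<union> {A. ?n = 2 * card A}" by auto
  then have split: "card {A :: 'n set. ?n \<le> 2 * card A} = card {A :: 'n set. ?n < 2 * card A} + card {A :: 'n set. ?n = 2 * card A}"
    by (subst card_Un_disjoint[symmetric]) auto
  have "card {A :: 'n set. ?n = 2 * card A} = (if even ?n then ?n choose (?n div 2) else 0)"
  proof (cases "even ?n")
    case True
    then have "{A :: 'n set. ?n = 2 * card A} = {A. A \<subseteq> UNIV \<and> card A = ?n div 2}" by auto
    then show ?thesis using True by (simp only: n_subsets[OF finite] if_True)
  next
    case False
    then have "{A :: 'n set. ?n = 2 * card A} = {}" by (auto intro: dvdI)
    then show ?thesis using False by simp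
  qed
  then show ?thesis using total split small by simp
qed

text \<open>
  Removing \<open>i\<close> from a set lowers its size by one, so the sets that contain \<open>i\<close> correspond to the sets that
  do not, with a threshold lower by one. The two counts differ by one layer of the Boolean lattice on the
  other elements.
\<close>

lemma card_large_subsets_membership:
  fixes i :: "'n::finite"
  shows "card {A. i \<in> A \<and> CARD('n) \<le> 2 * card A}
     = card {A. i \<notin> A \<and> CARD('n) \<le> 2 * card A} + (CARD('n) - 1 choose ((CARD('n) - 1) div 2))"
proof -
  let ?n = "CARD('n)"
  have npos: "?n > 0" by simp
  have "bij_betw (insert i) {B. i \<notin> B \<and> ?n \<le> 2 * (card B + 1)} {A. i \<in> A \<and> ?n \<le> 2 * card A}"
  proof (rule bij_betwI[where g = "\<lambda>A. A - {i}"])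
    show "(\<lambda>A. A - {i}) \<in> {A. i \<in> A \<and> ?n \<le> 2 * card A} \<rightarrow> {B. i \<notin> B \<and> ?n \<le> 2 * (card B + 1)}"
    proof (intro Pi_I CollectI conjI)
      fix A assume A: "A \<in> {A. i \<in> A \<and> ?n \<le> 2 * card A}"
      then have "card A = card (A - {i}) + 1" using card.remove[of A i] by simp
      then show "?n \<le> 2 * (card (A - {i}) + 1)" using A by (simp only: mem_Collect_eq)
    qed auto
  qed auto
  then have "card {A. i \<in> A \<and> ?n \<le> 2 * card A} = card {B. i \<notin> B \<and> ?n \<le> 2 * (card B + 1)}"
    by (rule bij_betw_same_card[symmetric])
  also have "{B. i \<notin> B \<and> ?n \<le> 2 * (card B + 1)}
      = {B. i \<notin> B \<and> ?n \<le> 2 * card B} \<union> {B. B \<subseteq> UNIV - {i} \<and> card B = (?n - 1) div 2}"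
    using npos by (auto simp del: zero_less_card_finite)
  also have "card \<dots> = card {B. i \<notin> B \<and> ?n \<le> 2 * card B} + card {B. B \<subseteq> UNIV - {i} \<and> card B = (?n - 1) div 2}"
    using npos by (intro card_Un_disjoint) (auto simp del: zero_less_card_finite)
  also have "card {B. B \<subseteq> UNIV - {i} \<and> card B = (?n - 1) div 2} = (?n - 1 choose ((?n - 1) div 2))"
    by (subst n_subsets) auto
  finally show ?thesis .
qed

text \<open>
  This is where \<open>rho\<close> comes from: the mean of a coordinate over the half-cube of sign vectors with
  nonnegative sum is the size of that layer divided by the size of the half-cube.
\<close>

lemma sum_component_nonneg_sum_sign_vectors:
  fixes i :: "'n::finite"
  defines "H \<equiv> {e \<in> (sign_vectors :: (real ^ 'n) set). 0 \<le> (\<Sum>j\<in>UNIV. e $ j)}"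
  shows "(\<Sum>e\<in>H. e $ i) = real (card H) * rho CARD('n)"
proof -
  let ?n = "CARD('n)" and ?P = "{A :: 'n set. CARD('n) \<le> 2 * card A}"
  let ?C = "real (?n - 1 choose ((?n - 1) div 2))"
  have sum_sv: "(\<Sum>j\<in>UNIV. sign_vector A $ j) = 2 * real (card A) - real ?n" for A :: "'n set"
  proof -
    have "(\<Sum>j\<in>UNIV. sign_vector A $ j) = (\<Sum>j\<in>A. 1) + (\<Sum>j\<in>- A. - 1 :: real)"
      by (simp add: sign_vector_def sum.If_cases)
    moreover have "real (card (- A)) = real ?n - real (card A)"
      by (simp add: Compl_eq_Diff_UNIV card_Diff_subset of_nat_diff card_mono)
    ultimately show ?thesis by simp
  qed
  have "bij_betw sign_vector ?P H"
  proof (rule bij_betw_subset[OF bij_betw_sign_vector])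
    have "sign_vector A \<in> H \<longleftrightarrow> A \<in> ?P" for A
      using bij_betw_sign_vector[where 'n='n] by (auto simp: H_def sum_sv bij_betw_def)
    moreover have "H \<subseteq> range sign_vector"
      using bij_betw_sign_vector[where 'n='n] by (auto simp: H_def bij_betw_def)
    ultimately show "sign_vector ` ?P = H" by blast
  qed auto
  then have card_H: "card H = card ?P" and
    sum_H: "(\<Sum>e\<in>H. e $ i) = (\<Sum>A\<in>?P. sign_vector A $ i)"
    using bij_betw_same_card sum.reindex_bij_betw[of sign_vector ?P H "\<lambda>e. e $ i"] by metis+
  have "(\<Sum>A\<in>?P. sign_vector A $ i)
      = real (card {A. i \<in> A \<and> ?n \<le> 2 * card A}) - real (card {A. i \<notin> A \<and> ?n \<le> 2 * card A})"
  proof -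
    have "?P \<inter> {A. i \<in> A} = {A. i \<in> A \<and> ?n \<le> 2 * card A}"
      "?P \<inter> - {A. i \<in> A} = {A. i \<notin> A \<and> ?n \<le> 2 * card A}" by auto
    then show ?thesis by (simp add: sign_vector_def sum.If_cases)
  qed
  then have sum_C: "(\<Sum>e\<in>H. e $ i) = ?C"
    unfolding sum_H using card_large_subsets_membership[of i] by simp
  have npos: "?n > 0" by simp
  have "2 * real (card ?P) = real (2 * card ?P)" by simp
  then have two: "2 * real (card ?P) = 2 ^ ?n + (if even ?n then real (?n choose (?n div 2)) else 0)"
    unfolding card_large_subsets by (simp split: if_splits)
  have pow: "(2::real) ^ ?n = 2 * 2 ^ (?n - 1)" using npos by (metis power_eq_if not_less0)
  have "real (card ?P) * rho ?n = ?C"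
  proof (cases "even ?n")
    case True
    have "n - 1 - n div 2 = (n - 1) div 2 \<and> n div 2 \<le> n - 1" if "even n" "n > 0" for n :: nat
      using that by (auto elim!: evenE)
    from this[OF True npos] have half: "?n - 1 - ?n div 2 = (?n - 1) div 2" "?n div 2 \<le> ?n - 1"
      by blast+
    then have "(?n - 1 choose (?n div 2)) = (?n - 1 choose ((?n - 1) div 2))"
      by (subst binomial_symmetric[OF half(2)]) (simp only: half(1))
    moreover have "real (card ?P) = 2 ^ (?n - 1) + real (?n choose (?n div 2)) / 2"
      using two pow True by simp
    moreover have "\<dots> > 0" by (simp add: add_pos_nonneg)
    ultimately show ?thesis using True by (simp add: rho_def)
  next
    case False
    then have "real (card ?P) = 2 ^ (?n - 1)" using two pow by simp
    then show ?thesis using False by (simp add: rho_def)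
  qed
  then show ?thesis using sum_C card_H by simp
qed

lemma descent_signs_finite: "finite (descent_signs u)"
  unfolding descent_signs_def by (rule finite_subset[OF _ finite_sign_vectors]) auto

lemma descent_signs_nonempty:
  fixes u :: "real ^ 'n"
  shows "card (descent_signs u) > 0"
proof -
  obtain v :: "real ^ 'n" where v: "v \<in> sign_vectors" using card_sign_vectors[where 'n='n] by fastforce
  then have "- v \<in> sign_vectors" by (auto simp: sign_vectors_def)
  then have "v \<in> descent_signs u \<or> - v \<in> descent_signs u"
    using v by (auto simp: descent_signs_def)
  then show ?thesis using descent_signs_finite by (auto simp: card_gt_0_iff)
qed

lemma infnorm_scaled_sign_vector:
  fixes w :: "real ^ 'n"
  assumes "w \<in> sign_vectors"
  shows "infnorm (s *\<^sub>R w) = \<bar>s\<bar>"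
proof -
  have "\<bar>w $ i\<bar> = 1" for i using sign_vectors_component[OF assms, of i] by auto
  then have "{\<bar>w $ i\<bar> |i. i \<in> UNIV} = {1}" by auto
  then have "infnorm w = 1" unfolding infnorm_cart by simp
  then show ?thesis by (simp add: infnorm_mul)
qed

text \<open>
  Multiplying coordinatewise by the signs of \<open>u\<close> maps the half-cube facing \<open>u\<close> to the one facing the
  all-ones vector.
\<close>

lemma sum_descent_signs_component:
  fixes w :: "real ^ 'n"
  assumes w: "w \<in> sign_vectors" and s: "s \<noteq> 0"
  defines "u \<equiv> s *\<^sub>R w"
  shows "(\<Sum>d\<in>descent_signs u. d $ i) = real (card (descent_signs u)) * (rho CARD('n) / infnorm u * u $ i)"
proof -
  define e where "e = sgn s *\<^sub>R w"
  have e: "e \<in> sign_vectors" using w s by (auto simp: e_def sign_vectors_def sgn_if)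
  have u: "u = \<bar>s\<bar> *\<^sub>R e" by (simp add: u_def e_def abs_mult_sgn)
  define H where "H = {d \<in> (sign_vectors :: (real ^ 'n) set). 0 \<le> (\<Sum>j\<in>UNIV. d $ j)}"
  define tw where "tw d = (\<chi> j. e $ j * d $ j)" for d :: "real ^ 'n"
  have tw_tw: "tw (tw d) = d" for d
    using sign_vectors_square[OF e] by (simp add: tw_def vec_eq_iff flip: mult.assoc)
  have tw_sign: "tw d \<in> sign_vectors" if "d \<in> sign_vectors" for d
  proof -
    have "e $ j * d $ j \<in> {- 1, 1}" for j
      using sign_vectors_component[OF e, of j] sign_vectors_component[OF that, of j] by auto
    then show ?thesis by (simp add: sign_vectors_def tw_def)
  qed
  have tw_sum: "(\<Sum>j\<in>UNIV. tw d $ j) = d \<bullet> e" for d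
    by (simp add: tw_def inner_vec_def mult.commute)
  have desc: "descent_signs u = {d \<in> sign_vectors. 0 \<le> d \<bullet> e}"
    using s by (auto simp: descent_signs_def u zero_le_mult_iff)
  have bij: "bij_betw tw H (descent_signs u)"
  proof (rule bij_betwI[where g = tw])
    show "tw \<in> H \<rightarrow> descent_signs u"
      using tw_sign tw_sum by (auto simp: H_def desc) (metis tw_tw)
    show "tw \<in> descent_signs u \<rightarrow> H"
      using tw_sign tw_sum by (auto simp: H_def desc)
  qed (auto simp: tw_tw)
  have "(\<Sum>d\<in>descent_signs u. d $ i) = (\<Sum>d\<in>H. tw d $ i)"
    using sum.reindex_bij_betw[OF bij, of "\<lambda>d. d $ i"] by simp
  also have "\<dots> = e $ i * (\<Sum>d\<in>H. d $ i)" by (simp add: tw_def sum_distrib_left)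
  also have "\<dots> = real (card H) * rho CARD('n) * e $ i"
    unfolding H_def sum_component_nonneg_sum_sign_vectors by simp
  also have "card H = card (descent_signs u)" using bij by (rule bij_betw_same_card)
  finally show ?thesis
    using s infnorm_scaled_sign_vector[OF w, of s] by (simp add: u_def e_def sgn_if)
qed

section \<open>Series of orthogonal increments\<close>

text \<open>
  Partial sums of \<open>D\<close>, stopped when they first leave the interval from \<open>- e\<close> to \<open>e\<close>.
\<close>

fun stopped_sum :: "(nat \<Rightarrow> 'a \<Rightarrow> real) \<Rightarrow> real \<Rightarrow> nat \<Rightarrow> 'a \<Rightarrow> real" where
  "stopped_sum D e 0 \<omega> = 0"
| "stopped_sum D e (Suc j) \<omega> =
     stopped_sum D e j \<omega> + (if \<bar>stopped_sum D e j \<omega>\<bar> < e then D j \<omega> else 0)"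

lemma stopped_sum_large:
  assumes "e > 0" "j \<le> N" "e \<le> \<bar>\<Sum>i<j. D i \<omega>\<bar>"
  shows "e \<le> \<bar>stopped_sum D e N \<omega>\<bar>"
proof -
  have "e \<le> \<bar>stopped_sum D e N \<omega>\<bar> \<or>
      (stopped_sum D e N \<omega> = (\<Sum>i<N. D i \<omega>) \<and> (\<forall>j\<le>N. \<bar>\<Sum>i<j. D i \<omega>\<bar> < e))" for N
  proof (induction N)
    case 0
    then show ?case using assms(1) by simp
  next
    case (Suc N)
    then show ?case by (auto simp: le_Suc_eq not_less not_le)
  qed
  then show ?thesis using assms(2,3) by force
qed

context prob_space
begin

text \<open>
  Kolmogorov's inequality, as Chebyshev's inequality for the stopped sums. Stopping serves two purposes:
  the stopped sum remembers an excursion, and up to the stopping time it is bounded by \<open>e\<close>, so that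
  orthogonality of the increments to bounded functions is enough to make their variances add up.
\<close>

lemma orthogonal_increments_maximal_inequality:
  fixes D :: "nat \<Rightarrow> 'a \<Rightarrow> real" and F :: "nat \<Rightarrow> 'a measure"
  assumes sub: "\<And>k. subalgebra M (F k)"
    and mono: "\<And>k. sets (F k) \<subseteq> sets (F (Suc k))"
    and adapted: "\<And>k. D k \<in> borel_measurable (F (Suc k))"
    and sq: "\<And>k. integrable M (\<lambda>\<omega>. (D k \<omega>)\<^sup>2)"
    and orth: "\<And>k Y C. Y \<in> borel_measurable (F k) \<Longrightarrow> (\<And>\<omega>. \<bar>Y \<omega>\<bar> \<le> C) \<Longrightarrow> (\<integral>\<omega>. Y \<omega> * D k \<omega> \<partial>M) = 0"
    and e: "e > 0"
    and bound: "\<And>N. (\<Sum>k<N. \<integral>\<omega>. (D k \<omega>)\<^sup>2 \<partial>M) \<le> V"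
  shows "prob {\<omega> \<in> space M. \<exists>j. e \<le> \<bar>\<Sum>i<j. D i \<omega>\<bar>} \<le> V / e\<^sup>2"
proof -
  let ?T = "stopped_sum D e"
  have spaceF: "space (F k) = space M" for k using sub[of k] by (simp add: subalgebra_def)
  have step_meas: "h \<in> borel_measurable (F (Suc k))" if "h \<in> borel_measurable (F k)" for h :: "'a \<Rightarrow> real" and k
    using that mono[of k] by (auto simp: measurable_def spaceF)
  have T_F: "?T j \<in> borel_measurable (F j)" for j
  proof (induction j)
    case (Suc j)
    note [measurable] = step_meas[OF Suc] adapted[of j]
    show ?case by (simp only: stopped_sum.simps) measurable
  qed simp
  have T_M [measurable]: "?T j \<in> borel_measurable M" for j
    using measurable_from_subalg[OF sub T_F] .
  have D_M [measurable]: "D k \<in> borel_measurable M" for k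
    using measurable_from_subalg[OF sub adapted] .
  have D_int: "integrable M (D k)" for k
    using square_integrable_imp_integrable[OF D_M sq] .
  have T: "integrable M (\<lambda>\<omega>. (?T j \<omega>)\<^sup>2) \<and> (\<integral>\<omega>. (?T j \<omega>)\<^sup>2 \<partial>M) \<le> (\<Sum>k<j. \<integral>\<omega>. (D k \<omega>)\<^sup>2 \<partial>M)" for j
  proof (induction j)
    case (Suc j)
    define Y where "Y \<omega> = (if \<bar>?T j \<omega>\<bar> < e then 2 * ?T j \<omega> else 0)" for \<omega>
    define Z where "Z \<omega> = (if \<bar>?T j \<omega>\<bar> < e then 1 else 0) * (D j \<omega>)\<^sup>2" for \<omega>
    have Y_F: "Y \<in> borel_measurable (F j)" using T_F[of j] unfolding Y_def by measurable
    then have [measurable]: "Y \<in> borel_measurable M" by (rule measurable_from_subalg[OF sub])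
    have [measurable]: "Z \<in> borel_measurable M" unfolding Z_def by measurable
    have Y_bd: "\<bar>Y \<omega>\<bar> \<le> 2 * e" for \<omega> using e by (simp add: Y_def abs_mult)
    have eq: "(?T (Suc j) \<omega>)\<^sup>2 = (?T j \<omega>)\<^sup>2 + Y \<omega> * D j \<omega> + Z \<omega>" for \<omega>
      by (simp add: Y_def Z_def power2_sum)
    have YD: "integrable M (\<lambda>\<omega>. Y \<omega> * D j \<omega>)"
    proof (rule Bochner_Integration.integrable_bound[of _ "\<lambda>\<omega>. 2 * e * D j \<omega>"])
      show "AE \<omega> in M. norm (Y \<omega> * D j \<omega>) \<le> norm (2 * e * D j \<omega>)"
        using Y_bd e by (auto simp: abs_mult intro!: mult_right_mono)
    qed (use D_int in auto)
    have ZI: "integrable M Z"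
      by (rule Bochner_Integration.integrable_bound[OF sq[of j]]) (auto simp: Z_def)
    have "(\<integral>\<omega>. Z \<omega> \<partial>M) \<le> (\<integral>\<omega>. (D j \<omega>)\<^sup>2 \<partial>M)"
      by (rule integral_mono[OF ZI sq]) (auto simp: Z_def)
    moreover have "(\<integral>\<omega>. (?T (Suc j) \<omega>)\<^sup>2 \<partial>M) = (\<integral>\<omega>. (?T j \<omega>)\<^sup>2 \<partial>M) + (\<integral>\<omega>. Y \<omega> * D j \<omega> \<partial>M) + (\<integral>\<omega>. Z \<omega> \<partial>M)"
      unfolding eq using Suc YD ZI by simp
    moreover have "integrable M (\<lambda>\<omega>. (?T (Suc j) \<omega>)\<^sup>2)"
      unfolding eq using Suc YD ZI by simp
    ultimately show ?case using Suc orth[OF Y_F Y_bd] by simp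
  qed simp
  let ?A = "\<lambda>N. {\<omega> \<in> space M. \<exists>j\<le>N. e \<le> \<bar>\<Sum>i<j. D i \<omega>\<bar>}"
  have A_bound: "prob (?A N) \<le> V / e\<^sup>2" for N
  proof -
    have "prob (?A N) \<le> prob {\<omega> \<in> space M. e \<le> \<bar>?T N \<omega>\<bar>}"
      using stopped_sum_large[OF e] by (intro finite_measure_mono) auto
    also have "\<dots> \<le> (\<integral>\<omega>. (?T N \<omega>)\<^sup>2 \<partial>M) / e\<^sup>2"
      using T[of N] e by (intro second_moment_method) auto
    also have "\<dots> \<le> V / e\<^sup>2"
      using T[of N] bound[of N] e by (intro divide_right_mono) auto
    finally show ?thesis .
  qed
  have "(\<lambda>N. prob (?A N)) \<longlonglongrightarrow> prob (\<Union>N. ?A N)"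
    by (rule finite_Lim_measure_incseq) (auto simp: incseq_def intro: order_trans)
  moreover have "(\<Union>N. ?A N) = {\<omega> \<in> space M. \<exists>j. e \<le> \<bar>\<Sum>i<j. D i \<omega>\<bar>}" by auto
  ultimately show ?thesis using A_bound by (auto intro!: LIMSEQ_le_const2)
qed

text \<open>
  By the maximal inequality the oscillation of the partial sums after index \<open>m\<close> exceeds a given level only
  with a probability that tends to zero with the tail of the series of second moments, so almost every
  sequence of partial sums is Cauchy.
\<close>

theorem orthogonal_increments_summable:
  fixes D :: "nat \<Rightarrow> 'a \<Rightarrow> real" and F :: "nat \<Rightarrow> 'a measure"
  assumes sub: "\<And>k. subalgebra M (F k)"
    and mono: "\<And>k. sets (F k) \<subseteq> sets (F (Suc k))"
    and adapted: "\<And>k. D k \<in> borel_measurable (F (Suc k))"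
    and sq: "\<And>k. integrable M (\<lambda>\<omega>. (D k \<omega>)\<^sup>2)"
    and orth: "\<And>k Y C. Y \<in> borel_measurable (F k) \<Longrightarrow> (\<And>\<omega>. \<bar>Y \<omega>\<bar> \<le> C) \<Longrightarrow> (\<integral>\<omega>. Y \<omega> * D k \<omega> \<partial>M) = 0"
    and summ: "summable (\<lambda>k. \<integral>\<omega>. (D k \<omega>)\<^sup>2 \<partial>M)"
  shows "AE \<omega> in M. summable (\<lambda>k. D k \<omega>)"
proof -
  define v where "v k = (\<integral>\<omega>. (D k \<omega>)\<^sup>2 \<partial>M)" for k
  have v: "v k \<ge> 0" "summable v" for k using summ by (simp_all add: v_def[abs_def])
  have D_M [measurable]: "D k \<in> borel_measurable M" for k
    using measurable_from_subalg[OF sub adapted] .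
  define B where "B e m = {\<omega> \<in> space M. \<exists>j. e \<le> \<bar>\<Sum>i<j. D (i + m) \<omega>\<bar>}" for e m
  have B_sets [measurable]: "B e m \<in> sets M" for e m unfolding B_def by measurable
  have tail: "prob (B e m) \<le> (\<Sum>k. v (k + m)) / e\<^sup>2" if "e > 0" for e m
    unfolding B_def
  proof (rule orthogonal_increments_maximal_inequality[where F="\<lambda>k. F (k + m)"])
    show "(\<Sum>k<N. \<integral>\<omega>. (D (k + m) \<omega>)\<^sup>2 \<partial>M) \<le> (\<Sum>k. v (k + m))" for N
      unfolding v_def[symmetric] using v by (intro sum_le_suminf summable_ignore_initial_segment) auto
    show "sets (F (k + m)) \<subseteq> sets (F (Suc k + m))" "D (k + m) \<in> borel_measurable (F (Suc k + m))" for k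
      using mono[of "k + m"] adapted[of "k + m"] by auto
    show "(\<integral>\<omega>. Y \<omega> * D (k + m) \<omega> \<partial>M) = 0"
      if "Y \<in> borel_measurable (F (k + m))" "\<And>\<omega>. \<bar>Y \<omega>\<bar> \<le> C" for Y k C
      using orth[OF that] .
  qed (use sub sq that in auto)
  have small: "AE \<omega> in M. \<exists>m. \<omega> \<notin> B e m" if e: "e > 0" for e
  proof -
    have lim: "(\<lambda>m. (\<Sum>k. v (k + m)) / e\<^sup>2) \<longlonglongrightarrow> 0"
      using tendsto_divide[OF suminf_exist_split2[OF v(2)] tendsto_const[of "e\<^sup>2"]] e by simp
    have "prob (\<Inter>m. B e m) \<le> (\<Sum>k. v (k + m)) / e\<^sup>2" for m
      using tail[OF e, of m] finite_measure_mono[of "\<Inter>m. B e m" "B e m"] by fastforce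
    then have "prob (\<Inter>m. B e m) \<le> 0" using lim by (intro LIMSEQ_le_const) auto
    then have "prob (\<Inter>m. B e m) = 0" by (simp add: measure_le_0_iff)
    then have "AE \<omega> in M. \<omega> \<notin> (\<Inter>m. B e m)"
      by (intro AE_not_in) (auto simp: null_sets_def emeasure_eq_measure)
    then show ?thesis by eventually_elim auto
  qed
  then have "AE \<omega> in M. \<forall>n. \<exists>m. \<omega> \<notin> B (inverse (real (Suc n))) m"
    by (intro AE_all_countable[THEN iffD2] allI) auto
  then show ?thesis
    using AE_space
  proof eventually_elim
    case (elim \<omega>)
    show "summable (\<lambda>k. D k \<omega>)"
      unfolding summable_Cauchy
    proof (intro allI impI)
      fix e :: real assume "e > 0"
      then obtain n where n: "inverse (real (Suc n)) < e / 2"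
        using reals_Archimedean[of "e / 2"] by auto
      obtain m where m: "\<omega> \<notin> B (inverse (real (Suc n))) m" using elim(1) by blast
      have small: "\<bar>\<Sum>i<j. D (i + m) \<omega>\<bar> < e / 2" for j
      proof -
        have "\<not> inverse (real (Suc n)) \<le> \<bar>\<Sum>i<j. D (i + m) \<omega>\<bar>"
          using m elim(2) unfolding B_def by blast
        then show ?thesis using n by linarith
      qed
      have "norm (sum (\<lambda>k. D k \<omega>) {p..<q}) < e" if "p \<ge> m" for p q
      proof (cases "p \<le> q")
        case True
        have shift: "(\<Sum>i<j. D (i + m) \<omega>) = sum (\<lambda>k. D k \<omega>) {m..<m + j}" for j
          using sum.shift_bounds_nat_ivl[of "\<lambda>k. D k \<omega>" 0 m j] by (simp add: atLeast0LessThan add.commute)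
        have "sum (\<lambda>k. D k \<omega>) {m..<q} = sum (\<lambda>k. D k \<omega>) {m..<p} + sum (\<lambda>k. D k \<omega>) {p..<q}"
          using that True by (simp add: sum.atLeastLessThan_concat)
        moreover have "\<bar>sum (\<lambda>k. D k \<omega>) {m..<q}\<bar> < e / 2" "\<bar>sum (\<lambda>k. D k \<omega>) {m..<p}\<bar> < e / 2"
          using small[of "q - m"] small[of "p - m"] that True unfolding shift by simp_all
        ultimately show ?thesis unfolding real_norm_def by linarith
      qed (use \<open>e > 0\<close> in simp)
      then show "\<exists>N. \<forall>m\<ge>N. \<forall>n. norm (sum (\<lambda>k. D k \<omega>) {m..<n}) < e" by blast
    qed
  qed
qed

end

section \<open>The information available to the algorithm\<close>

lemma measurable_sigma_preimages:
  assumes "preimages M X \<subseteq> P" "P \<subseteq> Pow (space M)"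
  shows "X \<in> borel_measurable (sigma (space M) P)"
  using assms by (intro measurableI) (auto simp: preimages_def)

lemma preimages_sets:
  assumes "X \<in> borel_measurable M"
  shows "preimages M X \<subseteq> sets M"
  using assms unfolding preimages_def by (auto intro: measurable_sets)

lemma subalgebra_sigma:
  assumes "P \<subseteq> sets M"
  shows "subalgebra M (sigma (space M) P)"
proof -
  have "P \<subseteq> Pow (space M)" using assms sets.space_closed by blast
  then show ?thesis using assms sets.sigma_sets_subset[of P M] by (auto simp: subalgebra_def)
qed

lemma borel_measurable_vec_iff:
  fixes X :: "'w \<Rightarrow> real ^ 'n"
  shows "X \<in> borel_measurable N \<longleftrightarrow> (\<forall>i. (\<lambda>\<omega>. X \<omega> $ i) \<in> borel_measurable N)"
proof -
  have "(\<forall>b\<in>(Basis :: (real ^ 'n) set). (\<lambda>\<omega>. X \<omega> \<bullet> b) \<in> borel_measurable N)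
      \<longleftrightarrow> (\<forall>i. (\<lambda>\<omega>. X \<omega> $ i) \<in> borel_measurable N)"
    by (auto simp: Basis_vec_def inner_axis)
  then show ?thesis by (simp add: borel_measurable_euclidean_space[of X N])
qed

lemma borel_measurable_vec_nth [measurable (raw)]:
  fixes X :: "'w \<Rightarrow> real ^ 'n"
  shows "X \<in> borel_measurable N \<Longrightarrow> (\<lambda>\<omega>. X \<omega> $ i) \<in> borel_measurable N"
  by (simp add: borel_measurable_vec_iff)

lemma borel_measurable_infnorm [measurable (raw)]:
  fixes X :: "'w \<Rightarrow> real ^ 'n"
  assumes "X \<in> borel_measurable N"
  shows "(\<lambda>\<omega>. infnorm (X \<omega>)) \<in> borel_measurable N"
  by (rule borel_measurable_continuous_on[OF _ assms]) (intro continuous_intros)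

lemma borel_measurable_grad_est:
  assumes [measurable]: "f \<in> borel_measurable borel" "X \<in> borel_measurable N" "V \<in> borel_measurable N"
    "P \<in> borel_measurable N" "Q \<in> borel_measurable N"
  shows "(\<lambda>\<omega>. grad_est f c (X \<omega>) (V \<omega>) (P \<omega>) (Q \<omega>)) \<in> borel_measurable N"
  unfolding borel_measurable_vec_iff grad_est_def by simp

locale SPSA1_A_run = SPSA1_A M f a c x xi xihat ep em ghat
  for M :: "'w measure" and f :: "real ^ 'n \<Rightarrow> real" and a c x xi xihat ep em ghat +
  assumes f_measurable [measurable]: "f \<in> borel_measurable borel"
begin

declare xi_measurable [measurable] ep_measurable [measurable] em_measurable [measurable]
  xihat_measurable [measurable]

text \<open>
  Stated for an arbitrary \<open>\<sigma>\<close>-algebra because it is needed both for \<open>M\<close> and for the history.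
\<close>

lemma iterate_measurable_wrt_generators:
  assumes space: "space N = space M" and x0: "x 0 \<in> borel_measurable N"
    and gen: "\<And>j. j < k \<Longrightarrow> xi j \<in> borel_measurable N" "\<And>j. j < k \<Longrightarrow> ep j \<in> borel_measurable N"
      "\<And>j. j < k \<Longrightarrow> em j \<in> borel_measurable N" "\<And>j. j < k \<Longrightarrow> xihat j \<in> borel_measurable N"
  shows "x k \<in> borel_measurable N"
  using gen
proof (induction k)
  case 0
  then show ?case using x0 by simp
next
  case (Suc k)
  note [measurable] = f_measurable
  have [measurable]: "x k \<in> borel_measurable N" using Suc by simp
  have [measurable]: "xihat k \<in> borel_measurable N" using Suc.prems by simp
  have [measurable]: "ghat k \<in> borel_measurable N"
    unfolding ghat_def using Suc.prems by (intro borel_measurable_grad_est) auto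
  have "(\<lambda>\<omega>. x k \<omega> - (a k / (1 + rho CARD('n) / infnorm (ghat k \<omega>))) *\<^sub>R (ghat k \<omega> + xihat k \<omega>))
      \<in> borel_measurable N" by measurable
  then show ?case using step space by (subst measurable_cong) auto
qed

lemma x_measurable [measurable]: "x k \<in> borel_measurable M"
  by (rule iterate_measurable_wrt_generators) (auto simp: x0_measurable)

lemma ghat_measurable_wrt:
  assumes "x k \<in> borel_measurable N" "xi k \<in> borel_measurable N" "ep k \<in> borel_measurable N"
    "em k \<in> borel_measurable N"
  shows "ghat k \<in> borel_measurable N"
  unfolding ghat_def using assms f_measurable by (intro borel_measurable_grad_est) auto

lemma ghat_measurable [measurable]: "ghat k \<in> borel_measurable M"
  by (rule ghat_measurable_wrt) auto

definition iterates_algebra :: "nat \<Rightarrow> 'w measure" where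
  "iterates_algebra k = sigma (space M) (\<Union>j\<le>k. preimages M (x j))"

abbreviation direction_algebra :: "nat \<Rightarrow> 'w measure" where
  "direction_algebra k \<equiv> sigma_iterates_direction M x xi k"

abbreviation history_algebra :: "nat \<Rightarrow> 'w measure" where
  "history_algebra k \<equiv> sigma_history M (x 0) xi xihat ep em k"

lemma space_algebras [simp]:
  "space (iterates_algebra k) = space M" "space (direction_algebra k) = space M"
  "space (history_algebra k) = space M"
  by (auto simp: iterates_algebra_def sigma_iterates_direction_def sigma_history_def space_measure_of_conv)

lemma subalgebra_iterates: "subalgebra M (iterates_algebra k)"
  unfolding iterates_algebra_def by (rule subalgebra_sigma) (auto dest: subsetD[OF preimages_sets[OF x_measurable]])

lemma subalgebra_direction: "subalgebra M (direction_algebra k)"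
  unfolding sigma_iterates_direction_def
  by (rule subalgebra_sigma)
    (auto dest: subsetD[OF preimages_sets[OF x_measurable]] subsetD[OF preimages_sets[OF xi_measurable]])

lemma subalgebra_history: "subalgebra M (history_algebra k)"
  unfolding sigma_history_def
  by (rule subalgebra_sigma)
    (auto dest: subsetD[OF preimages_sets[OF x_measurable]] subsetD[OF preimages_sets[OF xi_measurable]]
      subsetD[OF preimages_sets[OF ep_measurable]] subsetD[OF preimages_sets[OF em_measurable]]
      subsetD[OF preimages_sets[OF xihat_measurable]])

lemma preimages_Pow: "preimages M X \<subseteq> Pow (space M)"
  by (auto simp: preimages_def)

lemma x_measurable_iterates: "j \<le> k \<Longrightarrow> x j \<in> borel_measurable (iterates_algebra k)"
  unfolding iterates_algebra_def
  by (rule measurable_sigma_preimages) (use preimages_Pow in blast)+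

lemma measurable_wrt_larger:
  assumes "h \<in> borel_measurable A" "sets A \<subseteq> sets B" "space A = space B"
  shows "h \<in> borel_measurable B"
  using assms by (auto simp: measurable_def)

lemma iterates_algebra_least:
  assumes N: "space N = space M" and X: "\<And>j. j \<le> k \<Longrightarrow> x j \<in> borel_measurable N"
  shows "sets (iterates_algebra k) \<subseteq> sets N"
proof -
  have "preimages M (x j) \<subseteq> sets N" if "j \<le> k" for j
    using X[OF that] N unfolding preimages_def by (auto dest!: measurable_sets)
  then have sub: "(\<Union>j\<le>k. preimages M (x j)) \<subseteq> sets N" by blast
  then have "sigma_sets (space N) (\<Union>j\<le>k. preimages M (x j)) \<subseteq> sets N"
    by (rule sets.sigma_sets_subset)
  then show ?thesis
    unfolding iterates_algebra_def using preimages_Pow N by (subst sets_measure_of) auto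
qed

lemma iterates_algebra_mono: "sets (iterates_algebra k) \<subseteq> sets (iterates_algebra (Suc k))"
  by (rule iterates_algebra_least) (simp_all add: x_measurable_iterates)

lemma direction_algebra_measurable:
  "j \<le> k \<Longrightarrow> x j \<in> borel_measurable (direction_algebra k)"
  "xi k \<in> borel_measurable (direction_algebra k)"
  unfolding sigma_iterates_direction_def
  by (rule measurable_sigma_preimages; use preimages_Pow in blast)+

lemma iterates_measurable_imp_direction:
  assumes "h \<in> borel_measurable (iterates_algebra k)"
  shows "h \<in> borel_measurable (direction_algebra k)"
proof (rule measurable_wrt_larger[OF assms])
  show "sets (iterates_algebra k) \<subseteq> sets (direction_algebra k)"
    by (rule iterates_algebra_least) (simp_all add: direction_algebra_measurable)
qed simp

lemma history_algebra_measurable: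
  "x 0 \<in> borel_measurable (history_algebra k)"
  "j \<le> k \<Longrightarrow> xi j \<in> borel_measurable (history_algebra k)"
  "j \<le> k \<Longrightarrow> ep j \<in> borel_measurable (history_algebra k)"
  "j \<le> k \<Longrightarrow> em j \<in> borel_measurable (history_algebra k)"
  "j < k \<Longrightarrow> xihat j \<in> borel_measurable (history_algebra k)"
  unfolding sigma_history_def
  by (rule measurable_sigma_preimages; (blast | auto simp: preimages_def))+

lemma x_measurable_history: "j \<le> k \<Longrightarrow> x j \<in> borel_measurable (history_algebra k)"
  by (rule iterate_measurable_wrt_generators)
    (simp_all add: history_algebra_measurable)

lemma ghat_measurable_history: "ghat k \<in> borel_measurable (history_algebra k)"
  by (rule ghat_measurable_wrt) (auto simp: x_measurable_history history_algebra_measurable)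

lemma iterates_measurable_imp_history:
  assumes "h \<in> borel_measurable (iterates_algebra k)"
  shows "h \<in> borel_measurable (history_algebra k)"
proof (rule measurable_wrt_larger[OF assms])
  show "sets (iterates_algebra k) \<subseteq> sets (history_algebra k)"
    by (rule iterates_algebra_least) (simp_all add: x_measurable_history)
qed simp

lemma xi_sign: "AE \<omega> in M. xi k \<omega> \<in> sign_vectors"
proof -
  have "prob (\<Union>v\<in>sign_vectors. {\<omega> \<in> space M. xi k \<omega> = v}) = (\<Sum>v\<in>sign_vectors. prob {\<omega> \<in> space M. xi k \<omega> = v})"
    by (rule finite_measure_finite_Union) (auto simp: finite_sign_vectors disjoint_family_on_def)
  also have "\<dots> = 1" using card_sign_vectors[where 'n='n] by (simp add: xi_uniform)
  also have "(\<Union>v\<in>sign_vectors. {\<omega> \<in> space M. xi k \<omega> = v}) = {\<omega> \<in> space M. xi k \<omega> \<in> sign_vectors}" by auto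
  finally have "prob {\<omega> \<in> space M. xi k \<omega> \<in> sign_vectors} = 1" .
  then show ?thesis by (rule AE_prob_1[THEN AE_mp]) auto
qed

text \<open>
  Independence of random variables requires a common codomain, so the direction enters through a function
  \<open>h\<close> of it; below this is the indicator of a single sign vector.
\<close>

lemma xi_indep_iterates:
  fixes Z :: "'w \<Rightarrow> 'c::topological_space"
  assumes Z: "Z \<in> borel_measurable (iterates_algebra k)" and h: "h \<in> borel_measurable borel"
  shows "indep_var borel (\<lambda>\<omega>. h (xi k \<omega>)) borel Z"
  unfolding indep_var_eq
proof (intro conjI)
  show Z_M: "random_variable borel Z" using measurable_from_subalg[OF subalgebra_iterates Z] .
  show h_M: "random_variable borel (\<lambda>\<omega>. h (xi k \<omega>))" using h by measurable
  have sig: "sigma_sets (space M) {X -` A \<inter> space M |A. A \<in> sets borel} = {X -` A \<inter> space M |A. A \<in> sets borel}"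
    for X :: "'w \<Rightarrow> 'c"
    using sets_vimage_algebra[of "space M" X borel] sets.sigma_sets_eq[of "vimage_algebra (space M) X borel"]
    by (simp add: sets_vimage_algebra2)
  have "{Z -` A \<inter> space M |A. A \<in> sets borel} \<subseteq> sets (iterates_algebra k)"
    using measurable_sets[OF Z] by auto
  also have "sets (iterates_algebra k) = sigma_sets (space M) (\<Union>j\<le>k. preimages M (x j))"
    unfolding iterates_algebra_def by (intro sets_measure_of) (use preimages_Pow in blast)
  finally have Z_sub: "{Z -` A \<inter> space M |A. A \<in> sets borel} \<subseteq> sigma_sets (space M) (\<Union>j\<le>k. preimages M (x j))" .
  have h_sub: "{(\<lambda>\<omega>. h (xi k \<omega>)) -` A \<inter> space M |A. A \<in> sets borel} \<subseteq> preimages M (xi k)"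
  proof clarify
    fix A :: "'c set" assume "A \<in> sets borel"
    then have "h -` A \<in> sets borel" using measurable_sets[OF h] by simp
    then show "(\<lambda>\<omega>. h (xi k \<omega>)) -` A \<inter> space M \<in> preimages M (xi k)"
      unfolding preimages_def by blast
  qed
  show "indep_set (sigma_sets (space M) {(\<lambda>\<omega>. h (xi k \<omega>)) -` A \<inter> space M |A. A \<in> sets borel})
     (sigma_sets (space M) {Z -` A \<inter> space M |A. A \<in> sets borel})"
    unfolding sig
  proof (rule indep_setI)
    show "{(\<lambda>\<omega>. h (xi k \<omega>)) -` A \<inter> space M |A. A \<in> sets borel} \<subseteq> events"
      "{Z -` A \<inter> space M |A. A \<in> sets borel} \<subseteq> events"
      using measurable_sets[OF h_M] measurable_sets[OF Z_M] by auto
    show "prob (A \<inter> B) = prob A * prob B"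
      if "A \<in> {(\<lambda>\<omega>. h (xi k \<omega>)) -` A \<inter> space M |A. A \<in> sets borel}"
        "B \<in> {Z -` A \<inter> space M |A. A \<in> sets borel}" for A B
      using indep_setD[OF xi_indep] subsetD[OF h_sub that(1)] subsetD[OF Z_sub that(2)] by blast
  qed
qed

end

section \<open>Mean and variance of one step\<close>

lemma (in prob_space) indep_var_nn_integral_mult:
  fixes X Y :: "'a \<Rightarrow> ennreal"
  assumes "indep_var borel X borel Y"
  shows "(\<integral>\<^sup>+\<omega>. X \<omega> * Y \<omega> \<partial>M) = (\<integral>\<^sup>+\<omega>. X \<omega> \<partial>M) * (\<integral>\<^sup>+\<omega>. Y \<omega> \<partial>M)"
proof -
  have "case_bool borel borel = (\<lambda>_. borel :: ennreal measure)" by (auto split: bool.splits)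
  then have "indep_vars (\<lambda>_. borel) (case_bool X Y) UNIV" using assms by (simp add: indep_var_def)
  from indep_vars_nn_integral[OF _ this] show ?thesis by (simp add: UNIV_bool mult.commute)
qed

lemma square_integrable_of_nn_integral_le:
  assumes X: "X \<in> borel_measurable M" and "(\<integral>\<^sup>+\<omega>. ennreal ((X \<omega>)\<^sup>2) \<partial>M) \<le> ennreal \<alpha>" "\<alpha> \<ge> 0"
  shows "integrable M (\<lambda>\<omega>. (X \<omega>)\<^sup>2)" "(\<integral>\<omega>. (X \<omega>)\<^sup>2 \<partial>M) \<le> \<alpha>"
proof -
  show int: "integrable M (\<lambda>\<omega>. (X \<omega>)\<^sup>2)"
    using assms by (intro integrableI_nonneg) (auto intro: le_less_trans)
  have "ennreal (\<integral>\<omega>. (X \<omega>)\<^sup>2 \<partial>M) \<le> ennreal \<alpha>"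
    using assms(2) nn_integral_eq_integral[OF int] by simp
  then show "(\<integral>\<omega>. (X \<omega>)\<^sup>2 \<partial>M) \<le> \<alpha>" using assms(3) by (simp add: ennreal_le_iff)
qed

text \<open>
  The conditional mean of the gradient estimate at \<open>y\<close>. A sign vector is its own componentwise inverse, so
  no inverse appears.
\<close>

definition central_difference_mean :: "(real ^ 'n \<Rightarrow> real) \<Rightarrow> real \<Rightarrow> real ^ 'n \<Rightarrow> real ^ 'n" where
  "central_difference_mean f h y = (\<chi> i. (\<Sum>v\<in>sign_vectors.
     (f (y + h *\<^sub>R v) - f (y - h *\<^sub>R v)) / (2 * h) * v $ i) / 2 ^ CARD('n))"

lemma sum_of_four_squared:
  "((p + q - r - s)::real)\<^sup>2 \<le> 4 * (p\<^sup>2 + q\<^sup>2 + r\<^sup>2 + s\<^sup>2)"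
proof -
  have "0 \<le> (p - q)\<^sup>2 + (p + r)\<^sup>2 + (p + s)\<^sup>2 + (q + r)\<^sup>2 + (q + s)\<^sup>2 + (r - s)\<^sup>2" by simp
  then show ?thesis by (simp add: power2_eq_square algebra_simps)
qed

lemma sum_of_two_squared: "((p + q)::real)\<^sup>2 \<le> 2 * p\<^sup>2 + 2 * q\<^sup>2"
proof -
  have "0 \<le> (p - q)\<^sup>2" by simp
  then show ?thesis by (simp add: power2_eq_square algebra_simps)
qed

locale SPSA1_A_moments = SPSA1_A_run M f a c x xi xihat ep em ghat
  for M :: "'w measure" and f :: "real ^ 'n \<Rightarrow> real" and a c x xi xihat ep em ghat +
  fixes \<alpha>0 \<alpha>1 :: real
  assumes a_pos: "\<And>k. a k > 0" and c_pos: "\<And>k. c k > 0"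
    and noise: "\<And>k. AE \<omega> in M.
      real_cond_exp M (sigma_iterates_direction M x xi k) (\<lambda>\<omega>. ep k \<omega> - em k \<omega>) \<omega> = 0"
    and \<alpha>_nonneg: "\<alpha>0 \<ge> 0" "\<alpha>1 \<ge> 0"
    and ep_moment: "\<And>k. (\<integral>\<^sup>+\<omega>. ennreal ((ep k \<omega>)\<^sup>2) \<partial>M) \<le> ennreal \<alpha>0"
    and em_moment: "\<And>k. (\<integral>\<^sup>+\<omega>. ennreal ((em k \<omega>)\<^sup>2) \<partial>M) \<le> ennreal \<alpha>0"
    and fp_moment: "\<And>k. (\<integral>\<^sup>+\<omega>. ennreal ((f (x k \<omega> + c k *\<^sub>R xi k \<omega>))\<^sup>2) \<partial>M) \<le> ennreal \<alpha>1"
    and fm_moment: "\<And>k. (\<integral>\<^sup>+\<omega>. ennreal ((f (x k \<omega> - c k *\<^sub>R xi k \<omega>))\<^sup>2) \<partial>M) \<le> ennreal \<alpha>1"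
begin

abbreviation fp where "fp k \<omega> \<equiv> f (x k \<omega> + c k *\<^sub>R xi k \<omega>)"
abbreviation fm where "fm k \<omega> \<equiv> f (x k \<omega> - c k *\<^sub>R xi k \<omega>)"

lemma fp_fm_measurable [measurable]: "fp k \<in> borel_measurable M" "fm k \<in> borel_measurable M"
  by measurable

lemmas ep_sq = square_integrable_of_nn_integral_le[OF ep_measurable ep_moment \<alpha>_nonneg(1)]
  and em_sq = square_integrable_of_nn_integral_le[OF em_measurable em_moment \<alpha>_nonneg(1)]
  and fp_sq = square_integrable_of_nn_integral_le[OF fp_fm_measurable(1) fp_moment \<alpha>_nonneg(2)]
  and fm_sq = square_integrable_of_nn_integral_le[OF fp_fm_measurable(2) fm_moment \<alpha>_nonneg(2)]

lemma frozen_measurable_iterates: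
  "(\<lambda>\<omega>. f (x k \<omega> + s *\<^sub>R v)) \<in> borel_measurable (iterates_algebra k)"
  using x_measurable_iterates[of k k] by measurable

lemma prob_xi: "v \<in> sign_vectors \<Longrightarrow> prob {\<omega> \<in> space M. xi k \<omega> = v} = 1 / 2 ^ CARD('n)"
  by (simp add: xi_uniform card_sign_vectors)

text \<open>
  The moment assumption concerns the random direction. Every fixed direction is drawn with probability
  \<open>2\<^sup>-\<^sup>n\<close> independently of the iterates, so its moment is larger by a factor of at most \<open>2\<^sup>n\<close>.
\<close>

lemma frozen_sq:
  assumes v: "v \<in> sign_vectors"
  shows "integrable M (\<lambda>\<omega>. (f (x k \<omega> + c k *\<^sub>R v))\<^sup>2)"
    and "(\<integral>\<omega>. (f (x k \<omega> + c k *\<^sub>R v))\<^sup>2 \<partial>M) \<le> 2 ^ CARD('n) * \<alpha>1"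
proof -
  let ?N = "2 ^ CARD('n) :: real"
  let ?J = "\<integral>\<^sup>+\<omega>. ennreal ((f (x k \<omega> + c k *\<^sub>R v))\<^sup>2) \<partial>M"
  have "indep_var borel (\<lambda>\<omega>. indicator {v} (xi k \<omega>) :: ennreal) borel (\<lambda>\<omega>. ennreal ((f (x k \<omega> + c k *\<^sub>R v))\<^sup>2))"
    by (rule xi_indep_iterates) (use frozen_measurable_iterates[of k "c k" v] in measurable)
  then have "(\<integral>\<^sup>+\<omega>. indicator {v} (xi k \<omega>) * ennreal ((f (x k \<omega> + c k *\<^sub>R v))\<^sup>2) \<partial>M)
      = (\<integral>\<^sup>+\<omega>. indicator {v} (xi k \<omega>) \<partial>M) * ?J"
    by (rule indep_var_nn_integral_mult)
  also have "(\<integral>\<^sup>+\<omega>. indicator {v} (xi k \<omega>) \<partial>M) = (\<integral>\<^sup>+\<omega>. indicator {\<omega> \<in> space M. xi k \<omega> = v} \<omega> \<partial>M)"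
    by (intro nn_integral_cong) (auto simp: indicator_def)
  also have "\<dots> = ennreal (1 / ?N)"
    using prob_xi[OF v, of k] by (simp add: emeasure_eq_measure)
  finally have "ennreal (1 / ?N) * ?J = (\<integral>\<^sup>+\<omega>. indicator {v} (xi k \<omega>) * ennreal ((f (x k \<omega> + c k *\<^sub>R v))\<^sup>2) \<partial>M)"
    by simp
  also have "\<dots> \<le> (\<integral>\<^sup>+\<omega>. ennreal ((fp k \<omega>)\<^sup>2) \<partial>M)"
    by (intro nn_integral_mono) (auto simp: indicator_def)
  also have "\<dots> \<le> ennreal \<alpha>1" by (rule fp_moment)
  finally have "ennreal ?N * (ennreal (1 / ?N) * ?J) \<le> ennreal ?N * ennreal \<alpha>1"
    by (rule mult_left_mono) simp
  moreover have "ennreal ?N * (ennreal (1 / ?N) * ?J) = ?J"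
    by (simp add: mult.assoc[symmetric] ennreal_mult[symmetric])
  ultimately have J: "?J \<le> ennreal (?N * \<alpha>1)" using \<alpha>_nonneg by (simp add: ennreal_mult)
  have meas: "(\<lambda>\<omega>. f (x k \<omega> + c k *\<^sub>R v)) \<in> borel_measurable M" by measurable
  show "integrable M (\<lambda>\<omega>. (f (x k \<omega> + c k *\<^sub>R v))\<^sup>2)"
    "(\<integral>\<omega>. (f (x k \<omega> + c k *\<^sub>R v))\<^sup>2 \<partial>M) \<le> ?N * \<alpha>1"
    using square_integrable_of_nn_integral_le[OF meas J] \<alpha>_nonneg by simp_all
qed

lemma uminus_sign_vectors: "v \<in> sign_vectors \<Longrightarrow> - v \<in> sign_vectors"
  by (auto simp: sign_vectors_def)

lemma frozen_integrable:
  assumes v: "v \<in> sign_vectors"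
  shows "integrable M (\<lambda>\<omega>. f (x k \<omega> + c k *\<^sub>R v))" "integrable M (\<lambda>\<omega>. f (x k \<omega> - c k *\<^sub>R v))"
proof -
  show "integrable M (\<lambda>\<omega>. f (x k \<omega> + c k *\<^sub>R v))"
    by (rule square_integrable_imp_integrable[OF _ frozen_sq(1)[OF v]]) measurable
  show "integrable M (\<lambda>\<omega>. f (x k \<omega> - c k *\<^sub>R v))"
    using square_integrable_imp_integrable[OF _ frozen_sq(1)[OF uminus_sign_vectors[OF v], of k]] by simp
qed

lemma integrable_bounded_mult:
  fixes Y X :: "'w \<Rightarrow> real"
  assumes "Y \<in> borel_measurable M" "\<And>\<omega>. \<bar>Y \<omega>\<bar> \<le> C" "integrable M X"
  shows "integrable M (\<lambda>\<omega>. Y \<omega> * X \<omega>)"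
proof (rule Bochner_Integration.integrable_bound[of _ "\<lambda>\<omega>. C * X \<omega>"])
  have "C \<ge> 0" using assms(2)[of undefined] by linarith
  then show "AE \<omega> in M. norm (Y \<omega> * X \<omega>) \<le> norm (C * X \<omega>)"
    using assms(2) by (auto simp: abs_mult intro!: mult_right_mono)
qed (use assms in auto)

text \<open>
  The expectation is split according to the value of \<open>xi\<close>; in each part the direction is a constant, and
  independence replaces its indicator by the probability \<open>2\<^sup>-\<^sup>n\<close>.
\<close>

lemma direction_average:
  assumes Y: "Y \<in> borel_measurable (iterates_algebra k)" and Y_bd: "\<And>\<omega>. \<bar>Y \<omega>\<bar> \<le> C"
  shows "(\<integral>\<omega>. Y \<omega> * ((fp k \<omega> - fm k \<omega>) / (2 * c k) * inverse (xi k \<omega> $ i)) \<partial>M)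
      = (\<integral>\<omega>. Y \<omega> * central_difference_mean f (c k) (x k \<omega>) $ i \<partial>M)"
proof -
  define \<Delta> where "\<Delta> v \<omega> = (f (x k \<omega> + c k *\<^sub>R v) - f (x k \<omega> - c k *\<^sub>R v)) / (2 * c k)" for v \<omega>
  note [measurable] = measurable_from_subalg[OF subalgebra_iterates Y]
  have \<Delta>_int: "integrable M (\<lambda>\<omega>. Y \<omega> * (\<Delta> v \<omega> * v $ i))" if "v \<in> sign_vectors" for v
    unfolding \<Delta>_def using frozen_integrable[OF that]
    by (intro integrable_bounded_mult[OF _ Y_bd]) auto
  have \<Delta>_F: "(\<lambda>\<omega>. Y \<omega> * (\<Delta> v \<omega> * v $ i)) \<in> borel_measurable (iterates_algebra k)" for v
    unfolding \<Delta>_def using Y frozen_measurable_iterates[of k "c k" v] frozen_measurable_iterates[of k "- c k" v]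
    by simp
  have split: "(\<integral>\<omega>. indicator {v} (xi k \<omega>) * (Y \<omega> * (\<Delta> v \<omega> * v $ i)) \<partial>M)
      = 1 / 2 ^ CARD('n) * (\<integral>\<omega>. Y \<omega> * (\<Delta> v \<omega> * v $ i) \<partial>M)"
    and split_int: "integrable M (\<lambda>\<omega>. indicator {v} (xi k \<omega>) * (Y \<omega> * (\<Delta> v \<omega> * v $ i)))"
    if v: "v \<in> sign_vectors" for v
  proof -
    have indep: "indep_var borel (\<lambda>\<omega>. indicator {v} (xi k \<omega>) :: real) borel (\<lambda>\<omega>. Y \<omega> * (\<Delta> v \<omega> * v $ i))"
      by (rule xi_indep_iterates[OF \<Delta>_F]) measurable
    have int: "integrable M (\<lambda>\<omega>. indicator {v} (xi k \<omega>) :: real)"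
      by (rule integrable_const_bound[of _ 1]) (auto simp: indicator_def)
    have "(\<integral>\<omega>. indicator {v} (xi k \<omega>) \<partial>M) = (\<integral>\<omega>. indicator {\<omega> \<in> space M. xi k \<omega> = v} \<omega> \<partial>M :: real)"
      by (intro Bochner_Integration.integral_cong) (auto simp: indicator_def)
    also have "\<dots> = 1 / 2 ^ CARD('n)" using prob_xi[OF v, of k] by simp
    finally show "(\<integral>\<omega>. indicator {v} (xi k \<omega>) * (Y \<omega> * (\<Delta> v \<omega> * v $ i)) \<partial>M)
      = 1 / 2 ^ CARD('n) * (\<integral>\<omega>. Y \<omega> * (\<Delta> v \<omega> * v $ i) \<partial>M)"
      using indep_var_lebesgue_integral[OF indep int \<Delta>_int[OF v]] by simp
    show "integrable M (\<lambda>\<omega>. indicator {v} (xi k \<omega>) * (Y \<omega> * (\<Delta> v \<omega> * v $ i)))"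
      using indep_var_integrable[OF indep int \<Delta>_int[OF v]] .
  qed
  have [measurable]: "\<Delta> v \<in> borel_measurable M" for v unfolding \<Delta>_def by measurable
  have "(\<integral>\<omega>. Y \<omega> * ((fp k \<omega> - fm k \<omega>) / (2 * c k) * inverse (xi k \<omega> $ i)) \<partial>M)
      = (\<integral>\<omega>. (\<Sum>v\<in>sign_vectors. indicator {v} (xi k \<omega>) * (Y \<omega> * (\<Delta> v \<omega> * v $ i))) \<partial>M)"
  proof (rule integral_cong_AE)
    show "AE \<omega> in M. Y \<omega> * ((fp k \<omega> - fm k \<omega>) / (2 * c k) * inverse (xi k \<omega> $ i))
        = (\<Sum>v\<in>sign_vectors. indicator {v} (xi k \<omega>) * (Y \<omega> * (\<Delta> v \<omega> * v $ i)))"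
      using xi_sign[of k]
    proof eventually_elim
      case (elim \<omega>)
      have "(\<Sum>v\<in>sign_vectors. indicator {v} (xi k \<omega>) * (Y \<omega> * (\<Delta> v \<omega> * v $ i)))
          = (\<Sum>v\<in>sign_vectors. if v = xi k \<omega> then Y \<omega> * (\<Delta> v \<omega> * v $ i) else 0)"
        by (intro sum.cong) (auto simp: indicator_def)
      then show ?case
        using elim by (simp add: finite_sign_vectors \<Delta>_def sign_vectors_inverse)
    qed
  qed measurable
  also have "\<dots> = (\<Sum>v\<in>sign_vectors. 1 / 2 ^ CARD('n) * (\<integral>\<omega>. Y \<omega> * (\<Delta> v \<omega> * v $ i) \<partial>M))"
    using split_int split by (subst Bochner_Integration.integral_sum) auto
  also have "\<dots> = (\<integral>\<omega>. (\<Sum>v\<in>sign_vectors. 1 / 2 ^ CARD('n) * (Y \<omega> * (\<Delta> v \<omega> * v $ i))) \<partial>M)"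
    using \<Delta>_int by (subst Bochner_Integration.integral_sum) auto
  also have "\<dots> = (\<integral>\<omega>. Y \<omega> * central_difference_mean f (c k) (x k \<omega>) $ i \<partial>M)"
    by (intro Bochner_Integration.integral_cong)
      (auto simp: central_difference_mean_def \<Delta>_def sum_distrib_left sum_divide_distrib mult.commute[of "2 ^ CARD('n)"])
  finally show ?thesis .
qed

lemma noise_orthogonal:
  assumes W: "W \<in> borel_measurable (direction_algebra k)" and W_bd: "\<And>\<omega>. \<bar>W \<omega>\<bar> \<le> C"
  shows "(\<integral>\<omega>. W \<omega> * (ep k \<omega> - em k \<omega>) \<partial>M) = 0"
    and "integrable M (\<lambda>\<omega>. W \<omega> * (ep k \<omega> - em k \<omega>))"
proof -
  interpret D: finite_measure_subalgebra M "direction_algebra k"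
    by unfold_locales (rule subalgebra_direction)
  note [measurable] = measurable_from_subalg[OF subalgebra_direction W]
  have "integrable M (ep k)" "integrable M (em k)"
    using square_integrable_imp_integrable[OF ep_measurable ep_sq(1)]
      square_integrable_imp_integrable[OF em_measurable em_sq(1)] by auto
  then show int: "integrable M (\<lambda>\<omega>. W \<omega> * (ep k \<omega> - em k \<omega>))"
    by (intro integrable_bounded_mult[OF _ W_bd]) auto
  have "(\<integral>\<omega>. W \<omega> * (ep k \<omega> - em k \<omega>) \<partial>M)
      = (\<integral>\<omega>. W \<omega> * real_cond_exp M (direction_algebra k) (\<lambda>\<omega>. ep k \<omega> - em k \<omega>) \<omega> \<partial>M)"
    using D.real_cond_exp_intg(2)[OF int W] by simp
  also have "\<dots> = (\<integral>\<omega>. 0 \<partial>M)"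
    using noise[of k] by (intro integral_cong_AE) auto
  finally show "(\<integral>\<omega>. W \<omega> * (ep k \<omega> - em k \<omega>) \<partial>M) = 0" by simp
qed

definition descent_prob :: "nat \<Rightarrow> real ^ 'n \<Rightarrow> 'w \<Rightarrow> real" where
  "descent_prob k d \<omega> = indicator (descent_signs (ghat k \<omega>)) d / real (card (descent_signs (ghat k \<omega>)))"

text \<open>
  This form exhibits the probability as a measurable function of \<open>ghat\<close>.
\<close>

lemma descent_prob_alt:
  "descent_prob k d \<omega> = (if d \<in> sign_vectors \<and> 0 \<le> d \<bullet> ghat k \<omega> then 1 else 0) /
     (\<Sum>e\<in>sign_vectors. if 0 \<le> e \<bullet> ghat k \<omega> then 1 else 0)"
proof -
  have "real (card (descent_signs (ghat k \<omega>))) = (\<Sum>e\<in>sign_vectors. if 0 \<le> e \<bullet> ghat k \<omega> then 1 else 0)"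
    by (simp add: descent_signs_def finite_sign_vectors sum.If_cases Collect_conj_eq)
  then show ?thesis by (simp add: descent_prob_def descent_signs_def indicator_def)
qed

lemma descent_prob_measurable [measurable]: "descent_prob k d \<in> borel_measurable M"
  unfolding descent_prob_alt[abs_def] by measurable

lemma descent_prob_bound: "\<bar>descent_prob k d \<omega>\<bar> \<le> 1"
  using descent_signs_nonempty[of "ghat k \<omega>"] by (auto simp: descent_prob_def indicator_def)

lemma sum_descent_prob:
  "(\<Sum>d\<in>sign_vectors. h d * descent_prob k d \<omega>)
     = (\<Sum>d\<in>descent_signs (ghat k \<omega>). h d) / real (card (descent_signs (ghat k \<omega>)))"
proof -
  have "(\<Sum>d\<in>sign_vectors. h d * descent_prob k d \<omega>)
      = (\<Sum>d\<in>descent_signs (ghat k \<omega>). h d * descent_prob k d \<omega>)"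
    by (rule sum.mono_neutral_right) (auto simp: finite_sign_vectors descent_signs_def descent_prob_def)
  then show ?thesis by (simp add: descent_prob_def sum_divide_distrib)
qed

lemma xihat_cond_prob:
  assumes W: "W \<in> borel_measurable (history_algebra k)" and W_bd: "\<And>\<omega>. \<bar>W \<omega>\<bar> \<le> C"
  shows "(\<integral>\<omega>. W \<omega> * indicator {\<omega> \<in> space M. xihat k \<omega> = d} \<omega> \<partial>M) = (\<integral>\<omega>. W \<omega> * descent_prob k d \<omega> \<partial>M)"
proof -
  interpret H: finite_measure_subalgebra M "history_algebra k"
    by unfold_locales (rule subalgebra_history)
  note [measurable] = measurable_from_subalg[OF subalgebra_history W]
  have int: "integrable M (\<lambda>\<omega>. W \<omega> * indicator {\<omega> \<in> space M. xihat k \<omega> = d} \<omega>)"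
    by (intro integrable_bounded_mult[OF _ W_bd] integrable_real_indicator)
      (auto simp: less_top[symmetric])
  have "(\<integral>\<omega>. W \<omega> * indicator {\<omega> \<in> space M. xihat k \<omega> = d} \<omega> \<partial>M)
      = (\<integral>\<omega>. W \<omega> * real_cond_exp M (history_algebra k) (indicator {\<omega> \<in> space M. xihat k \<omega> = d}) \<omega> \<partial>M)"
    by (rule H.real_cond_exp_intg(2)[OF int W, symmetric]) measurable
  also have "\<dots> = (\<integral>\<omega>. W \<omega> * descent_prob k d \<omega> \<partial>M)"
    using xihat_uniform[of k d] unfolding descent_prob_def[symmetric] by (intro integral_cong_AE) auto
  finally show ?thesis .
qed

lemma xihat_sign: "AE \<omega> in M. xihat k \<omega> \<in> sign_vectors"
proof -
  have int: "integrable M (descent_prob k d)" for d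
    by (rule integrable_const_bound[of _ 1]) (auto simp: descent_prob_bound)
  have one: "(\<Sum>d\<in>descent_signs u. 1) / real (card (descent_signs u)) = 1" for u :: "real ^ 'n"
    using descent_signs_nonempty[of u] by simp
  have "prob (\<Union>v\<in>sign_vectors. {\<omega> \<in> space M. xihat k \<omega> = v}) = (\<Sum>v\<in>sign_vectors. prob {\<omega> \<in> space M. xihat k \<omega> = v})"
    by (rule finite_measure_finite_Union) (auto simp: finite_sign_vectors disjoint_family_on_def)
  also have "\<dots> = (\<Sum>v\<in>sign_vectors. \<integral>\<omega>. 1 * descent_prob k v \<omega> \<partial>M)"
    using xihat_cond_prob[of "\<lambda>_. 1" k 1] by simp
  also have "\<dots> = (\<integral>\<omega>. (\<Sum>v\<in>sign_vectors. 1 * descent_prob k v \<omega>) \<partial>M)"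
    using int by (subst Bochner_Integration.integral_sum) auto
  also have "\<dots> = 1"
    unfolding sum_descent_prob one using prob_space by simp
  also have "(\<Union>v\<in>sign_vectors. {\<omega> \<in> space M. xihat k \<omega> = v}) = {\<omega> \<in> space M. xihat k \<omega> \<in> sign_vectors}" by auto
  finally have "prob {\<omega> \<in> space M. xihat k \<omega> \<in> sign_vectors} = 1" .
  then show ?thesis by (rule AE_prob_1[THEN AE_mp]) auto
qed

text \<open>
  A sign vector is its own componentwise inverse, so the estimate is a scalar multiple of \<open>xi\<close> itself.
\<close>

lemma ghat_sign_direction: "AE \<omega> in M. \<exists>w\<in>sign_vectors. \<exists>s. s \<noteq> 0 \<and> ghat k \<omega> = s *\<^sub>R w"
  using xi_sign[of k] ghat_nonzero[of k]
proof eventually_elim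
  case (elim \<omega>)
  define s where "s = ((f (x k \<omega> + c k *\<^sub>R xi k \<omega>) + ep k \<omega>) - (f (x k \<omega> - c k *\<^sub>R xi k \<omega>) + em k \<omega>)) / (2 * c k)"
  have "ghat k \<omega> = s *\<^sub>R xi k \<omega>"
    using sign_vectors_inverse[OF elim(1)] unfolding ghat_def grad_est_def s_def[symmetric] by (simp add: vec_eq_iff)
  then show ?case using elim by (intro bexI[of _ "xi k \<omega>"] exI[of _ s]) auto
qed

text \<open>
  Given the history, \<open>xihat\<close> averages over the half-cube facing \<open>ghat\<close>. The factor
  \<open>rho / infnorm ghat\<close> depends only on \<open>ghat\<close>, so the result is again a function of the history.
\<close>

lemma xihat_conditional_mean:
  assumes W: "W \<in> borel_measurable (history_algebra k)" and W_bd: "\<And>\<omega>. \<bar>W \<omega>\<bar> \<le> C"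
  shows "(\<integral>\<omega>. W \<omega> * xihat k \<omega> $ i \<partial>M) = (\<integral>\<omega>. W \<omega> * (rho CARD('n) / infnorm (ghat k \<omega>) * ghat k \<omega> $ i) \<partial>M)"
proof -
  note [measurable] = measurable_from_subalg[OF subalgebra_history W]
  let ?I = "\<lambda>d. indicator {\<omega> \<in> space M. xihat k \<omega> = d} :: 'w \<Rightarrow> real"
  have int1: "integrable M (\<lambda>\<omega>. W \<omega> * ?I d \<omega>)" for d
    by (intro integrable_bounded_mult[OF _ W_bd] integrable_real_indicator)
      (auto simp: less_top[symmetric])
  have int2: "integrable M (\<lambda>\<omega>. W \<omega> * descent_prob k d \<omega>)" for d
    by (intro integrable_bounded_mult[OF _ W_bd] integrable_const_bound[of _ 1])
      (auto simp: descent_prob_bound)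
  have "(\<integral>\<omega>. W \<omega> * xihat k \<omega> $ i \<partial>M) = (\<integral>\<omega>. (\<Sum>d\<in>sign_vectors. d $ i * (W \<omega> * ?I d \<omega>)) \<partial>M)"
  proof (rule integral_cong_AE)
    show "AE \<omega> in M. W \<omega> * xihat k \<omega> $ i = (\<Sum>d\<in>sign_vectors. d $ i * (W \<omega> * ?I d \<omega>))"
      using xihat_sign[of k] AE_space
    proof eventually_elim
      case (elim \<omega>)
      have "(\<Sum>d\<in>sign_vectors. d $ i * (W \<omega> * ?I d \<omega>))
          = (\<Sum>d\<in>sign_vectors. if d = xihat k \<omega> then d $ i * W \<omega> else 0)"
        using elim(2) by (intro sum.cong) (auto simp: indicator_def)
      then show ?case using elim(1) by (simp add: finite_sign_vectors)
    qed
  qed measurable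
  also have "\<dots> = (\<Sum>d\<in>sign_vectors. d $ i * (\<integral>\<omega>. W \<omega> * ?I d \<omega> \<partial>M))"
    using int1 by (subst Bochner_Integration.integral_sum) auto
  also have "\<dots> = (\<Sum>d\<in>sign_vectors. d $ i * (\<integral>\<omega>. W \<omega> * descent_prob k d \<omega> \<partial>M))"
    using xihat_cond_prob[OF W W_bd] by simp
  also have "\<dots> = (\<integral>\<omega>. (\<Sum>d\<in>sign_vectors. d $ i * (W \<omega> * descent_prob k d \<omega>)) \<partial>M)"
    using int2 by (subst Bochner_Integration.integral_sum) auto
  also have "\<dots> = (\<integral>\<omega>. W \<omega> * (rho CARD('n) / infnorm (ghat k \<omega>) * ghat k \<omega> $ i) \<partial>M)"
  proof (rule integral_cong_AE)
    show "AE \<omega> in M. (\<Sum>d\<in>sign_vectors. d $ i * (W \<omega> * descent_prob k d \<omega>))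
        = W \<omega> * (rho CARD('n) / infnorm (ghat k \<omega>) * ghat k \<omega> $ i)"
      using ghat_sign_direction[of k]
    proof eventually_elim
      case (elim \<omega>)
      then obtain w s where w: "w \<in> sign_vectors" "s \<noteq> 0" "ghat k \<omega> = s *\<^sub>R w" by blast
      have "(\<Sum>d\<in>sign_vectors. d $ i * (W \<omega> * descent_prob k d \<omega>))
          = W \<omega> * (\<Sum>d\<in>sign_vectors. d $ i * descent_prob k d \<omega>)"
        by (simp add: sum_distrib_left mult_ac)
      then show ?case
        unfolding sum_descent_prob
        using sum_descent_signs_component[OF w(1,2), of i] descent_signs_nonempty[of "ghat k \<omega>"] w(3) by simp
    qed
  qed measurable
  finally show ?thesis .
qed

text \<open>
  A component of the martingale difference \<open>w k\<close>. Written through the iterates alone, it is visibly a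
  function of \<open>x 0, \<dots>, x (k + 1)\<close>.
\<close>

definition fluctuation :: "nat \<Rightarrow> 'n \<Rightarrow> 'w \<Rightarrow> real" where
  "fluctuation k i \<omega> = x k \<omega> $ i - x (Suc k) \<omega> $ i - a k * central_difference_mean f (c k) (x k \<omega>) $ i"

lemma central_difference_mean_measurable: "central_difference_mean f (c k) \<in> borel_measurable borel"
  unfolding central_difference_mean_def borel_measurable_vec_iff by simp

lemma fluctuation_measurable: "fluctuation k i \<in> borel_measurable (iterates_algebra (Suc k))"
proof -
  note [measurable] = x_measurable_iterates[of k "Suc k"] x_measurable_iterates[of "Suc k" "Suc k"]
    central_difference_mean_measurable
  show ?thesis unfolding fluctuation_def[abs_def] by measurable
qed

definition gain :: "nat \<Rightarrow> 'w \<Rightarrow> real" where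
  "gain k \<omega> = 1 / (1 + rho CARD('n) / infnorm (ghat k \<omega>))"

lemma rho_nonneg: "rho n \<ge> 0"
  by (simp add: rho_def)

lemma gain_bounds: "0 \<le> gain k \<omega>" "gain k \<omega> \<le> 1"
proof -
  have "0 \<le> rho CARD('n) / infnorm (ghat k \<omega>)"
    using rho_nonneg infnorm_pos_le by (rule divide_nonneg_nonneg)
  then show "0 \<le> gain k \<omega>" "gain k \<omega> \<le> 1" by (simp_all add: gain_def)
qed

lemma gain_measurable_history: "gain k \<in> borel_measurable (history_algebra k)"
proof -
  note [measurable] = ghat_measurable_history[of k]
  show ?thesis unfolding gain_def[abs_def] by measurable
qed

lemma gain_measurable [measurable]: "gain k \<in> borel_measurable M"
  using measurable_from_subalg[OF subalgebra_history gain_measurable_history] .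

lemma step_component:
  "\<omega> \<in> space M \<Longrightarrow> x k \<omega> $ i - x (Suc k) \<omega> $ i = a k * (gain k \<omega> * (ghat k \<omega> $ i + xihat k \<omega> $ i))"
  by (simp add: step gain_def)

lemma ghat_component:
  "ghat k \<omega> $ i = (fp k \<omega> - fm k \<omega>) / (2 * c k) * inverse (xi k \<omega> $ i)
     + inverse (xi k \<omega> $ i) * (ep k \<omega> - em k \<omega>) / (2 * c k)"
  unfolding ghat_def grad_est_def by (simp add: diff_divide_distrib add_divide_distrib algebra_simps)

definition energy :: "nat \<Rightarrow> 'w \<Rightarrow> real" where
  "energy k \<omega> = (fp k \<omega>)\<^sup>2 + (fm k \<omega>)\<^sup>2 + (ep k \<omega>)\<^sup>2 + (em k \<omega>)\<^sup>2"

lemma energy_integrable: "integrable M (energy k)" and energy_integral: "(\<integral>\<omega>. energy k \<omega> \<partial>M) \<le> 2 * \<alpha>0 + 2 * \<alpha>1"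
proof -
  show "integrable M (energy k)"
    unfolding energy_def[abs_def]
    by (intro Bochner_Integration.integrable_add ep_sq em_sq fp_sq fm_sq)
  have "(\<integral>\<omega>. energy k \<omega> \<partial>M) = (\<integral>\<omega>. (fp k \<omega>)\<^sup>2 \<partial>M) + (\<integral>\<omega>. (fm k \<omega>)\<^sup>2 \<partial>M)
      + (\<integral>\<omega>. (ep k \<omega>)\<^sup>2 \<partial>M) + (\<integral>\<omega>. (em k \<omega>)\<^sup>2 \<partial>M)"
    unfolding energy_def
    by (simp only: Bochner_Integration.integral_add Bochner_Integration.integrable_add ep_sq em_sq fp_sq fm_sq)
  then show "(\<integral>\<omega>. energy k \<omega> \<partial>M) \<le> 2 * \<alpha>0 + 2 * \<alpha>1"
    using ep_sq(2)[of k] em_sq(2)[of k] fp_sq(2)[of k] fm_sq(2)[of k] by linarith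
qed

lemma ghat_component_sq_le: "AE \<omega> in M. (ghat k \<omega> $ i)\<^sup>2 \<le> energy k \<omega> / (c k)\<^sup>2"
  using xi_sign[of k]
proof eventually_elim
  case (elim \<omega>)
  have "ghat k \<omega> $ i = (fp k \<omega> + ep k \<omega> - (fm k \<omega> + em k \<omega>)) / (2 * c k) * xi k \<omega> $ i"
    unfolding ghat_def grad_est_def using sign_vectors_inverse[OF elim, of i] by simp
  also have "fp k \<omega> + ep k \<omega> - (fm k \<omega> + em k \<omega>) = fp k \<omega> + ep k \<omega> - fm k \<omega> - em k \<omega>" by simp
  finally have "(ghat k \<omega> $ i)\<^sup>2 = ((fp k \<omega> + ep k \<omega> - fm k \<omega> - em k \<omega>) / (2 * c k))\<^sup>2 * (xi k \<omega> $ i)\<^sup>2"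
    by (simp only: power_mult_distrib)
  also have "(xi k \<omega> $ i)\<^sup>2 = 1" using sign_vectors_square[OF elim, of i] by (simp add: power2_eq_square)
  also have "((fp k \<omega> + ep k \<omega> - fm k \<omega> - em k \<omega>) / (2 * c k))\<^sup>2 * 1
      = (fp k \<omega> + ep k \<omega> - fm k \<omega> - em k \<omega>)\<^sup>2 / 4 / (c k)\<^sup>2"
    by (simp add: power_divide power_mult_distrib)
  also have "\<dots> \<le> energy k \<omega> / (c k)\<^sup>2"
    using sum_of_four_squared[of "fp k \<omega>" "ep k \<omega>" "fm k \<omega>" "em k \<omega>"]
    by (intro divide_right_mono) (auto simp: energy_def)
  finally show ?case .
qed

lemma ghat_component_integrable: "integrable M (\<lambda>\<omega>. ghat k \<omega> $ i)"
proof (rule square_integrable_imp_integrable)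
  show "integrable M (\<lambda>\<omega>. (ghat k \<omega> $ i)\<^sup>2)"
  proof (rule Bochner_Integration.integrable_bound[of _ "\<lambda>\<omega>. energy k \<omega> / (c k)\<^sup>2"])
    show "AE \<omega> in M. norm ((ghat k \<omega> $ i)\<^sup>2) \<le> norm (energy k \<omega> / (c k)\<^sup>2)"
      using ghat_component_sq_le[of k i] by eventually_elim (auto simp: energy_def)
  qed (use energy_integrable in auto)
qed measurable

text \<open>
  The noise drops out by the assumption on its conditional expectation, and what remains is an average
  over the direction.
\<close>

lemma ghat_unbiased:
  assumes Y: "Y \<in> borel_measurable (iterates_algebra k)" and Y_bd: "\<And>\<omega>. \<bar>Y \<omega>\<bar> \<le> C"
  shows "(\<integral>\<omega>. Y \<omega> * ghat k \<omega> $ i \<partial>M) = (\<integral>\<omega>. Y \<omega> * central_difference_mean f (c k) (x k \<omega>) $ i \<partial>M)"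
proof -
  \<comment> \<open>multipliers have to be bounded everywhere, while the components of the inverse of \<open>xi\<close> are
    bounded almost surely; the truncation changes them on a null set\<close>
  define W where "W \<omega> = Y \<omega> * max (- 1) (min 1 (inverse (xi k \<omega> $ i)))" for \<omega>
  note [measurable] = measurable_from_subalg[OF subalgebra_iterates Y]
  have C: "C \<ge> 0" using Y_bd[of undefined] by linarith
  have W_D: "W \<in> borel_measurable (direction_algebra k)"
  proof -
    note [measurable] = iterates_measurable_imp_direction[OF Y] direction_algebra_measurable(2)[of k]
    show ?thesis unfolding W_def by measurable
  qed
  then have [measurable]: "W \<in> borel_measurable M" by (rule measurable_from_subalg[OF subalgebra_direction])
  have W_bd: "\<bar>W \<omega>\<bar> \<le> C" for \<omega>
  proof -
    have "\<bar>Y \<omega>\<bar> * \<bar>max (- 1) (min 1 (inverse (xi k \<omega> $ i)))\<bar> \<le> C * 1"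
      using Y_bd[of \<omega>] C by (intro mult_mono) auto
    then show ?thesis by (simp add: W_def abs_mult)
  qed
  have W_eq: "AE \<omega> in M. Y \<omega> * inverse (xi k \<omega> $ i) = W \<omega>"
    using xi_sign[of k]
  proof eventually_elim
    case (elim \<omega>)
    then show ?case using sign_vectors_component[OF elim, of i] by (auto simp: W_def)
  qed
  let ?S = "\<lambda>\<omega>. Y \<omega> * ((fp k \<omega> - fm k \<omega>) / (2 * c k) * inverse (xi k \<omega> $ i))"
  let ?R = "\<lambda>\<omega>. W \<omega> * (ep k \<omega> - em k \<omega>) / (2 * c k)"
  have split: "AE \<omega> in M. Y \<omega> * ghat k \<omega> $ i = ?S \<omega> + ?R \<omega>"
    using W_eq
  proof eventually_elim
    case (elim \<omega>)
    show ?case unfolding ghat_component elim[symmetric] by (simp add: algebra_simps)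
  qed
  have R_int: "integrable M ?R" using noise_orthogonal(2)[OF W_D W_bd] by simp
  have Yg_int: "integrable M (\<lambda>\<omega>. Y \<omega> * ghat k \<omega> $ i)"
    by (rule integrable_bounded_mult[OF _ Y_bd ghat_component_integrable]) measurable
  have "integrable M (\<lambda>\<omega>. Y \<omega> * ghat k \<omega> $ i - ?R \<omega>)" using Yg_int R_int by simp
  moreover have "AE \<omega> in M. Y \<omega> * ghat k \<omega> $ i - ?R \<omega> = ?S \<omega>"
    using split by eventually_elim simp
  ultimately have S_int: "integrable M ?S"
    by (subst integrable_cong_AE[symmetric, where f="\<lambda>\<omega>. Y \<omega> * ghat k \<omega> $ i - ?R \<omega>"]) measurable
  have "(\<integral>\<omega>. Y \<omega> * ghat k \<omega> $ i \<partial>M) = (\<integral>\<omega>. ?S \<omega> + ?R \<omega> \<partial>M)"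
    using split by (intro integral_cong_AE) measurable
  also have "\<dots> = (\<integral>\<omega>. ?S \<omega> \<partial>M) + (\<integral>\<omega>. ?R \<omega> \<partial>M)" using S_int R_int by simp
  also have "(\<integral>\<omega>. ?R \<omega> \<partial>M) = 0" using noise_orthogonal(1)[OF W_D W_bd] by simp
  finally show ?thesis using direction_average[OF Y Y_bd] by simp
qed

text \<open>
  Given the history, the mean of \<open>xihat\<close> is \<open>rho / infnorm ghat\<close> times \<open>ghat\<close>, and the gain is the inverse
  of \<open>1 + rho / infnorm ghat\<close>.
\<close>

lemma normalized_step_unbiased:
  assumes Y: "Y \<in> borel_measurable (iterates_algebra k)" and Y_bd: "\<And>\<omega>. \<bar>Y \<omega>\<bar> \<le> C"
  shows "(\<integral>\<omega>. Y \<omega> * (gain k \<omega> * (ghat k \<omega> $ i + xihat k \<omega> $ i)) \<partial>M) = (\<integral>\<omega>. Y \<omega> * ghat k \<omega> $ i \<partial>M)"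
proof -
  define W where "W \<omega> = Y \<omega> * gain k \<omega>" for \<omega>
  note [measurable] = measurable_from_subalg[OF subalgebra_iterates Y]
  have W_H: "W \<in> borel_measurable (history_algebra k)"
  proof -
    note [measurable] = iterates_measurable_imp_history[OF Y] gain_measurable_history[of k]
    show ?thesis unfolding W_def by measurable
  qed
  then have [measurable]: "W \<in> borel_measurable M" by (rule measurable_from_subalg[OF subalgebra_history])
  have C: "C \<ge> 0" using Y_bd[of undefined] by linarith
  have W_bd: "\<bar>W \<omega>\<bar> \<le> C" for \<omega>
    using mult_mono[OF Y_bd[of \<omega>] gain_bounds(2)[of k \<omega>] C gain_bounds(1)[of k \<omega>]] gain_bounds(1)[of k \<omega>]
    by (simp add: W_def abs_mult)
  let ?U = "\<lambda>\<omega>. ghat k \<omega> $ i" and ?m = "\<lambda>\<omega>. rho CARD('n) / infnorm (ghat k \<omega>) * ghat k \<omega> $ i"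
  have xihat_int: "integrable M (\<lambda>\<omega>. xihat k \<omega> $ i)"
  proof (rule integrable_const_bound[of _ 1])
    show "AE \<omega> in M. norm (xihat k \<omega> $ i) \<le> 1"
      using xihat_sign[of k]
    proof eventually_elim
      case (elim \<omega>)
      then show ?case using sign_vectors_component[OF elim, of i] by auto
    qed
  qed measurable
  have m_bd: "\<bar>?m \<omega>\<bar> \<le> rho CARD('n)" for \<omega>
  proof (cases "ghat k \<omega> = 0")
    case False
    then have "infnorm (ghat k \<omega>) > 0" by (simp add: infnorm_pos_lt)
    moreover have "\<bar>ghat k \<omega> $ i\<bar> \<le> infnorm (ghat k \<omega>)" by (rule component_le_infnorm_cart)
    ultimately have "\<bar>ghat k \<omega> $ i\<bar> / infnorm (ghat k \<omega>) \<le> 1" by simp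
    then have "rho CARD('n) * (\<bar>ghat k \<omega> $ i\<bar> / infnorm (ghat k \<omega>)) \<le> rho CARD('n) * 1"
      using rho_nonneg by (rule mult_left_mono)
    then show ?thesis using rho_nonneg[of "CARD('n)"] infnorm_pos_le[of "ghat k \<omega>"] by (simp add: abs_mult)
  qed (use rho_nonneg in simp)
  have m_int: "integrable M ?m"
    by (rule integrable_const_bound[of _ "rho CARD('n)"]) (use m_bd in \<open>auto simp: abs_mult\<close>)
  note ints = integrable_bounded_mult[OF _ W_bd ghat_component_integrable]
    integrable_bounded_mult[OF _ W_bd xihat_int] integrable_bounded_mult[OF _ W_bd m_int]
  have "(\<integral>\<omega>. Y \<omega> * (gain k \<omega> * (?U \<omega> + xihat k \<omega> $ i)) \<partial>M)
      = (\<integral>\<omega>. W \<omega> * ?U \<omega> + W \<omega> * xihat k \<omega> $ i \<partial>M)"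
    by (simp add: W_def algebra_simps)
  also have "\<dots> = (\<integral>\<omega>. W \<omega> * ?U \<omega> \<partial>M) + (\<integral>\<omega>. W \<omega> * xihat k \<omega> $ i \<partial>M)"
    using ints by simp
  also have "(\<integral>\<omega>. W \<omega> * xihat k \<omega> $ i \<partial>M) = (\<integral>\<omega>. W \<omega> * ?m \<omega> \<partial>M)"
    by (rule xihat_conditional_mean[OF W_H W_bd])
  also have "(\<integral>\<omega>. W \<omega> * ?U \<omega> \<partial>M) + (\<integral>\<omega>. W \<omega> * ?m \<omega> \<partial>M) = (\<integral>\<omega>. W \<omega> * ?U \<omega> + W \<omega> * ?m \<omega> \<partial>M)"
    using ints by simp
  also have "\<dots> = (\<integral>\<omega>. Y \<omega> * ?U \<omega> \<partial>M)"
  proof (rule integral_cong_AE)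
    show "AE \<omega> in M. W \<omega> * ?U \<omega> + W \<omega> * ?m \<omega> = Y \<omega> * ?U \<omega>"
      using ghat_nonzero[of k]
    proof eventually_elim
      case (elim \<omega>)
      then have "infnorm (ghat k \<omega>) > 0" by (simp add: infnorm_pos_lt)
      then have "1 + rho CARD('n) / infnorm (ghat k \<omega>) > 0" using rho_nonneg[of "CARD('n)"]
        by (intro add_pos_nonneg) auto
      then have "gain k \<omega> * (1 + rho CARD('n) / infnorm (ghat k \<omega>)) = 1" by (simp add: gain_def)
      moreover have "W \<omega> * ?U \<omega> + W \<omega> * ?m \<omega>
          = (gain k \<omega> * (1 + rho CARD('n) / infnorm (ghat k \<omega>))) * (Y \<omega> * ?U \<omega>)"
        by (simp add: W_def algebra_simps)
      ultimately show ?case by simp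
    qed
  qed measurable
  finally show ?thesis .
qed

lemma frozen_sq_minus:
  assumes "v \<in> sign_vectors"
  shows "integrable M (\<lambda>\<omega>. (f (x k \<omega> - c k *\<^sub>R v))\<^sup>2)"
    and "(\<integral>\<omega>. (f (x k \<omega> - c k *\<^sub>R v))\<^sup>2 \<partial>M) \<le> 2 ^ CARD('n) * \<alpha>1"
  using frozen_sq[OF uminus_sign_vectors[OF assms], of k] by simp_all

text \<open>
  A bound for the square of the fluctuation that is integrable because every summand has a bounded moment.
  The energy accounts for \<open>ghat\<close>, the constant \<open>4\<close> for \<open>xihat\<close>, and the last summand for the mean
  difference, whose square is at most the mean of the squared differences.
\<close>

definition majorant :: "nat \<Rightarrow> 'w \<Rightarrow> real" where
  "majorant k \<omega> = (a k)\<^sup>2 * (4 * (energy k \<omega> / (c k)\<^sup>2) + 4 +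
     (\<Sum>v\<in>sign_vectors. (f (x k \<omega> + c k *\<^sub>R v))\<^sup>2 + (f (x k \<omega> - c k *\<^sub>R v))\<^sup>2) / (2 ^ CARD('n) * (c k)\<^sup>2))"

lemma majorant_integrable: "integrable M (majorant k)"
  unfolding majorant_def[abs_def]
  using energy_integrable[of k] frozen_sq(1)[of _ k] frozen_sq_minus(1)[of _ k]
  by (intro integrable_mult_right Bochner_Integration.integrable_add Bochner_Integration.integrable_divide_zero
      Bochner_Integration.integrable_sum) auto

lemma majorant_integral:
  "(\<integral>\<omega>. majorant k \<omega> \<partial>M) \<le> (a k)\<^sup>2 * (4 * ((2 * \<alpha>0 + 2 * \<alpha>1) / (c k)\<^sup>2) + 4 + 2 ^ CARD('n) * 2 * \<alpha>1 / (c k)\<^sup>2)"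
proof -
  let ?N = "2 ^ CARD('n) :: real"
  let ?g = "\<lambda>v \<omega>. (f (x k \<omega> + c k *\<^sub>R v))\<^sup>2 + (f (x k \<omega> - c k *\<^sub>R v))\<^sup>2"
  have g_int: "integrable M (?g v)" "(\<integral>\<omega>. ?g v \<omega> \<partial>M) \<le> ?N * \<alpha>1 + ?N * \<alpha>1" if "v \<in> sign_vectors" for v
    using frozen_sq[OF that, of k] frozen_sq_minus[OF that, of k]
    by (simp_all only: Bochner_Integration.integral_add Bochner_Integration.integrable_add add_mono)
  have "(\<integral>\<omega>. (\<Sum>v\<in>sign_vectors. ?g v \<omega>) \<partial>M) = (\<Sum>v\<in>sign_vectors. \<integral>\<omega>. ?g v \<omega> \<partial>M)"
    using g_int(1) by (intro Bochner_Integration.integral_sum)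
  also have "\<dots> \<le> (\<Sum>v\<in>(sign_vectors :: (real ^ 'n) set). ?N * \<alpha>1 + ?N * \<alpha>1)"
    using g_int(2) by (rule sum_mono)
  also have "\<dots> = ?N * (?N * 2 * \<alpha>1)" by (simp add: card_sign_vectors)
  finally have "(\<integral>\<omega>. (\<Sum>v\<in>sign_vectors. ?g v \<omega>) \<partial>M) / (?N * (c k)\<^sup>2) \<le> ?N * (?N * 2 * \<alpha>1) / (?N * (c k)\<^sup>2)"
    by (rule divide_right_mono) simp
  then have s: "(\<integral>\<omega>. (\<Sum>v\<in>sign_vectors. ?g v \<omega>) \<partial>M) / (?N * (c k)\<^sup>2) \<le> ?N * 2 * \<alpha>1 / (c k)\<^sup>2" by simp
  have e: "(\<integral>\<omega>. energy k \<omega> \<partial>M) / (c k)\<^sup>2 \<le> (2 * \<alpha>0 + 2 * \<alpha>1) / (c k)\<^sup>2"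
    using energy_integral by (rule divide_right_mono) simp
  have ints: "integrable M (\<lambda>\<omega>. 4 * (energy k \<omega> / (c k)\<^sup>2))"
    "integrable M (\<lambda>\<omega>. (\<Sum>v\<in>sign_vectors. ?g v \<omega>) / (?N * (c k)\<^sup>2))"
    using energy_integrable g_int(1)
    by (auto intro!: Bochner_Integration.integrable_divide_zero Bochner_Integration.integrable_sum)
  have "(\<integral>\<omega>. majorant k \<omega> \<partial>M) = (a k)\<^sup>2 * (\<integral>\<omega>. 4 * (energy k \<omega> / (c k)\<^sup>2) + 4 + (\<Sum>v\<in>sign_vectors. ?g v \<omega>) / (?N * (c k)\<^sup>2) \<partial>M)"
    unfolding majorant_def by (rule integral_mult_right_zero)
  also have "(\<integral>\<omega>. 4 * (energy k \<omega> / (c k)\<^sup>2) + 4 + (\<Sum>v\<in>sign_vectors. ?g v \<omega>) / (?N * (c k)\<^sup>2) \<partial>M)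
      = (\<integral>\<omega>. 4 * (energy k \<omega> / (c k)\<^sup>2) \<partial>M) + 4 + (\<integral>\<omega>. (\<Sum>v\<in>sign_vectors. ?g v \<omega>) / (?N * (c k)\<^sup>2) \<partial>M)"
    using ints prob_space by (simp add: Bochner_Integration.integral_add)
  also have "\<dots> = 4 * ((\<integral>\<omega>. energy k \<omega> \<partial>M) / (c k)\<^sup>2) + 4 + (\<integral>\<omega>. (\<Sum>v\<in>sign_vectors. ?g v \<omega>) \<partial>M) / (?N * (c k)\<^sup>2)"
    by simp
  also have "\<dots> \<le> 4 * ((2 * \<alpha>0 + 2 * \<alpha>1) / (c k)\<^sup>2) + 4 + ?N * 2 * \<alpha>1 / (c k)\<^sup>2"
    using s e by linarith
  finally show ?thesis by (simp add: mult_left_mono)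
qed

lemma fluctuation_sq_le: "AE \<omega> in M. (fluctuation k i \<omega>)\<^sup>2 \<le> majorant k \<omega>"
  using ghat_component_sq_le[of k i] xihat_sign[of k] AE_space
proof eventually_elim
  case (elim \<omega>)
  let ?N = "2 ^ CARD('n) :: real"
  define h where "h = gain k \<omega> * (ghat k \<omega> $ i + xihat k \<omega> $ i)"
  define m where "m = central_difference_mean f (c k) (x k \<omega>) $ i"
  define \<Delta> where "\<Delta> v = (f (x k \<omega> + c k *\<^sub>R v) - f (x k \<omega> - c k *\<^sub>R v)) / (2 * c k)" for v
  have "fluctuation k i \<omega> = a k * (h + (- m))"
    using step_component[OF elim(3), of k i] by (simp add: fluctuation_def h_def m_def algebra_simps)
  then have fl_le: "(fluctuation k i \<omega>)\<^sup>2 \<le> (a k)\<^sup>2 * (2 * h\<^sup>2 + 2 * m\<^sup>2)"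
    using sum_of_two_squared[of h "- m"] by (simp add: power_mult_distrib mult_left_mono)
  have "h\<^sup>2 \<le> 2 * (energy k \<omega> / (c k)\<^sup>2) + 2"
  proof -
    have "(xihat k \<omega> $ i)\<^sup>2 = 1" using sign_vectors_square[OF elim(2), of i] by (simp add: power2_eq_square)
    then have "(ghat k \<omega> $ i + xihat k \<omega> $ i)\<^sup>2 \<le> 2 * (energy k \<omega> / (c k)\<^sup>2) + 2"
      using sum_of_two_squared[of "ghat k \<omega> $ i" "xihat k \<omega> $ i"] elim(1) by linarith
    moreover have "h\<^sup>2 \<le> 1 * (ghat k \<omega> $ i + xihat k \<omega> $ i)\<^sup>2"
      unfolding h_def power_mult_distrib using gain_bounds[of k \<omega>]
      by (intro mult_right_mono) (auto simp: power_le_one)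
    ultimately show ?thesis by simp
  qed
  moreover have "2 * m\<^sup>2 \<le> (\<Sum>v\<in>sign_vectors. (f (x k \<omega> + c k *\<^sub>R v))\<^sup>2 + (f (x k \<omega> - c k *\<^sub>R v))\<^sup>2) / (?N * (c k)\<^sup>2)"
  proof -
    have "(\<Sum>v\<in>sign_vectors. \<Delta> v * v $ i)\<^sup>2 \<le> (\<Sum>v\<in>sign_vectors. (\<Delta> v * v $ i)\<^sup>2) * ?N"
      using sum_squared_le_sum_of_squares[of "\<lambda>v. \<Delta> v * v $ i" "sign_vectors :: (real ^ 'n) set"] finite_sign_vectors
      by (simp add: card_sign_vectors)
    then have "m\<^sup>2 \<le> (\<Sum>v\<in>sign_vectors. (\<Delta> v * v $ i)\<^sup>2) / ?N"
      by (simp add: m_def central_difference_mean_def \<Delta>_def power_divide divide_simps power2_eq_square)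
    also have "\<dots> \<le> (\<Sum>v\<in>sign_vectors. ((f (x k \<omega> + c k *\<^sub>R v))\<^sup>2 + (f (x k \<omega> - c k *\<^sub>R v))\<^sup>2) / (2 * (c k)\<^sup>2)) / ?N"
    proof (intro divide_right_mono sum_mono)
      fix v :: "real ^ 'n" assume v: "v \<in> sign_vectors"
      have "(\<Delta> v * v $ i)\<^sup>2 = (f (x k \<omega> + c k *\<^sub>R v) + - f (x k \<omega> - c k *\<^sub>R v))\<^sup>2 / (4 * (c k)\<^sup>2)"
        using sign_vectors_square[OF v, of i] by (simp add: \<Delta>_def power_mult_distrib power_divide power2_eq_square)
      also have "\<dots> \<le> (2 * (f (x k \<omega> + c k *\<^sub>R v))\<^sup>2 + 2 * (f (x k \<omega> - c k *\<^sub>R v))\<^sup>2) / (4 * (c k)\<^sup>2)"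
        using sum_of_two_squared[of "f (x k \<omega> + c k *\<^sub>R v)" "- f (x k \<omega> - c k *\<^sub>R v)"]
        by (intro divide_right_mono) auto
      also have "\<dots> = ((f (x k \<omega> + c k *\<^sub>R v))\<^sup>2 + (f (x k \<omega> - c k *\<^sub>R v))\<^sup>2) / (2 * (c k)\<^sup>2)"
        by (simp add: divide_simps)
      finally show "(\<Delta> v * v $ i)\<^sup>2 \<le> \<dots>" .
    qed simp
    finally show ?thesis by (simp add: sum_divide_distrib[symmetric] mult_ac)
  qed
  ultimately have "2 * h\<^sup>2 + 2 * m\<^sup>2 \<le> 4 * (energy k \<omega> / (c k)\<^sup>2) + 4 +
      (\<Sum>v\<in>sign_vectors. (f (x k \<omega> + c k *\<^sub>R v))\<^sup>2 + (f (x k \<omega> - c k *\<^sub>R v))\<^sup>2) / (?N * (c k)\<^sup>2)"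
    by linarith
  from mult_left_mono[OF this zero_le_power2[of "a k"]] fl_le
  show ?case unfolding majorant_def by linarith
qed

lemma fluctuation_measurable_M [measurable]: "fluctuation k i \<in> borel_measurable M"
  using measurable_from_subalg[OF subalgebra_iterates fluctuation_measurable] .

lemma fluctuation_sq_integrable: "integrable M (\<lambda>\<omega>. (fluctuation k i \<omega>)\<^sup>2)"
proof (rule Bochner_Integration.integrable_bound[OF majorant_integrable[of k]])
  show "AE \<omega> in M. norm ((fluctuation k i \<omega>)\<^sup>2) \<le> norm (majorant k \<omega>)"
    using fluctuation_sq_le[of k i] by eventually_elim simp
qed measurable

lemma fluctuation_sq_integral:
  "(\<integral>\<omega>. (fluctuation k i \<omega>)\<^sup>2 \<partial>M)
     \<le> (a k)\<^sup>2 * (4 * ((2 * \<alpha>0 + 2 * \<alpha>1) / (c k)\<^sup>2) + 4 + 2 ^ CARD('n) * 2 * \<alpha>1 / (c k)\<^sup>2)"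
  using integral_mono_AE[OF fluctuation_sq_integrable majorant_integrable fluctuation_sq_le] majorant_integral
  by (rule order_trans)

lemma fluctuation_orthogonal:
  assumes Y: "Y \<in> borel_measurable (iterates_algebra k)" and Y_bd: "\<And>\<omega>. \<bar>Y \<omega>\<bar> \<le> C"
  shows "(\<integral>\<omega>. Y \<omega> * fluctuation k i \<omega> \<partial>M) = 0"
proof -
  note [measurable] = measurable_from_subalg[OF subalgebra_iterates Y] central_difference_mean_measurable
  let ?h = "\<lambda>\<omega>. gain k \<omega> * (ghat k \<omega> $ i + xihat k \<omega> $ i)" and ?m = "\<lambda>\<omega>. central_difference_mean f (c k) (x k \<omega>) $ i"
  have m_int: "integrable M ?m"
    unfolding central_difference_mean_def using frozen_integrable[of _ k]
    by (auto intro!: Bochner_Integration.integrable_divide_zero Bochner_Integration.integrable_sum)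
  have fl_int: "integrable M (fluctuation k i)"
    by (rule square_integrable_imp_integrable[OF _ fluctuation_sq_integrable]) measurable
  have fl: "fluctuation k i \<omega> = a k * ?h \<omega> - a k * ?m \<omega>" if "\<omega> \<in> space M" for \<omega>
    using step_component[OF that] by (simp add: fluctuation_def)
  have "integrable M (\<lambda>\<omega>. (fluctuation k i \<omega> + a k * ?m \<omega>) / a k)" using fl_int m_int by simp
  moreover have "(fluctuation k i \<omega> + a k * ?m \<omega>) / a k = ?h \<omega>" if "\<omega> \<in> space M" for \<omega>
    using fl[OF that] a_pos[of k] by simp
  ultimately have h_int: "integrable M ?h" by (simp cong: Bochner_Integration.integrable_cong)
  note Yints = integrable_bounded_mult[OF _ Y_bd h_int] integrable_bounded_mult[OF _ Y_bd m_int]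
  have "(\<integral>\<omega>. Y \<omega> * fluctuation k i \<omega> \<partial>M) = (\<integral>\<omega>. a k * (Y \<omega> * ?h \<omega>) - a k * (Y \<omega> * ?m \<omega>) \<partial>M)"
    by (intro Bochner_Integration.integral_cong) (auto simp: fl algebra_simps)
  also have "\<dots> = a k * (\<integral>\<omega>. Y \<omega> * ?h \<omega> \<partial>M) - a k * (\<integral>\<omega>. Y \<omega> * ?m \<omega> \<partial>M)"
    using Yints by simp
  also have "\<dots> = 0"
    using normalized_step_unbiased[OF Y Y_bd, of i] ghat_unbiased[OF Y Y_bd, of i] by simp
  finally show ?thesis .
qed

lemma fluctuation_summable:
  assumes c_bd: "\<And>k. c k \<le> B" and summ: "summable (\<lambda>k. (a k / c k)\<^sup>2)"
  shows "AE \<omega> in M. summable (\<lambda>k. fluctuation k i \<omega>)"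
proof (rule orthogonal_increments_summable[where F = iterates_algebra])
  let ?K = "4 * (2 * \<alpha>0 + 2 * \<alpha>1) + 4 * B\<^sup>2 + 2 ^ CARD('n) * 2 * \<alpha>1"
  show "summable (\<lambda>k. \<integral>\<omega>. (fluctuation k i \<omega>)\<^sup>2 \<partial>M)"
  proof (rule summable_comparison_test')
    show "summable (\<lambda>k. ?K * (a k / c k)\<^sup>2)" using summ by (rule summable_mult)
    fix k :: nat
    have "(c k)\<^sup>2 \<le> B\<^sup>2" using c_pos[of k] c_bd[of k] by (intro power_mono) auto
    then have "4 \<le> 4 * B\<^sup>2 / (c k)\<^sup>2" using c_pos[of k] by (simp add: field_simps)
    then have "4 * ((2 * \<alpha>0 + 2 * \<alpha>1) / (c k)\<^sup>2) + 4 + 2 ^ CARD('n) * 2 * \<alpha>1 / (c k)\<^sup>2 \<le> ?K / (c k)\<^sup>2"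
      by (simp add: add_divide_distrib)
    then have "(a k)\<^sup>2 * (4 * ((2 * \<alpha>0 + 2 * \<alpha>1) / (c k)\<^sup>2) + 4 + 2 ^ CARD('n) * 2 * \<alpha>1 / (c k)\<^sup>2) \<le> (a k)\<^sup>2 * (?K / (c k)\<^sup>2)"
      by (rule mult_left_mono) simp
    then have "(\<integral>\<omega>. (fluctuation k i \<omega>)\<^sup>2 \<partial>M) \<le> (a k)\<^sup>2 * (?K / (c k)\<^sup>2)"
      using fluctuation_sq_integral[of k i] by (rule order_trans[rotated])
    then show "norm (\<integral>\<omega>. (fluctuation k i \<omega>)\<^sup>2 \<partial>M) \<le> ?K * (a k / c k)\<^sup>2"
      by (simp add: power_divide mult_ac)
  qed
qed (rule subalgebra_iterates iterates_algebra_mono fluctuation_measurable fluctuation_sq_integrable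
    fluctuation_orthogonal; assumption)+

end

section \<open>Consistency of central differences and convergence\<close>

text \<open>
  By the mean value theorem a central difference in direction \<open>v\<close> is the derivative in direction \<open>v\<close> at a
  point at most \<open>c k\<close> times \<open>v\<close> away, and continuity of \<open>g\<close> makes the displacement harmless. Weighting
  by \<open>v\<close> and averaging recovers the gradient from its inner products with sign vectors.
\<close>

lemma central_difference_mean_consistent:
  fixes f :: "real ^ 'n \<Rightarrow> real" and y :: "nat \<Rightarrow> real ^ 'n"
  assumes grad: "\<And>y. GDERIV f y :> g y"
    and c: "\<And>k. c k > 0" "c \<longlonglongrightarrow> 0"
    and bdd: "bounded (range y)"
    and cont: "\<And>p. cluster_point y p \<Longrightarrow> isCont g p"
  shows "(\<lambda>k. central_difference_mean f (c k) (y k) - g (y k)) \<longlonglongrightarrow> 0"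
proof -
  have "(\<lambda>k. (f (y k + c k *\<^sub>R v) - f (y k - c k *\<^sub>R v)) / (2 * c k) - g (y k) \<bullet> v) \<longlonglongrightarrow> 0" for v
  proof -
    have "\<exists>s. \<bar>s\<bar> \<le> c k \<and> (f (y k + c k *\<^sub>R v) - f (y k - c k *\<^sub>R v)) / (2 * c k) = g (y k + s *\<^sub>R v) \<bullet> v" for k
    proof -
      obtain \<theta> where \<theta>: "0 < \<theta>" "\<theta> < 1"
        "f ((y k - c k *\<^sub>R v) + (2 * c k) *\<^sub>R v) - f (y k - c k *\<^sub>R v)
          = g ((y k - c k *\<^sub>R v) + \<theta> *\<^sub>R (2 * c k) *\<^sub>R v) \<bullet> ((2 * c k) *\<^sub>R v)"
        using gradient_mean_value[OF grad, of "y k - c k *\<^sub>R v" "(2 * c k) *\<^sub>R v"] by blast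
      have eqs: "(y k - c k *\<^sub>R v) + (2 * c k) *\<^sub>R v = y k + c k *\<^sub>R v"
        "(y k - c k *\<^sub>R v) + \<theta> *\<^sub>R (2 * c k) *\<^sub>R v = y k + ((2 * \<theta> - 1) * c k) *\<^sub>R v"
        by (simp_all add: vec_eq_iff algebra_simps)
      have "(f (y k + c k *\<^sub>R v) - f (y k - c k *\<^sub>R v)) / (2 * c k) = g (y k + ((2 * \<theta> - 1) * c k) *\<^sub>R v) \<bullet> v"
        using \<theta>(3)[unfolded eqs] c(1)[of k] by simp
      moreover have "\<bar>2 * \<theta> - 1\<bar> * c k \<le> 1 * c k"
        using \<theta> c(1)[of k] by (intro mult_right_mono) auto
      ultimately show ?thesis
        using c(1)[of k] by (intro exI[of _ "(2 * \<theta> - 1) * c k"]) (simp add: abs_mult)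
    qed
    then obtain s where s: "\<And>k. \<bar>s k\<bar> \<le> c k"
      "\<And>k. (f (y k + c k *\<^sub>R v) - f (y k - c k *\<^sub>R v)) / (2 * c k) = g (y k + s k *\<^sub>R v) \<bullet> v" by metis
    have "s \<longlonglongrightarrow> 0"
      by (rule Lim_null_comparison[OF _ c(2)]) (use s(1) in auto)
    then have "(\<lambda>k. s k *\<^sub>R v) \<longlonglongrightarrow> 0 *\<^sub>R v" by (intro tendsto_scaleR tendsto_const)
    then have "(\<lambda>k. (y k + s k *\<^sub>R v) - y k) \<longlonglongrightarrow> 0" by simp
    from continuous_at_cluster_points_asymptotic[OF bdd this cont]
    have "(\<lambda>k. (g (y k + s k *\<^sub>R v) - g (y k)) \<bullet> v) \<longlonglongrightarrow> 0 \<bullet> v"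
      by (intro tendsto_inner tendsto_const)
    then show ?thesis by (simp add: s(2) inner_diff_left)
  qed
  then have lim: "(\<lambda>k. (\<Sum>v\<in>sign_vectors. ((f (y k + c k *\<^sub>R v) - f (y k - c k *\<^sub>R v)) / (2 * c k) - g (y k) \<bullet> v) * v $ i)
      / 2 ^ CARD('n)) \<longlonglongrightarrow> (\<Sum>v\<in>(sign_vectors :: (real ^ 'n) set). 0 * v $ i) / 2 ^ CARD('n)" for i :: 'n
    by (intro tendsto_divide tendsto_sum tendsto_mult tendsto_const) auto
  have "(\<Sum>v\<in>sign_vectors. ((f (y k + c k *\<^sub>R v) - f (y k - c k *\<^sub>R v)) / (2 * c k) - g (y k) \<bullet> v) * v $ i)
      / 2 ^ CARD('n) = (central_difference_mean f (c k) (y k) - g (y k)) $ i" for i k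
    by (simp add: central_difference_mean_def left_diff_distrib sum_subtractf sum_sign_vectors_isotropic diff_divide_distrib)
  then show ?thesis
    using lim by (intro vec_tendstoI) simp
qed

theorem proposition1:
  fixes M :: "'w measure"
    and f :: "real ^ 'n \<Rightarrow> real"
    and g :: "real ^ 'n \<Rightarrow> real ^ 'n"
    and a c :: "nat \<Rightarrow> real"
    and x xi xihat :: "nat \<Rightarrow> 'w \<Rightarrow> real ^ 'n"
    and ep em :: "nat \<Rightarrow> 'w \<Rightarrow> real"
    and xstar :: "real ^ 'n"
  assumes gradient: "\<And>y. GDERIV f y :> g y"
    and algorithm: "SPSA1_A M f a c x xi xihat ep em"
    and noise: "\<And>k. AE \<omega> in M.
      real_cond_exp M (sigma_iterates_direction M x xi k) (\<lambda>\<omega>. ep k \<omega> - em k \<omega>) \<omega> = 0"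
    and gains_pos: "\<And>k. a k > 0" "\<And>k. c k > 0"
    and gains_limit: "a \<longlonglongrightarrow> 0" "c \<longlonglongrightarrow> 0"
    and gains_sum: "filterlim (\<lambda>N. \<Sum>k<N. a k) at_top sequentially"
      "summable (\<lambda>k. (a k / c k)\<^sup>2)"
    and moments: "\<exists>\<alpha>0>0. \<exists>\<alpha>1>0. \<forall>k.
      (\<integral>\<^sup>+\<omega>. ennreal ((ep k \<omega>)\<^sup>2) \<partial>M) \<le> ennreal \<alpha>0 \<and>
      (\<integral>\<^sup>+\<omega>. ennreal ((em k \<omega>)\<^sup>2) \<partial>M) \<le> ennreal \<alpha>0 \<and>
      (\<integral>\<^sup>+\<omega>. ennreal ((f (x k \<omega> + c k *\<^sub>R xi k \<omega>))\<^sup>2) \<partial>M) \<le> ennreal \<alpha>1 \<and>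
      (\<integral>\<^sup>+\<omega>. ennreal ((f (x k \<omega> - c k *\<^sub>R xi k \<omega>))\<^sup>2) \<partial>M) \<le> ennreal \<alpha>1"
    and bounded_iterates: "AE \<omega> in M. bdd_above (range (\<lambda>k. norm (x k \<omega>)))"
    and stable: "asymptotically_stable (\<lambda>y. - g y) xstar"
    and recurrent: "\<exists>S. compact S \<and> S \<subseteq> attraction_domain (\<lambda>y. - g y) xstar \<and>
      (AE \<omega> in M. infinite {k. x k \<omega> \<in> S})"
    and smooth: "\<exists>K::nat. \<exists>r>0. AE \<omega> in M. \<forall>k\<ge>K.
      third_deriv_continuous_bounded_on f {y. norm (y - x k \<omega>) < r}"
  shows "AE \<omega> in M. (\<lambda>k. x k \<omega>) \<longlonglongrightarrow> xstar"
proof -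
  obtain \<alpha>0 \<alpha>1 where \<alpha>: "\<alpha>0 > 0" "\<alpha>1 > 0" and mom:
    "\<And>k. (\<integral>\<^sup>+\<omega>. ennreal ((ep k \<omega>)\<^sup>2) \<partial>M) \<le> ennreal \<alpha>0"
    "\<And>k. (\<integral>\<^sup>+\<omega>. ennreal ((em k \<omega>)\<^sup>2) \<partial>M) \<le> ennreal \<alpha>0"
    "\<And>k. (\<integral>\<^sup>+\<omega>. ennreal ((f (x k \<omega> + c k *\<^sub>R xi k \<omega>))\<^sup>2) \<partial>M) \<le> ennreal \<alpha>1"
    "\<And>k. (\<integral>\<^sup>+\<omega>. ennreal ((f (x k \<omega> - c k *\<^sub>R xi k \<omega>))\<^sup>2) \<partial>M) \<le> ennreal \<alpha>1"
    using moments by blast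
  obtain S where S: "compact S" "S \<subseteq> attraction_domain (\<lambda>y. - g y) xstar"
    "AE \<omega> in M. infinite {k. x k \<omega> \<in> S}" using recurrent by blast
  obtain K r where r: "r > 0" "AE \<omega> in M. \<forall>k\<ge>K. third_deriv_continuous_bounded_on f {y. norm (y - x k \<omega>) < r}"
    using smooth by blast
  have "continuous_on UNIV f"
    using gradient by (auto simp: continuous_on_eq_continuous_within gderiv_def intro: has_derivative_continuous)
  then have f_borel: "f \<in> borel_measurable borel" by (rule borel_measurable_continuous_onI)
  interpret A: SPSA1_A_moments M f a c x xi xihat ep em
    "\<lambda>k \<omega>. grad_est f (c k) (x k \<omega>) (xi k \<omega>) (ep k \<omega>) (em k \<omega>)" \<alpha>0 \<alpha>1
    using algorithm f_borel gains_pos noise \<alpha> mom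
    by (intro SPSA1_A_moments.intro SPSA1_A_run.intro SPSA1_A_run_axioms.intro SPSA1_A_moments_axioms.intro)
      (auto intro: less_imp_le)
  obtain B where B: "\<And>k. c k \<le> B"
    using convergent_imp_Bseq[OF convergentI[OF gains_limit(2)]] unfolding Bseq_def
    by (metis abs_le_D1 real_norm_def)
  have "AE \<omega> in M. \<forall>i. summable (\<lambda>k. A.fluctuation k i \<omega>)"
    using A.fluctuation_summable[OF B gains_sum(2)] by (simp add: AE_all_countable)
  then show ?thesis
    using bounded_iterates S(3) r(2)
  proof eventually_elim
    case (elim \<omega>)
    define w where "w k = (\<chi> i. A.fluctuation k i \<omega>)" for k
    define b where "b k = central_difference_mean f (c k) (x k \<omega>) - g (x k \<omega>)" for k
    have rec: "x (Suc k) \<omega> = x k \<omega> - a k *\<^sub>R (g (x k \<omega>) + b k) - w k" for k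
      by (simp add: vec_eq_iff w_def b_def A.fluctuation_def)
    have "(\<lambda>N. \<Sum>k<N. w k) \<longlonglongrightarrow> (\<chi> i. \<Sum>k. A.fluctuation k i \<omega>)"
      using elim(1) by (intro vec_tendstoI) (simp add: w_def summable_LIMSEQ)
    then have w: "summable w" by (auto simp: summable_def sums_def)
    have bdd: "bounded (range (\<lambda>k. x k \<omega>))"
      using elim(2) by (auto simp: bounded_iff bdd_above_def)
    have lip: "\<exists>R>0. \<exists>L. L-lipschitz_on (ball p R) g" if p: "cluster_point (\<lambda>k. x k \<omega>) p" for p
    proof -
      obtain k where k: "k \<ge> K" "dist (x k \<omega>) p < r / 2"
        using cluster_pointE[OF p, of "r / 2" K] r(1) by auto
      \<comment> \<open>smoothness is known around the iterates only; an iterate near \<open>p\<close> transfers it to a ball around \<open>p\<close>\<close>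
      have "ball p (r / 2) \<subseteq> {y. norm (y - x k \<omega>) < r}"
      proof
        fix y assume "y \<in> ball p (r / 2)"
        then have "dist y p < r / 2" by (simp add: dist_commute)
        then have "dist y (x k \<omega>) < r" using k(2) dist_triangle_half_l by blast
        then show "y \<in> {y. norm (y - x k \<omega>) < r}" by (simp add: dist_norm)
      qed
      then obtain L where "L-lipschitz_on (ball p (r / 2 / 4)) g"
        using gradient_locally_lipschitz[OF gradient] elim(4) k(1) by metis
      then show ?thesis using r(1) by (intro exI[of _ "r / 2 / 4"]) auto
    qed
    have "isCont g p" if p: "cluster_point (\<lambda>k. x k \<omega>) p" for p
    proof -
      obtain R L where R: "R > 0" "L-lipschitz_on (ball p R) g" using lip[OF p] by blast
      then have "continuous_on (ball p R) g" using lipschitz_on_continuous_on by blast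
      then show ?thesis using R(1) by (simp add: continuous_on_eq_continuous_at)
    qed
    then have b: "b \<longlonglongrightarrow> 0"
      unfolding b_def using central_difference_mean_consistent[OF gradient gains_pos(2) gains_limit(2) bdd] by blast
    show "(\<lambda>k. x k \<omega>) \<longlonglongrightarrow> xstar"
      by (rule gradient_recursion_converges[OF gradient rec gains_pos(1) gains_limit(1) gains_sum(1) b w bdd lip
            stable S(1,2) elim(3)])
  qed
qed

end
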